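(* The metric space $(\mathcal D_K,\Box)$ is geodesic, i.e. any two $X,Y\in\mathcal D_K$ are joined by a constant-speed $\Box$-geodesic lying in $\mathcal D_K$. More generally, if $X,Y\in\mathcal D$ and $\Box(X,Y)<1$, then there is a constant-speed $\Box$-geodesic from $X$ to $Y$ in $\mathcal D$.
   Context: A geometric data set is a triple $(X,F_X,\mu_X)$ where $F_X$ is a nonempty family of real-valued functions (features) on $X$ such that $d_X(x,x'):=\sup_{f\in F_X}|f(x)-f(x')|$ is a (finite) complete separable metric on $X$, and $\mu_X$ is a Borel probability measure on $(X,d_X)$ with full support. $\overline{F_X}$ denotes the closure of $F_X$ in the set of real-valued functions on $X$ under pointwise convergence. $X$ and $Y$ are isomorphic if there is a Borel map $\phi:X\to Y$ with $\phi_*\mu_X=\mu_Y$ and $\overline{F_Y}\circ\phi=\overline{F_X}$. Isomorphic geometric data sets are identified; $\mathcal D$ is the set of isomorphism classes. $K=[-1/2,1/2]$ and $\mathcal D_K\subset\mathcal D$ is the set of classes whose features all take values in $K$. $\mathcal T(\mu,\nu)$ is the set of couplings of $\mu,\nu$ (Borel probability measures on the product with marginals $\mu,\nu$); $\mathrm{pr}_1,\mathrm{pr}_2$ are the coordinate projections; $(d)_H$ is the Hausdorff distance induced by $d$ (possibly $+\infty$). Box distance. For a closed set $S\subset X\times Y$, $d_{\infty,S}(u,v):=\sup_{z\in S}|u(z)-v(z)|$ if $S\ne\varnothing$ and $d_{\infty,\varnothing}:=0$. Then \[\Box(X,Y):=\inf_{\pi\in\mathcal T(\mu_X,\mu_Y),\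 S\subset X\times Y\text{ closed}}\max\{1-\pi(S),\,2(d_{\infty,S})_H(F_X\circ\mathrm{pr}_1,F_Y\circ\mathrm{pr}_2)\},\] which is a metric on $\mathcal D$. A constant-speed $\Box$-geodesic from $X$ to $Y$ is a family $(X_t)_{t\in[0,1]}$ with $X_0=X$, $X_1=Y$ and $\Box(X_s,X_t)=|s-t|\,\Box(X,Y)$ for all $s,t\in[0,1]$. *)

theory Defs
  imports "HOL-Analysis.Analysis" "HOL-Probability.Probability"
begin

text \<open>
  Functions on a carrier \<open>A\<close> are represented as elements of \<open>A \<rightarrow>\<^sub>E UNIV\<close>
  (they take the value \<open>undefined\<close> off \<open>A\<close>), so that equality of features means
  equality on the carrier.
\<close>

record 'a geo_data =
  points :: "'a set"
  features :: "('a \<Rightarrow> real) set"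
  meas :: "'a measure"

text \<open>
  The feature distance is set to \<open>0\<close> off the carrier because the locale
  \<^locale>\<open>Metric_space\<close> asks for a distance that is nonnegative on the whole type.
\<close>

definition feat_dist :: "'a geo_data \<Rightarrow> 'a \<Rightarrow> 'a \<Rightarrow> real" where
  "feat_dist X x y =
     (if x \<in> points X \<and> y \<in> points X then (SUP f\<in>features X. \<bar>f x - f y\<bar>) else 0)"

definition feat_topology :: "'a geo_data \<Rightarrow> 'a topology" where
  "feat_topology X = Metric_space.mtopology (points X) (feat_dist X)"

definition borel_space :: "'a topology \<Rightarrow> 'a measure" where
  "borel_space T = sigma (topspace T) {U. openin T U}"

definition geo_data_set :: "'a geo_data \<Rightarrow> bool" where
  "geo_data_set X \<longleftrightarrow>
     features X \<noteq> {} \<and>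
     features X \<subseteq> points X \<rightarrow>\<^sub>E UNIV \<and>
     (\<forall>x\<in>points X. \<forall>y\<in>points X. bdd_above ((\<lambda>f. \<bar>f x - f y\<bar>) ` features X)) \<and>
     Metric_space (points X) (feat_dist X) \<and>
     Metric_space.mcomplete (points X) (feat_dist X) \<and>
     separable_space (feat_topology X) \<and>
     space (meas X) = points X \<and>
     sets (meas X) = sets (borel_space (feat_topology X)) \<and>
     prob_space (meas X) \<and>
     (\<forall>U. openin (feat_topology X) U \<and> U \<noteq> {} \<longrightarrow> emeasure (meas X) U > 0)"

text \<open>The topology \<^term>\<open>powertop_real A\<close> on \<open>A \<rightarrow>\<^sub>E UNIV\<close> is that of pointwise convergence.\<close>

definition feat_closure :: "'a geo_data \<Rightarrow> ('a \<Rightarrow> real) set" where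
  "feat_closure X = powertop_real (points X) closure_of features X"

definition isomorphic :: "'a geo_data \<Rightarrow> 'b geo_data \<Rightarrow> bool" where
  "isomorphic X Y \<longleftrightarrow>
     (\<exists>\<phi> \<in> measurable (meas X) (meas Y).
        distr (meas X) (meas Y) \<phi> = meas Y \<and>
        (\<lambda>f. compose (points X) f \<phi>) ` feat_closure Y = feat_closure X)"

definition couplings :: "'a geo_data \<Rightarrow> 'b geo_data \<Rightarrow> ('a \<times> 'b) measure set" where
  "couplings X Y =
     {\<pi>. sets \<pi> = sets (borel_space (prod_topology (feat_topology X) (feat_topology Y))) \<and>
         prob_space \<pi> \<and>
         distr \<pi> (meas X) fst = meas X \<and> distr \<pi> (meas Y) snd = meas Y}"

text \<open>In \<^typ>\<open>ennreal\<close> the supremum over the empty set is \<open>0\<close>, as required.\<close>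

definition sup_dist :: "'c set \<Rightarrow> ('c \<Rightarrow> real) \<Rightarrow> ('c \<Rightarrow> real) \<Rightarrow> ennreal" where
  "sup_dist S u v = (SUP z\<in>S. ennreal \<bar>u z - v z\<bar>)"

definition hausdorff_dist :: "('c \<Rightarrow> 'c \<Rightarrow> ennreal) \<Rightarrow> 'c set \<Rightarrow> 'c set \<Rightarrow> ennreal" where
  "hausdorff_dist d A B =
     max (SUP a\<in>A. INF b\<in>B. d a b) (SUP b\<in>B. INF a\<in>A. d a b)"

text \<open>
  The infimum is at most \<open>1\<close> for geometric data sets (take the product coupling and \<open>S = {}\<close>),
  so \<^const>\<open>enn2real\<close> loses nothing there.
\<close>

definition box_dist :: "'a geo_data \<Rightarrow> 'b geo_data \<Rightarrow> real" where
  "box_dist X Y = enn2real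
     (INF \<pi>\<in>couplings X Y.
      INF S\<in>{S. closedin (prod_topology (feat_topology X) (feat_topology Y)) S}.
        max (1 - emeasure \<pi> S)
            (2 * hausdorff_dist (sup_dist S)
                   ((\<lambda>f. f \<circ> fst) ` features X) ((\<lambda>g. g \<circ> snd) ` features Y)))"

text \<open>
  Every isomorphism class has a representative whose carrier is a subset of \<^typ>\<open>real\<close>
  (with a metric and topology unrelated to those of the real line), because a separable metric
  space has at most continuum many points.  Hence \<^typ>\<open>real geo_data\<close> suffices to form the set
  of all isomorphism classes.
\<close>

lemma borel_space_simps:
  shows "sets (borel_space U) = sigma_sets (topspace U) {V. openin U V}"
          "space (borel_space U) = topspace U"
    unfolding borel_space_def by (auto intro!: sets_measure_of dest: openin_subset simp: space_measure_of_conv)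

lemma data_set_lepoll_real:
  assumes "geo_data_set X"
  shows "points X \<lesssim> (UNIV :: real set)"
proof -
  interpret M: Metric_space "points X" "feat_dist X"
    using assms by (simp add: geo_data_set_def)
  have T: "feat_topology X = M.mtopology" by (simp add: feat_topology_def)
  obtain C where C: "countable C" "C \<subseteq> points X" "M.mtopology closure_of C = points X"
    using assms unfolding geo_data_set_def separable_space_def T by auto
  define q where "q = from_nat_into C"
  define e where "e x = {n. feat_dist X x (q (fst (prod_decode n))) < inverse (real (Suc (snd (prod_decode n))))}" for x
  have "inj_on e (points X)"
  proof (rule inj_onI, rule ccontr)
    fix x y assume x: "x \<in> points X" and y: "y \<in> points X" and eq: "e x = e y" and ne: "x \<noteq> y"
    have pos: "feat_dist X x y > 0" using x y ne M.nonneg[of x y] M.zero[of x y] by linarith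
    then obtain k where k: "inverse (real (Suc k)) < feat_dist X x y / 2"
      using reals_Archimedean[of "feat_dist X x y / 2"] by auto
    have "x \<in> M.mtopology closure_of C" using C x by simp
    then obtain c where c: "c \<in> C" "feat_dist X x c < inverse (real (Suc k))"
      unfolding M.metric_closure_of by (auto simp: M.in_mball dest!: spec[of _ "inverse (real (Suc k))"])
    have "C \<noteq> {}" using c by auto
    then obtain i where i: "q i = c" using from_nat_into_surj[OF C(1) c(1)] q_def by auto
    have "prod_encode (i,k) \<in> e x" using c i by (simp add: e_def)
    then have "prod_encode (i,k) \<in> e y" using eq by simp
    then have "feat_dist X y c < inverse (real (Suc k))" using i by (simp add: e_def)
    moreover have "feat_dist X x y \<le> feat_dist X x c + feat_dist X c y"
      using x y c C by (intro M.triangle) auto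
    ultimately show False using c k M.commute[of c y] by linarith
  qed
  then have "points X \<lesssim> (UNIV :: nat set set)" by (auto simp: lepoll_def)
  then show ?thesis
    using nat_sets_eqpoll_reals lepoll_trans2 by blast
qed

lemma geo_data_set_real_representative:
  fixes X :: "'a geo_data"
  assumes gX: "geo_data_set X"
  shows "\<exists>Z :: real geo_data. geo_data_set Z \<and> isomorphic X Z"
proof -
  note g = gX[unfolded geo_data_set_def]
  obtain h :: "'a \<Rightarrow> real" where h: "inj_on h (points X)"
    using data_set_lepoll_real[OF gX] by (auto simp: lepoll_def)
  define P where "P = h ` points X"
  define k where "k = inv_into (points X) h"
  have kh: "k (h x) = x" if "x \<in> points X" for x using h that by (simp add: k_def)
  have hk: "h (k z) = z" "k z \<in> points X" if "z \<in> P" for z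
    using that by (simp_all add: k_def P_def f_inv_into_f inv_into_into)
  have hP: "h x \<in> P" if "x \<in> points X" for x using that by (simp add: P_def)
  define F where "F = (\<lambda>f. compose P f k) ` features X"
  define Z0 where "Z0 = \<lparr>points = P, features = F, meas = undefined\<rparr>"
  define T where "T = feat_topology Z0"
  define Z where "Z = \<lparr>points = P, features = F, meas = distr (meas X) (borel_space T) h\<rparr>"
  have sel: "points Z = P" "features Z = F" "meas Z = distr (meas X) (borel_space T) h"
    by (simp_all add: Z_def)
  have dZ0: "feat_dist Z = feat_dist Z0" by (simp add: fun_eq_iff feat_dist_def Z_def Z0_def)
  have TZ: "feat_topology Z = T" by (simp add: T_def feat_topology_def dZ0) (simp add: Z_def Z0_def)
  have d: "feat_dist Z (h x) (h y) = feat_dist X x y" if "x \<in> points X" "y \<in> points X" for x y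
    using that by (simp add: feat_dist_def sel F_def image_image compose_def hP kh)
  have d': "feat_dist Z z w = feat_dist X (k z) (k w)" if "z \<in> P" "w \<in> P" for z w
    using d[of "k z" "k w"] that by (simp add: hk)
  have d0: "feat_dist Z z w = 0" if "\<not> (z \<in> P \<and> w \<in> P)" for z w
    using that by (auto simp add: feat_dist_def sel)
  interpret M1: Metric_space "points X" "feat_dist X" using g by simp
  interpret M2: Metric_space P "feat_dist Z"
  proof
    fix x y show "0 \<le> feat_dist Z x y"
      using d'[of x y] d0[of x y] by (cases "x \<in> P \<and> y \<in> P") auto
  next
    fix x y show "feat_dist Z x y = feat_dist Z y x"
      using d'[of x y] d'[of y x] d0[of x y] d0[of y x] M1.commute[of "k x" "k y"]
      by (cases "x \<in> P \<and> y \<in> P") auto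
  next
    fix x y assume "x \<in> P" "y \<in> P"
    then show "(feat_dist Z x y = 0) = (x = y)" using d' hk M1.zero by metis
  next
    fix x y z assume "x \<in> P" "y \<in> P" "z \<in> P"
    then show "feat_dist Z x z \<le> feat_dist Z x y + feat_dist Z y z"
      using d' hk M1.triangle by metis
  qed
  interpret MM: Metric_space12 "points X" "feat_dist X" P "feat_dist Z" ..
  have TX: "feat_topology X = M1.mtopology" by (simp add: feat_topology_def)
  have TM: "T = M2.mtopology" using TZ by (simp add: feat_topology_def sel)
  have hom: "homeomorphic_map M1.mtopology M2.mtopology h"
    by (rule MM.isometry_imp_homeomorphic_map) (auto simp: P_def d)
  have hc: "continuous_map M1.mtopology M2.mtopology h"
    using hom by (rule homeomorphic_imp_continuous_map)
  have sep: "separable_space T"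
    using g homeomorphic_separable_space[of M1.mtopology M2.mtopology] hom
    by (auto simp: TX TM homeomorphic_space)
  have comp1: "M1.mcomplete" using g by simp
  have comp: "M2.mcomplete"
    unfolding M2.mcomplete_def
  proof (intro allI impI)
    fix s assume s: "M2.MCauchy s"
    then have sP: "s n \<in> P" for n by (auto simp: M2.MCauchy_def)
    have "M1.MCauchy (k \<circ> s)"
      using s sP by (auto simp: M1.MCauchy_def M2.MCauchy_def hk d' image_subset_iff)
    then obtain x where "limitin M1.mtopology (k \<circ> s) x sequentially"
      using comp1 unfolding M1.mcomplete_def by blast
    then have "limitin M2.mtopology (h \<circ> (k \<circ> s)) (h x) sequentially"
      by (rule continuous_map_limit[OF hc])
    moreover have "h \<circ> (k \<circ> s) = s" using sP by (auto simp: hk)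
    ultimately show "\<exists>x. limitin M2.mtopology s x sequentially" by auto
  qed
  have top1: "space (meas X) = points X" using g by simp
  have s1: "sets (meas X) = sigma_sets (points X) {U. openin M1.mtopology U}"
    using g borel_space_simps(1)[of M1.mtopology] unfolding TX by simp
  have bs: "space (borel_space T) = P" "sets (borel_space T) = sigma_sets P {U. openin M2.mtopology U}"
    using borel_space_simps[of M2.mtopology] unfolding TM by simp_all
  have hm: "h \<in> measurable (meas X) (borel_space T)"
    unfolding borel_space_def TM
  proof (rule measurable_measure_of)
    show "{U. openin M2.mtopology U} \<subseteq> Pow (topspace M2.mtopology)" using openin_subset by blast
    show "h \<in> space (meas X) \<rightarrow> topspace M2.mtopology" by (auto simp: top1 hP)
    fix y assume "y \<in> {U. openin M2.mtopology U}"
    then have "openin M1.mtopology {x \<in> topspace M1.mtopology. h x \<in> y}"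
      by (intro openin_continuous_map_preimage[OF hc]) simp
    moreover have "{x \<in> topspace M1.mtopology. h x \<in> y} = h -` y \<inter> space (meas X)" by (auto simp: top1)
    ultimately show "h -` y \<inter> space (meas X) \<in> sets (meas X)" by (auto simp: s1)
  qed
  have ps: "prob_space (meas Z)" unfolding sel using g hm by (intro prob_space.prob_space_distr) auto
  have supp: "emeasure (meas Z) U > 0" if U: "openin T U" "U \<noteq> {}" for U
  proof -
    have US: "U \<in> sets (borel_space T)" using U unfolding bs by (simp add: TM sigma_sets.Basic)
    have o: "openin M1.mtopology {x \<in> topspace M1.mtopology. h x \<in> U}"
      using U TM by (intro openin_continuous_map_preimage[OF hc]) simp
    have eq: "{x \<in> topspace M1.mtopology. h x \<in> U} = h -` U \<inter> space (meas X)" by (auto simp: top1)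
    obtain z where "z \<in> U" "z \<in> P" using U openin_subset[of M2.mtopology U] TM by auto
    then have "k z \<in> h -` U \<inter> space (meas X)" by (simp add: hk top1)
    then have "emeasure (meas X) (h -` U \<inter> space (meas X)) > 0"
      using g o eq by (auto simp: TX)
    then show ?thesis unfolding sel using hm US by (simp add: emeasure_distr)
  qed
  have bdd: "bdd_above ((\<lambda>f. \<bar>f x - f y\<bar>) ` features Z)" if "x \<in> P" "y \<in> P" for x y
    using g that hk by (auto simp: sel F_def image_image compose_def)
  have gZ: "geo_data_set Z"
    unfolding geo_data_set_def TZ sel(1)
  proof (intro conjI)
    show "features Z \<noteq> {}" using g by (simp add: sel F_def)
    show "features Z \<subseteq> P \<rightarrow>\<^sub>E UNIV" by (auto simp: sel F_def compose_def)
    show "space (meas Z) = P" "sets (meas Z) = sets (borel_space T)" by (simp_all add: sel bs)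
  qed (simp_all add: M2.Metric_space_axioms comp sep ps supp bdd)
  define A where "A = powertop_real (points X)"
  define B where "B = powertop_real P"
  define a where "a f = compose P f k" for f :: "'a \<Rightarrow> real"
  define b where "b f = compose (points X) f h" for f :: "real \<Rightarrow> real"
  have tA: "topspace A = points X \<rightarrow>\<^sub>E UNIV" "topspace B = P \<rightarrow>\<^sub>E UNIV" by (simp_all add: A_def B_def)
  have ab: "a (b f) = f" if "f \<in> P \<rightarrow>\<^sub>E UNIV" for f
    using that by (auto simp: a_def b_def compose_def fun_eq_iff hk PiE_def extensional_def)
  have ba: "b (a f) = f" if "f \<in> points X \<rightarrow>\<^sub>E UNIV" for f
    using that by (auto simp: a_def b_def compose_def fun_eq_iff kh hP PiE_def extensional_def)
  have ca: "continuous_map A B a"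
    unfolding A_def B_def a_def
    by (subst continuous_map_componentwise) (auto simp: compose_def hk intro: continuous_map_product_projection)
  have cb: "continuous_map B A b"
    unfolding A_def B_def b_def
    by (subst continuous_map_componentwise) (auto simp: compose_def hP intro: continuous_map_product_projection)
  have hb: "homeomorphic_map B A b"
    using ca cb ab ba by (intro homeomorphic_maps_imp_map[where g=a]) (auto simp: homeomorphic_maps_def tA)
  have FX: "features X \<subseteq> topspace A" "F \<subseteq> topspace B" 
    using g by (auto simp: tA F_def compose_def)
  have "b ` F = (\<lambda>f. b (a f)) ` features X" by (simp add: F_def a_def image_image)
  also have "\<dots> = id ` features X"
    using FX(1) unfolding tA by (intro image_cong) (auto simp: ba subset_iff)
  also have "\<dots> = features X" by simp
  finally have bF: "b ` F = features X" .
  have "A closure_of (b ` F) = b ` (B closure_of F)"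
    using homeomorphic_map_closure_of[OF hb FX(2)] .
  then have "b ` feat_closure Z = feat_closure X"
    by (simp add: feat_closure_def sel bF A_def[symmetric] B_def[symmetric])
  moreover have "h \<in> measurable (meas X) (meas Z)" using hm by (simp add: sel)
  moreover have "distr (meas X) (meas Z) h = meas Z" unfolding sel by (intro distr_cong) auto
  ultimately have "isomorphic X Z" unfolding isomorphic_def b_def by blast
  then show ?thesis using gZ by blast
qed

definition iso_rel :: "(real geo_data \<times> real geo_data) set" where
  "iso_rel = {(X, Y). geo_data_set X \<and> geo_data_set Y \<and> isomorphic X Y}"

definition data_sets :: "real geo_data set set" where
  "data_sets = {X. geo_data_set X} // iso_rel"

definition data_sets_K :: "real geo_data set set" where
  "data_sets_K =
     {C \<in> data_sets. \<forall>X\<in>C. \<forall>f\<in>features X. \<forall>x\<in>points X. f x \<in> {-1/2..1/2}}"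

text \<open>
  The box distance is invariant under isomorphism, so the choice of representatives is immaterial.
\<close>

definition box_class :: "real geo_data set \<Rightarrow> real geo_data set \<Rightarrow> real" where
  "box_class A B = box_dist (SOME X. X \<in> A) (SOME Y. Y \<in> B)"

definition box_geodesic :: "(real \<Rightarrow> real geo_data set) \<Rightarrow> real geo_data set \<Rightarrow> real geo_data set \<Rightarrow> bool" where
  "box_geodesic \<gamma> A B \<longleftrightarrow>
     \<gamma> 0 = A \<and> \<gamma> 1 = B \<and>
     (\<forall>s\<in>{0..1}. \<forall>t\<in>{0..1}. box_class (\<gamma> s) (\<gamma> t) = \<bar>s - t\<bar> * box_class A B)"

end

theory Submission
  imports Defs
begin

text \<open>
  Let \<open>D = \<box>(X,Y)\<close>.  If \<open>D < 1\<close>, the infimum is attained by a coupling \<open>\<pi>\<close> and a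
  set \<open>S\<close> with \<open>\<pi>(S) \<ge> 1 - D\<close>: take an ultralimit of nearly optimal couplings and sets; since the
  sets have mass bounded below, matching features stay bounded and have pointwise ultralimits.
  For \<open>D = 1\<close> with features in \<open>K\<close>, \<open>S = {}\<close> does.  Let \<open>(f, g)\<close> range over the
  pairs in the closures of the two feature sets with \<open>\<bar>f - g\<bar> \<le> D/2\<close> on \<open>S\<close>.  On
  \<open>(X \<times> Y) \<times> [0,1]\<close> with \<open>\<pi>\<close> times Lebesgue measure, let \<open>h\<^sub>t\<close> be
  \<open>(1 - t) f + t g\<close> over \<open>S\<close>; off \<open>S\<close>, at height \<open>u\<close>, let it be \<open>f\<close> if
  \<open>t \<le> u\<close> and \<open>g\<close> otherwise.  The functions \<open>h\<^sub>t\<close> generate a geometric data set \<open>X\<^sub>t\<close>.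
  For \<open>s \<le> t\<close>, \<open>\<bar>h\<^sub>s - h\<^sub>t\<bar> \<le> (t - s) D/2\<close> outside a set of mass at most
  \<open>(t - s) D\<close>, so \<open>\<box>(X\<^sub>s, X\<^sub>t) \<le> (t - s) D\<close>; the triangle inequality turns this into equality.
\<close>

section \<open>A single geometric data set\<close>

text \<open>Off \<open>S\<close> the functions f and g are unrelated, so a linear passage from one
  to the other has no speed bound there. Switching at a random height instead trades the size of the
  change for the mass on which it happens, and the box distance charges mass and twice the feature
  error at the same rate; this is also why matched features are allowed an error of half the
  distance. The generated data set must have finite distance: one point of \<open>S\<close> bounds
  |f x - g y| for all matched pairs at once, and where \<open>S\<close> is empty boundedness of the
  features has to replace it. A single ultrafilter serves uncountably many features simultaneously,
  but it yields only elements of the feature closures, so upper bounds for the distance must accept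
  these (\<open>box_distI\<close>). The measure theory is reduced to countable measurable partitions
  into cells of small diameter (\<open>cells\<close>): they give tightness, gluing, the limit set
  and the measurability of the quotient map.\<close>

lemma feat_closure_iff:
  assumes "features X \<subseteq> points X \<rightarrow>\<^sub>E UNIV"
  shows "g \<in> feat_closure X \<longleftrightarrow> g \<in> points X \<rightarrow>\<^sub>E UNIV \<and>
    (\<forall>A e. finite A \<and> A \<subseteq> points X \<and> e > 0 \<longrightarrow> (\<exists>f\<in>features X. \<forall>a\<in>A. \<bar>f a - g a\<bar> < e))"
proof
  assume g: "g \<in> feat_closure X"
  have gE: "g \<in> points X \<rightarrow>\<^sub>E UNIV" using g by (auto simp: feat_closure_def in_closure_of)
  moreover have "\<exists>f\<in>features X. \<forall>a\<in>A. \<bar>f a - g a\<bar> < e"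
    if A: "finite A" "A \<subseteq> points X" "e > 0" for A e
  proof -
    define U where "U = (\<Pi>\<^sub>E i\<in>points X. if i \<in> A then {g i - e<..<g i + e} else (UNIV :: real set))"
    have "openin (powertop_real (points X)) U"
      unfolding U_def using A by (intro product_topology_basis) (auto intro: finite_subset[of _ A] split: if_splits)
    moreover have "g \<in> U" using gE A by (auto simp: U_def PiE_iff)
    ultimately obtain f where f: "f \<in> features X" "f \<in> U"
      using g unfolding feat_closure_def in_closure_of by blast
    have "\<bar>f a - g a\<bar> < e" if "a \<in> A" for a
    proof -
      have "f a \<in> {g a - e<..<g a + e}" using f(2) that A by (force simp: U_def PiE_iff)
      then show ?thesis by auto
    qed
    with f show ?thesis by blast
  qed
  ultimately show "g \<in> points X \<rightarrow>\<^sub>E UNIV \<and>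
    (\<forall>A e. finite A \<and> A \<subseteq> points X \<and> e > 0 \<longrightarrow> (\<exists>f\<in>features X. \<forall>a\<in>A. \<bar>f a - g a\<bar> < e))" by blast
next
  assume g: "g \<in> points X \<rightarrow>\<^sub>E UNIV \<and>
    (\<forall>A e. finite A \<and> A \<subseteq> points X \<and> e > 0 \<longrightarrow> (\<exists>f\<in>features X. \<forall>a\<in>A. \<bar>f a - g a\<bar> < e))"
  show "g \<in> feat_closure X"
    unfolding feat_closure_def in_closure_of
  proof (intro conjI allI impI)
    show "g \<in> topspace (powertop_real (points X))" using g by simp
    fix T assume T: "g \<in> T \<and> openin (powertop_real (points X)) T"
    have "\<exists>W. finite {i \<in> points X. W i \<noteq> topspace euclideanreal} \<and>
        (\<forall>i\<in>points X. openin euclideanreal (W i)) \<and> g \<in> Pi\<^sub>E (points X) W \<and> Pi\<^sub>E (points X) W \<subseteq> T"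
      by (rule bspec[OF conjunct2[OF T, unfolded openin_product_topology_alt] conjunct1[OF T]])
    then obtain W where W: "finite {i \<in> points X. W i \<noteq> topspace euclideanreal}"
        "\<forall>i\<in>points X. openin euclideanreal (W i)" "g \<in> Pi\<^sub>E (points X) W" "Pi\<^sub>E (points X) W \<subseteq> T"
      by (elim exE conjE)
    define A where "A = {i \<in> points X. W i \<noteq> UNIV}"
    have fA: "finite A" "A \<subseteq> points X" using W by (auto simp: A_def)
    have "\<exists>e>0. ball (g i) e \<subseteq> W i" if "i \<in> A" for i
    proof -
      have "open (W i)" "g i \<in> W i" using W that fA by (auto simp: PiE_iff)
      then show ?thesis using open_contains_ball by blast
    qed
    then obtain r where r: "\<And>i. i \<in> A \<Longrightarrow> r i > 0 \<and> ball (g i) (r i) \<subseteq> W i" by metis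
    \<comment> \<open>Inserting 1 keeps the minimum defined and positive when \<open>A\<close> is
      empty.\<close>
    define e where "e = Min (insert 1 (r ` A))"
    have e: "e > 0" using fA r by (simp add: e_def)
    have er: "e \<le> r i" if "i \<in> A" for i using fA that by (simp add: e_def)
    obtain f where f: "f \<in> features X" "\<forall>a\<in>A. \<bar>f a - g a\<bar> < e" using g fA e by blast
    have "f i \<in> W i" if "i \<in> points X" for i
    proof (cases "i \<in> A")
      case True
      then have "f i \<in> ball (g i) (r i)" using f er[OF True] by (force simp: dist_real_def abs_minus_commute)
      then show ?thesis using r True by blast
    qed (use that in \<open>auto simp: A_def\<close>)
    moreover have "f \<in> points X \<rightarrow>\<^sub>E UNIV" using f assms by blast
    ultimately have "f \<in> Pi\<^sub>E (points X) W" by (auto simp: PiE_iff)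
    then show "\<exists>y. y \<in> features X \<and> y \<in> T" using f W by blast
  qed
qed

locale geo =
  fixes X :: "'a geo_data"
  assumes geo: "geo_data_set X"
begin

lemma F_ne: "features X \<noteq> {}" and F_ext: "features X \<subseteq> points X \<rightarrow>\<^sub>E UNIV"
  and space_meas [simp]: "space (meas X) = points X"
  and prob_meas: "prob_space (meas X)"
  and bdd_F: "\<And>x y. x \<in> points X \<Longrightarrow> y \<in> points X \<Longrightarrow> bdd_above ((\<lambda>f. \<bar>f x - f y\<bar>) ` features X)"
  using geo by (auto simp: geo_data_set_def)

sublocale Metric_space "points X" "feat_dist X"
  using geo by (simp add: geo_data_set_def)

sublocale prob_space "meas X" by (rule prob_meas)

lemma top_eq: "feat_topology X = mtopology" by (simp add: feat_topology_def)

lemma complete: mcomplete and sep: "separable_space mtopology"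
  and support: "\<And>U. openin mtopology U \<Longrightarrow> U \<noteq> {} \<Longrightarrow> emeasure (meas X) U > 0"
  using geo by (auto simp: geo_data_set_def top_eq)

lemma sets_meas: "sets (meas X) = sigma_sets (points X) {U. openin mtopology U}"
  using geo by (simp add: geo_data_set_def top_eq borel_space_simps)

lemma open_sets: "openin mtopology U \<Longrightarrow> U \<in> sets (meas X)"
  by (simp add: sets_meas sigma_sets.Basic)

lemma closed_sets: "closedin mtopology U \<Longrightarrow> U \<in> sets (meas X)"
  using sets.compl_sets[OF open_sets[of "points X - U"]] 
  by (auto simp: closedin_def double_diff)

lemma F_closure: "features X \<subseteq> feat_closure X"
  using F_ext unfolding feat_closure_def by (intro closure_of_subset) auto

lemma feature_lipschitz:
  assumes "f \<in> features X" "x \<in> points X" "y \<in> points X"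
  shows "\<bar>f x - f y\<bar> \<le> feat_dist X x y"
  using assms bdd_F by (auto simp: feat_dist_def intro!: cSUP_upper)

text \<open>Only two points are involved, so the bound passes to pointwise limits; elements of the
  closure can then stand in for features.\<close>

lemma closure_lipschitz:
  assumes "f \<in> feat_closure X" "x \<in> points X" "y \<in> points X"
  shows "\<bar>f x - f y\<bar> \<le> feat_dist X x y"
proof (rule field_le_epsilon)
  fix e :: real assume "e > 0"
  then obtain g where g: "g \<in> features X" "\<forall>a\<in>{x,y}. \<bar>g a - f a\<bar> < e/2"
    using assms(1)[unfolded feat_closure_iff[OF F_ext]] assms(2,3) 
    by (metis empty_subsetI finite.emptyI finite.insertI half_gt_zero insert_subset)
  then have "\<bar>g x - f x\<bar> < e/2" "\<bar>g y - f y\<bar> < e/2" by auto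
  then show "\<bar>f x - f y\<bar> \<le> feat_dist X x y + e"
    using feature_lipschitz[OF g(1) assms(2,3)] by linarith
qed

text \<open>Label a point by the first ball of half the scale, around a dense sequence, that
  contains it; two points with the same label share a ball. These partitions carry the separability
  of \<open>X\<close> into the later measure-theoretic arguments.\<close>

lemma cells:
  "\<exists>c :: nat \<Rightarrow> 'a \<Rightarrow> nat. (\<forall>k. c k \<in> measurable (meas X) (count_space UNIV)) \<and>
    (\<forall>k. \<forall>x\<in>points X. \<forall>y\<in>points X. c k x = c k y \<longrightarrow> feat_dist X x y < inverse (real (Suc k)))"
proof -
  obtain C where C: "countable C" "C \<subseteq> points X" "mtopology closure_of C = points X"
    using sep unfolding separable_space_def by auto
  define q where "q = from_nat_into C"
  define c where "c k x = (LEAST n. x \<in> mball (q n) (inverse (real (Suc k)) / 2))" for k x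
  have ex: "\<exists>n. x \<in> mball (q n) r" if "x \<in> points X" and r: "r > 0" for x r
  proof -
    have "x \<in> mtopology closure_of C" using C that by simp
    then obtain y where y: "y \<in> C" "y \<in> mball x r" using r unfolding metric_closure_of mem_Collect_eq by blast
    then obtain i where "q i = y" using from_nat_into_surj[OF C(1) y(1)] q_def by auto
    then show ?thesis using y commute by (auto simp: in_mball)
  qed
  show ?thesis
  proof (intro exI[of _ c] conjI allI ballI impI)
    fix k
    have "{x\<in>space (meas X). x \<in> mball (q n) (inverse (real (Suc k)) / 2)} = mball (q n) (inverse (real (Suc k)) / 2)" for n
      by auto
    moreover have "mball (q n) (inverse (real (Suc k)) / 2) \<in> sets (meas X)" for n
      using open_sets by blast
    ultimately have [measurable]: "Measurable.pred (meas X) (\<lambda>x. x \<in> mball (q n) (inverse (real (Suc k)) / 2))" for n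
      unfolding pred_def by metis
    show "c k \<in> measurable (meas X) (count_space UNIV)" unfolding c_def by measurable
  next
    fix k x y assume xy: "x \<in> points X" "y \<in> points X" "c k x = c k y"
    have r: "inverse (real (Suc k)) / 2 > 0" by simp
    have "x \<in> mball (q (c k x)) (inverse (real (Suc k)) / 2)" unfolding c_def by (rule LeastI_ex[OF ex[OF xy(1) r]])
    moreover have "y \<in> mball (q (c k y)) (inverse (real (Suc k)) / 2)" unfolding c_def by (rule LeastI_ex[OF ex[OF xy(2) r]])
    ultimately show "feat_dist X x y < inverse (real (Suc k))"
      using xy triangle[of x "q (c k x)" y] commute[of x "q (c k x)"] by (auto simp: in_mball)
  qed
qed

lemma open_cells:
  assumes "openin mtopology U" "x \<in> U"
  shows "\<exists>k. \<forall>y\<in>points X. feat_dist X x y < inverse (real (Suc k)) \<longrightarrow> y \<in> U"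
proof -
  obtain r where r: "r > 0" "mball x r \<subseteq> U" using assms openin_mtopology by blast
  obtain k where "inverse (real (Suc k)) < r" using reals_Archimedean[OF r(1)] by blast
  moreover have "x \<in> points X" using assms openin_subset by fastforce
  ultimately have "\<forall>y\<in>points X. feat_dist X x y < inverse (real (Suc k)) \<longrightarrow> y \<in> U"
    using r(2) by (auto simp: in_mball subset_iff)
  then show ?thesis by blast
qed

lemma feature_continuous:
  assumes "f \<in> feat_closure X"
  shows "continuous_map mtopology euclideanreal f"
proof -
  have "openin mtopology {x \<in> points X. f x \<in> U}" if "open U" for U
    unfolding openin_mtopology
  proof (intro conjI allI impI)
    fix x assume x: "x \<in> {x \<in> points X. f x \<in> U}"
    then obtain e where e: "e > 0" "ball (f x) e \<subseteq> U" using \<open>open U\<close> open_contains_ball by blast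
    have "mball x e \<subseteq> {x \<in> points X. f x \<in> U}"
    proof
      fix y assume y: "y \<in> mball x e"
      then have "\<bar>f x - f y\<bar> < e" using closure_lipschitz[OF assms, of x y] by (auto simp: in_mball)
      then have "f y \<in> ball (f x) e" by (simp add: dist_real_def)
      then show "y \<in> {x \<in> points X. f x \<in> U}" using y e by (auto simp: in_mball)
    qed
    then show "\<exists>r>0. mball x r \<subseteq> {x \<in> points X. f x \<in> U}" using e by blast
  qed auto
  then show ?thesis by (simp add: continuous_map)
qed

text \<open>The sets squeezed between a closed and an open set with small gap form a sigma-algebra,
  and open sets belong to it because they are F-sigma in a metric space.\<close>

lemma open_closed_approx:
  assumes "A \<in> sets (meas X)" "e > 0"
  shows "\<exists>C U. closedin mtopology C \<and> openin mtopology U \<and> C \<subseteq> A \<and> A \<subseteq> U \<and> measure (meas X) (U - C) < e"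
proof -
  define R where "R A \<longleftrightarrow> (\<forall>e>0. \<exists>C U. closedin mtopology C \<and> openin mtopology U \<and> C \<subseteq> A \<and> A \<subseteq> U \<and> measure (meas X) (U - C) < e)" for A
  have "A \<in> sigma_sets (points X) {U. openin mtopology U}" using assms by (simp add: sets_meas)
  then have "R A"
  proof (induction rule: sigma_sets.induct)
    case (Basic U)
    then have U: "openin mtopology U" by simp
    then have "fsigma_in mtopology U" using open_imp_fsigma_in metrizable_space_mtopology by blast
    then obtain C where C: "\<And>n. closedin mtopology (C n)" "\<And>n. C n \<subseteq> C (Suc n)" "\<Union>(range C) = U"
      unfolding fsigma_in_ascending by (metis)
    have "range C \<subseteq> sets (meas X)" using C closed_sets by auto
    then have "(\<lambda>n. prob (C n)) \<longlonglongrightarrow> prob (\<Union>(range C))"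
      using C(2) by (intro finite_Lim_measure_incseq) (auto intro: incseq_SucI)
    then have lim: "(\<lambda>n. prob (C n)) \<longlonglongrightarrow> prob U" using C by simp
    show ?case unfolding R_def
    proof (intro allI impI)
      fix e :: real assume "e > 0"
      then have "eventually (\<lambda>n. prob (C n) > prob U - e) sequentially"
        using lim by (intro order_tendstoD(1)) auto
      then obtain n where n: "prob (C n) > prob U - e" by (auto simp: eventually_sequentially)
      have "C n \<subseteq> U" using C by auto
      moreover have "prob (U - C n) = prob U - prob (C n)"
        using \<open>C n \<subseteq> U\<close> U C by (intro finite_measure_Diff open_sets closed_sets)
      ultimately show "\<exists>C V. closedin mtopology C \<and> openin mtopology V \<and> C \<subseteq> U \<and> U \<subseteq> V \<and> prob (V - C) < e"
        using U C n by (intro exI[of _ "C n"] exI[of _ U]) auto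
    qed
  next
    case Empty
    show ?case unfolding R_def by (intro allI impI exI[of _ "{}"]) auto
  next
    case (Compl a)
    show ?case unfolding R_def
    proof (intro allI impI)
      fix e :: real assume "e > 0"
      then obtain C U where CU: "closedin mtopology C" "openin mtopology U" "C \<subseteq> a" "a \<subseteq> U" "prob (U - C) < e"
        using Compl.IH unfolding R_def by metis
      \<comment> \<open>Complements exchange the two approximants and keep the gap.\<close>
      have "U \<subseteq> points X" using openin_subset[OF CU(2)] by simp
      then have "(points X - C) - (points X - U) = U - C" by auto
      then show "\<exists>C U. closedin mtopology C \<and> openin mtopology U \<and> C \<subseteq> points X - a \<and> points X - a \<subseteq> U \<and> prob (U - C) < e"
        using CU by (intro exI[of _ "points X - U"] exI[of _ "points X - C"]) (auto simp: closedin_def double_diff)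
    qed
  next
    case (Union a)
    show ?case unfolding R_def
    proof (intro allI impI)
      fix e :: real assume e: "e > 0"
      have "\<exists>C U. closedin mtopology C \<and> openin mtopology U \<and> C \<subseteq> a i \<and> a i \<subseteq> U \<and> prob (U - C) < e/2 * (1/2)^Suc i" for i
        using Union.IH[of i, unfolded R_def, rule_format, of "e/2 * (1/2)^Suc i"] e by simp
      then obtain C U where CU: "\<And>i. closedin mtopology (C i)" "\<And>i. openin mtopology (U i)" "\<And>i. C i \<subseteq> a i" "\<And>i. a i \<subseteq> U i"
          "\<And>i. prob (U i - C i) < e/2 * (1/2)^Suc i" by metis
      define V where "V = (\<Union>i. U i)"
      have V: "openin mtopology V" unfolding V_def using CU by (intro openin_Union) auto
      have Cs: "C i \<in> sets (meas X)" and Us: "U i \<in> sets (meas X)" for i using CU closed_sets open_sets by auto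
      have sm: "(\<lambda>i. e/2 * (1/2)^Suc i) sums (e/2)"
        using sums_mult[OF power_half_series, of "e/2"] by simp
      then have sm': "summable (\<lambda>i. e/2 * (1/2)^Suc i)" by (rule sums_summable)
      have sp: "summable (\<lambda>i. prob (U i - C i))"
        by (rule summable_comparison_test'[OF sm', of 0]) (use CU(5) in \<open>auto intro: less_imp_le\<close>)
      have "prob (\<Union>i. U i - C i) \<le> (\<Sum>i. prob (U i - C i))"
        using Cs Us sp by (intro finite_measure_subadditive_countably) auto
      also have "\<dots> \<le> (\<Sum>i. e/2 * (1/2)^Suc i)"
        using CU(5) by (intro suminf_le sp sm') (auto intro: less_imp_le)
      also have "\<dots> = e/2" using sm by (rule sums_unique[symmetric])
      finally have b1: "prob (\<Union>i. U i - C i) \<le> e/2" .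
      \<comment> \<open>An infinite union of closed sets need not be closed, so it is cut off at a
        finite stage; the gaps of the pieces use only \<open>e/2\<close>, which leaves room for the
        cut-off.\<close>
      have lim: "(\<lambda>n. prob (V - (\<Union>i<n. C i))) \<longlonglongrightarrow> prob (\<Inter>n. V - (\<Union>i<n. C i))"
        using Cs V open_sets[OF V]
        by (intro finite_Lim_measure_decseq) (auto simp: decseq_def)
      have "prob (\<Inter>n. V - (\<Union>i<n. C i)) \<le> e/2"
      proof -
        have "(\<Inter>n. V - (\<Union>i<n. C i)) \<subseteq> (\<Union>i. U i - C i)" by (auto simp: V_def)
        then have "prob (\<Inter>n. V - (\<Union>i<n. C i)) \<le> prob (\<Union>i. U i - C i)"
          using Cs Us by (intro finite_measure_mono) auto
        then show ?thesis using b1 by simp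
      qed
      then have "prob (\<Inter>n. V - (\<Union>i<n. C i)) < e" using e by linarith
      with lim have "eventually (\<lambda>n. prob (V - (\<Union>i<n. C i)) < e) sequentially"
        by (rule order_tendstoD(2))
      then obtain n where n: "prob (V - (\<Union>i<n. C i)) < e" by (auto simp: eventually_sequentially)
      have "closedin mtopology (\<Union>i<n. C i)" using CU by (intro closedin_Union) auto
      moreover have "(\<Union>i<n. C i) \<subseteq> (\<Union>i. a i)" "(\<Union>i. a i) \<subseteq> V" 
        using CU(3,4) unfolding V_def by (intro UN_mono; simp)+
      ultimately show "\<exists>C U. closedin mtopology C \<and> openin mtopology U \<and> C \<subseteq> \<Union> (range a) \<and> \<Union> (range a) \<subseteq> U \<and> prob (U - C) < e"
        using V n by (intro exI[of _ "\<Union>i<n. C i"] exI[of _ V] conjI)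
    qed
  qed
  then show ?thesis using assms unfolding R_def by blast
qed

lemma cells_tight:
  fixes c :: "'a \<Rightarrow> nat"
  assumes "c \<in> measurable (meas X) (count_space UNIV)" "e > 0"
  shows "\<exists>N. prob {x\<in>points X. c x > N} < e"
proof -
  have m: "{x\<in>points X. c x > N} \<in> events" for N
    using measurable_sets[OF assms(1), of "{N<..}"]
    by (simp add: vimage_def Int_def conj_commute)
  have "(\<lambda>N. prob {x\<in>points X. c x > N}) \<longlonglongrightarrow> prob (\<Inter>N. {x\<in>points X. c x > N})"
    using m by (intro finite_Lim_measure_decseq) (auto simp: decseq_def)
  moreover have "(\<Inter>N. {x\<in>points X. c x > N}) = {}" by (auto) 
  ultimately have "(\<lambda>N. prob {x\<in>points X. c x > N}) \<longlonglongrightarrow> 0" by simp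
  then have "eventually (\<lambda>N. prob {x\<in>points X. c x > N} < e) sequentially"
    using assms(2) by (rule order_tendstoD(2))
  then show ?thesis by (auto simp: eventually_sequentially)
qed

text \<open>Ulam's argument: at each scale \<open>k\<close> keep finitely many cells at a loss of
  \<open>e/2 * (1/2)^Suc k\<close>. What survives at all scales is totally bounded, and completeness
  makes its closure compact.\<close>

lemma tight:
  assumes e: "e > 0"
  shows "\<exists>K. compactin mtopology K \<and> prob (points X - K) < e"
proof -
  obtain c :: "nat \<Rightarrow> 'a \<Rightarrow> nat" where c: "\<And>k. c k \<in> measurable (meas X) (count_space UNIV)"
    "\<And>k x y. x \<in> points X \<Longrightarrow> y \<in> points X \<Longrightarrow> c k x = c k y \<Longrightarrow> feat_dist X x y < inverse (real (Suc k))"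
    using cells by metis
  have "\<exists>N. prob {x\<in>points X. c k x > N} < e/2 * (1/2)^Suc k" for k
    using cells_tight[OF c(1), of "e/2 * (1/2)^Suc k" k] e by simp
  then obtain N where N: "\<And>k. prob {x\<in>points X. c k x > N k} < e/2 * (1/2)^Suc k" by metis
  have m: "{x\<in>points X. c k x > N k} \<in> events" for k
    using measurable_sets[OF c(1), of "{N k<..}" k]
    by (simp add: vimage_def Int_def conj_commute)
  define B where "B = {x\<in>points X. \<forall>k. c k x \<le> N k}"
  have tb: "mtotally_bounded B"
    unfolding mtotally_bounded_def
  proof (intro allI impI)
    fix r :: real assume "r > 0"
    then obtain k where k: "inverse (real (Suc k)) < r" using reals_Archimedean by blast
    define J where "J = {j. j \<le> N k \<and> (\<exists>x\<in>B. c k x = j)}"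
    define y where "y j = (SOME x. x \<in> B \<and> c k x = j)" for j
    have y: "y j \<in> B \<and> c k (y j) = j" if "j \<in> J" for j
      unfolding y_def by (rule someI_ex) (use that in \<open>auto simp: J_def\<close>)
    have "finite J" by (simp add: J_def)
    moreover have "B \<subseteq> (\<Union>x\<in>y ` J. mball x r)"
    proof
      fix x assume x: "x \<in> B"
      then have j: "c k x \<in> J" by (auto simp: J_def B_def)
      have "feat_dist X (y (c k x)) x < inverse (real (Suc k))"
        using y[OF j] x by (intro c(2)) (auto simp: B_def)
      then have "x \<in> mball (y (c k x)) r" using k y[OF j] x by (auto simp: in_mball B_def)
      then show "x \<in> (\<Union>x\<in>y ` J. mball x r)" using j by blast
    qed
    ultimately show "\<exists>K. finite K \<and> K \<subseteq> B \<and> B \<subseteq> (\<Union>x\<in>K. mball x r)"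
      using y by (intro exI[of _ "y ` J"]) auto
  qed
  define K where "K = mtopology closure_of B"
  have K: "compactin mtopology K" using tb complete mtotally_bounded_eq_compact_closure_of unfolding K_def by blast
  have sm: "(\<lambda>i. e/2 * (1/2)^Suc i) sums (e/2)"
    using sums_mult[OF power_half_series, of "e/2"] by simp
  then have sm': "summable (\<lambda>i. e/2 * (1/2)^Suc i)" by (rule sums_summable)
  have sp: "summable (\<lambda>k. prob {x\<in>points X. c k x > N k})"
    by (rule summable_comparison_test'[OF sm', of 0]) (use N in \<open>auto intro: less_imp_le\<close>)
  have "B \<subseteq> K" unfolding K_def by (intro closure_of_subset) (auto simp: B_def)
  then have "points X - K \<subseteq> (\<Union>k. {x\<in>points X. c k x > N k})" by (auto simp: B_def not_le subset_iff Ball_def) (meson not_le)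
  then have "prob (points X - K) \<le> prob (\<Union>k. {x\<in>points X. c k x > N k})"
    using m by (intro finite_measure_mono) auto
  also have "\<dots> \<le> (\<Sum>k. prob {x\<in>points X. c k x > N k})"
    using m sp by (intro finite_measure_subadditive_countably) auto
  also have "\<dots> \<le> (\<Sum>i. e/2 * (1/2)^Suc i)"
    using N by (intro suminf_le sp sm') (auto intro: less_imp_le)
  also have "\<dots> = e/2" using sm by (rule sums_unique[symmetric])
  finally show ?thesis using K e by auto
qed

text \<open>Regularity gives a closed set inside \<open>A\<close>, tightness a compact set of almost
  full mass; their intersection works. With \<open>open_approx\<close> this is the Radon property
  behind the countable additivity of the ultralimit.\<close>

lemma compact_approx:
  assumes "A \<in> sets (meas X)" "e > 0"
  shows "\<exists>K. compactin mtopology K \<and> K \<in> sets (meas X) \<and> K \<subseteq> A \<and> prob (A - K) < e"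
proof -
  obtain C U where CU: "closedin mtopology C" "openin mtopology U" "C \<subseteq> A" "A \<subseteq> U" "prob (U - C) < e/2"
    using open_closed_approx[OF assms(1), of "e/2"] assms(2) by auto
  obtain L where L: "compactin mtopology L" "prob (points X - L) < e/2" using tight[of "e/2"] assms(2) by auto
  have Lc: "closedin mtopology L" using L(1) compactin_imp_closedin Hausdorff_space_mtopology by blast
  have Ls: "L \<in> sets (meas X)" "C \<in> sets (meas X)" "U \<in> sets (meas X)" using closed_sets open_sets CU Lc by auto
  have K: "compactin mtopology (C \<inter> L)" using CU(1) L(1) by (rule closed_Int_compactin)
  have "A - (C \<inter> L) \<subseteq> (U - C) \<union> (points X - L)" using CU sets.sets_into_space[OF assms(1)] by auto
  then have "prob (A - (C \<inter> L)) \<le> prob ((U - C) \<union> (points X - L))"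
    using Ls sets.compl_sets[OF Ls(1)] by (intro finite_measure_mono) auto
  also have "\<dots> \<le> prob (U - C) + prob (points X - L)"
    using Ls sets.compl_sets[OF Ls(1)] by (intro measure_Un_le) auto
  finally show ?thesis using K CU L Ls by (intro exI[of _ "C \<inter> L"]) auto
qed

lemma open_approx:
  assumes "A \<in> sets (meas X)" "e > 0"
  shows "\<exists>U. openin mtopology U \<and> U \<in> sets (meas X) \<and> A \<subseteq> U \<and> prob (U - A) < e"
proof -
  obtain C U where CU: "closedin mtopology C" "openin mtopology U" "C \<subseteq> A" "A \<subseteq> U" "prob (U - C) < e"
    using open_closed_approx[OF assms] by auto
  have "prob (U - A) \<le> prob (U - C)" 
    using CU closed_sets open_sets by (intro finite_measure_mono) auto
  then show ?thesis using CU open_sets by (intro exI[of _ U]) auto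
qed

end

section \<open>Couplings and the box distance\<close>

text \<open>Makes the sets on which two features differ by at most a constant closed in the product,
  so that such bounds survive taking closures.\<close>

lemma feature_diff_continuous:
  assumes "geo_data_set X" "geo_data_set Y" "f \<in> feat_closure X" "g \<in> feat_closure Y"
  shows "continuous_map (prod_topology (feat_topology X) (feat_topology Y)) euclideanreal (\<lambda>z. f (fst z) - g (snd z))"
proof -
  interpret X: geo X by unfold_locales fact
  interpret Y: geo Y by unfold_locales fact
  have "continuous_map (prod_topology (feat_topology X) (feat_topology Y)) euclideanreal (f \<circ> fst)"
    using X.feature_continuous[OF assms(3)] by (intro continuous_map_compose[OF continuous_map_fst]) (simp add: X.top_eq)
  moreover have "continuous_map (prod_topology (feat_topology X) (feat_topology Y)) euclideanreal (g \<circ> snd)"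
    using Y.feature_continuous[OF assms(4)] by (intro continuous_map_compose[OF continuous_map_snd]) (simp add: Y.top_eq)
  ultimately show ?thesis
    using continuous_map_diff[of _ "f \<circ> fst" "g \<circ> snd"] by (simp add: o_def)
qed

text \<open>Couplings are declared on the Borel sets of the product topology, while product measures
  and measurable pairs live on the product sigma-algebra. The two agree by separability: an open set
  is a countable union of products of cells.\<close>

lemma borel_space_prod:
  assumes "geo_data_set X" "geo_data_set Y"
  shows "sets (borel_space (prod_topology (feat_topology X) (feat_topology Y))) = sets (meas X \<Otimes>\<^sub>M meas Y)"
proof -
  interpret X: geo X by unfold_locales fact
  interpret Y: geo Y by unfold_locales fact
  let ?T = "prod_topology (feat_topology X) (feat_topology Y)"
  have top: "topspace ?T = space (meas X \<Otimes>\<^sub>M meas Y)"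
    by (simp add: X.top_eq Y.top_eq space_pair_measure)
  obtain c :: "nat \<Rightarrow> 'a \<Rightarrow> nat" where c: "\<And>k. c k \<in> measurable (meas X) (count_space UNIV)"
    "\<And>k x y. x \<in> points X \<Longrightarrow> y \<in> points X \<Longrightarrow> c k x = c k y \<Longrightarrow> feat_dist X x y < inverse (real (Suc k))"
    using X.cells by metis
  obtain d :: "nat \<Rightarrow> 'b \<Rightarrow> nat" where d: "\<And>k. d k \<in> measurable (meas Y) (count_space UNIV)"
    "\<And>k x y. x \<in> points Y \<Longrightarrow> y \<in> points Y \<Longrightarrow> d k x = d k y \<Longrightarrow> feat_dist Y x y < inverse (real (Suc k))"
    using Y.cells by metis
  have "W \<in> sets (meas X \<Otimes>\<^sub>M meas Y)" if W: "openin ?T W" for W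
  proof -
    define R where "R k i j = (c k -` {i} \<inter> space (meas X)) \<times> (d k -` {j} \<inter> space (meas Y))" for k i j
    define J where "J k = {(i,j). R k i j \<subseteq> W}" for k
    have Rs: "R k i j \<in> sets (meas X \<Otimes>\<^sub>M meas Y)" for k i j
      unfolding R_def by (intro pair_measureI measurable_sets[OF c(1)] measurable_sets[OF d(1)]) auto
    have "W \<subseteq> (\<Union>k. \<Union>(i,j)\<in>J k. R k i j)"
    proof
      fix z assume z: "z \<in> W"
      obtain x y where xy: "z = (x,y)" by (cases z)
      have zt: "x \<in> points X" "y \<in> points Y" using openin_subset[OF W] z xy top by (auto simp: space_pair_measure)
      obtain U V where UV: "openin X.mtopology U" "openin Y.mtopology V" "x \<in> U" "y \<in> V" "U \<times> V \<subseteq> W"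
        using W z unfolding openin_prod_topology_alt xy X.top_eq Y.top_eq by metis
      obtain k where k: "\<And>u. u \<in> points X \<Longrightarrow> feat_dist X x u < inverse (real (Suc k)) \<Longrightarrow> u \<in> U"
        using X.open_cells[OF UV(1,3)] by blast
      obtain l where l: "\<And>u. u \<in> points Y \<Longrightarrow> feat_dist Y y u < inverse (real (Suc l)) \<Longrightarrow> u \<in> V"
        using Y.open_cells[OF UV(2,4)] by blast
      define m where "m = max k l"
      have inv: "inverse (real (Suc m)) \<le> inverse (real (Suc k))" "inverse (real (Suc m)) \<le> inverse (real (Suc l))"
        unfolding m_def by (intro le_imp_inverse_le; simp)+
      have "R m (c m x) (d m y) \<subseteq> U \<times> V"
      proof
        fix w assume "w \<in> R m (c m x) (d m y)"
        then obtain a b where w: "w = (a,b)" "a \<in> points X" "b \<in> points Y" "c m a = c m x" "d m b = d m y"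
          by (auto simp: R_def)
        have "feat_dist X x a < inverse (real (Suc m))" "feat_dist Y y b < inverse (real (Suc m))"
          using c(2)[of x a m] d(2)[of y b m] w zt by auto
        then have "a \<in> U" "b \<in> V" using k[OF w(2)] l[OF w(3)] inv by linarith+
        then show "w \<in> U \<times> V" using w by simp
      qed
      then have "(c m x, d m y) \<in> J m" using UV(5) unfolding J_def by blast
      moreover have "z \<in> R m (c m x) (d m y)" using zt xy by (simp add: R_def)
      ultimately show "z \<in> (\<Union>k. \<Union>(i,j)\<in>J k. R k i j)" by blast
    qed
    moreover have "(\<Union>k. \<Union>(i,j)\<in>J k. R k i j) \<subseteq> W" by (auto simp: J_def)
    ultimately have "W = (\<Union>k. \<Union>(i,j)\<in>J k. R k i j)" by blast
    moreover have "(\<Union>k. \<Union>(i,j)\<in>J k. R k i j) \<in> sets (meas X \<Otimes>\<^sub>M meas Y)"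
      using Rs by (intro sets.countable_UN'') (auto simp: split_beta)
    ultimately show ?thesis by simp
  qed
  then have "sets (borel_space ?T) \<subseteq> sets (meas X \<Otimes>\<^sub>M meas Y)"
    unfolding borel_space_simps top by (intro sets.sigma_sets_subset) auto
  moreover have "sets (meas X \<Otimes>\<^sub>M meas Y) \<subseteq> sets (borel_space ?T)"
  proof -
    have sp: "space (borel_space ?T) = points X \<times> points Y" by (simp add: borel_space_simps X.top_eq Y.top_eq)
    have opn: "W \<in> sets (borel_space ?T)" if "openin ?T W" for W
      using that by (auto simp: borel_space_simps intro: sigma_sets.Basic)
    have f: "fst \<in> measurable (borel_space ?T) (meas X)"
    proof (rule measurable_sigma_sets[OF X.sets_meas])
      fix U assume U: "U \<in> {U. openin X.mtopology U}"
      then have "fst -` U \<inter> space (borel_space ?T) = U \<times> points Y"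
        using openin_subset by (fastforce simp: sp)
      moreover have "openin ?T (U \<times> points Y)"
        using U openin_topspace[of Y.mtopology] by (auto simp: openin_prod_Times_iff X.top_eq Y.top_eq)
      ultimately show "fst -` U \<inter> space (borel_space ?T) \<in> sets (borel_space ?T)" using opn by simp
    qed (use openin_subset in \<open>fastforce simp: sp\<close>)+
    have s: "snd \<in> measurable (borel_space ?T) (meas Y)"
    proof (rule measurable_sigma_sets[OF Y.sets_meas])
      fix U assume U: "U \<in> {U. openin Y.mtopology U}"
      then have "snd -` U \<inter> space (borel_space ?T) = points X \<times> U"
        using openin_subset by (fastforce simp: sp)
      moreover have "openin ?T (points X \<times> U)"
        using U openin_topspace[of X.mtopology] by (auto simp: openin_prod_Times_iff X.top_eq Y.top_eq)
      ultimately show "snd -` U \<inter> space (borel_space ?T) \<in> sets (borel_space ?T)" using opn by simp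
    qed (use openin_subset in \<open>fastforce simp: sp\<close>)+
    have "(\<lambda>z. z) \<in> measurable (borel_space ?T) (meas X \<Otimes>\<^sub>M meas Y)"
      using measurable_Pair[OF f s] by simp
    from measurable_sets[OF this] show ?thesis
      using sets.sets_into_space by (fastforce simp: sp space_pair_measure Int_absorb2)
  qed
  ultimately show ?thesis by blast
qed

section \<open>Bounding the box distance through couplings\<close>

definition box_inf :: "'a geo_data \<Rightarrow> 'b geo_data \<Rightarrow> ennreal" where
  "box_inf X Y = (INF \<pi>\<in>couplings X Y.
      INF S\<in>{S. closedin (prod_topology (feat_topology X) (feat_topology Y)) S}.
        max (1 - emeasure \<pi> S)
            (2 * hausdorff_dist (sup_dist S)
                   ((\<lambda>f. f \<circ> fst) ` features X) ((\<lambda>g. g \<circ> snd) ` features Y)))"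

text \<open>Any probability space with two measure-preserving maps yields a coupling, their joint
  law, and any event \<open>T\<close> yields a closed set, the closure of its image: closing up only
  adds mass, and the bounds on features are closed conditions. The \<open>e / 2\<close> absorbs the
  factor 2 of the definition.\<close>

lemma box_inf_leI:
  assumes gX: "geo_data_set X" and gY: "geo_data_set Y" and P: "prob_space P"
    and p: "p \<in> measurable P (meas X)" "distr P (meas X) p = meas X"
    and q: "q \<in> measurable P (meas Y)" "distr P (meas Y) q = meas Y"
    and T: "T \<in> sets P" "measure P T \<ge> 1 - e" and e: "e \<ge> 0"
    and fg: "\<And>f. f \<in> features X \<Longrightarrow> \<exists>g\<in>features Y. \<forall>w\<in>T. \<bar>f (p w) - g (q w)\<bar> \<le> e / 2"
    and gf: "\<And>g. g \<in> features Y \<Longrightarrow> \<exists>f\<in>features X. \<forall>w\<in>T. \<bar>f (p w) - g (q w)\<bar> \<le> e / 2"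
  shows "box_inf X Y \<le> ennreal e"
proof -
  interpret X: geo X by unfold_locales fact
  interpret Y: geo Y by unfold_locales fact
  interpret P: prob_space P by fact
  let ?T = "prod_topology (feat_topology X) (feat_topology Y)"
  let ?pq = "\<lambda>w. (p w, q w)"
  define \<pi> where "\<pi> = distr P (borel_space ?T) ?pq"
  have bs: "sets (borel_space ?T) = sets (meas X \<Otimes>\<^sub>M meas Y)" using borel_space_prod[OF gX gY] .
  have pq: "?pq \<in> measurable P (borel_space ?T)"
    using measurable_Pair[OF p(1) q(1)] measurable_cong_sets[OF refl bs] by blast
  have f: "fst \<in> measurable (borel_space ?T) (meas X)" and s: "snd \<in> measurable (borel_space ?T) (meas Y)"
    using measurable_fst measurable_snd measurable_cong_sets[OF bs refl] by blast+
  have \<pi>: "\<pi> \<in> couplings X Y"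
    unfolding couplings_def \<pi>_def using P.prob_space_distr[OF pq] p q
    by (simp add: distr_distr[OF f pq] distr_distr[OF s pq] o_def)
  define S where "S = ?T closure_of (?pq ` T)"
  have S: "closedin ?T S" by (simp add: S_def)
  have Tsp: "T \<subseteq> space P" using T sets.sets_into_space by blast
  have imT: "?pq ` T \<subseteq> topspace ?T" 
    using Tsp measurable_space[OF p(1)] measurable_space[OF q(1)] by (auto simp: X.top_eq Y.top_eq)
  have "topspace ?T - S \<in> sets (borel_space ?T)"
    using S by (auto simp: borel_space_simps closedin_def intro!: sigma_sets.Basic)
  then have "topspace ?T - (topspace ?T - S) \<in> sets (borel_space ?T)"
    using sets.compl_sets[of "topspace ?T - S" "borel_space ?T"] by (simp add: borel_space_simps)
  then have Ss: "S \<in> sets (borel_space ?T)" using closedin_subset[OF S] by (simp add: double_diff)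
  have "emeasure P T \<le> emeasure P (?pq -` S \<inter> space P)"
  proof (rule emeasure_mono)
    show "T \<subseteq> ?pq -` S \<inter> space P"
      using closure_of_subset[OF imT] Tsp by (auto simp: S_def)
    show "?pq -` S \<inter> space P \<in> sets P" using measurable_sets[OF pq Ss] .
  qed
  also have "\<dots> = emeasure \<pi> S" unfolding \<pi>_def using emeasure_distr[OF pq Ss] by simp
  finally have "1 - emeasure \<pi> S \<le> 1 - emeasure P T" by (intro ennreal_mono_minus)
  also have "\<dots> = ennreal (1 - measure P T)"
    by (simp add: P.emeasure_eq_measure ennreal_minus flip: ennreal_1)
  also have "\<dots> \<le> ennreal e" using T(2) by (intro ennreal_leI) linarith
  finally have m1: "1 - emeasure \<pi> S \<le> ennreal e" .
  have sd: "sup_dist S (f \<circ> fst) (g \<circ> snd) \<le> ennreal (e/2)"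
    if fg': "f \<in> features X" "g \<in> features Y" "\<forall>w\<in>T. \<bar>f (p w) - g (q w)\<bar> \<le> e / 2" for f g
    unfolding sup_dist_def
  proof (rule SUP_least)
    fix z assume z: "z \<in> S"
    have "closedin ?T {z \<in> topspace ?T. f (fst z) - g (snd z) \<in> {-(e/2)..e/2}}"
      using feature_diff_continuous[OF gX gY, of f g] X.F_closure Y.F_closure fg'
      by (intro closedin_continuous_map_preimage[where Y=euclideanreal]) auto
    then have "S \<subseteq> {z \<in> topspace ?T. f (fst z) - g (snd z) \<in> {-(e/2)..e/2}}"
      unfolding S_def
    proof (rule closure_of_minimal[rotated])
      show "?pq ` T \<subseteq> {z \<in> topspace ?T. f (fst z) - g (snd z) \<in> {-(e/2)..e/2}}"
      proof
        fix z assume z: "z \<in> ?pq ` T"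
        then obtain w where w: "w \<in> T" "z = (p w, q w)" by blast
        have "\<bar>f (p w) - g (q w)\<bar> \<le> e / 2" using fg'(3) w by blast
        then have "-(e/2) \<le> f (p w) - g (q w) \<and> f (p w) - g (q w) \<le> e/2" by linarith
        then have "f (fst z) - g (snd z) \<in> {-(e/2)..e/2}" unfolding w(2) by simp
        moreover have "z \<in> topspace ?T" using imT z by blast
        ultimately show "z \<in> {z \<in> topspace ?T. f (fst z) - g (snd z) \<in> {-(e/2)..e/2}}" by blast
      qed
    qed
    then have "f (fst z) - g (snd z) \<in> {-(e/2)..e/2}" using z by auto
    then have "\<bar>(f \<circ> fst) z - (g \<circ> snd) z\<bar> \<le> e/2"
      unfolding comp_def atLeastAtMost_iff abs_le_iff by linarith
    then show "ennreal \<bar>(f \<circ> fst) z - (g \<circ> snd) z\<bar> \<le> ennreal (e/2)" by (rule ennreal_leI)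
  qed
  have "hausdorff_dist (sup_dist S) ((\<lambda>f. f \<circ> fst) ` features X) ((\<lambda>g. g \<circ> snd) ` features Y) \<le> ennreal (e/2)"
    unfolding hausdorff_dist_def
  proof (intro max.boundedI SUP_least)
    fix u :: "'a \<times> 'b \<Rightarrow> real" assume "u \<in> (\<lambda>f. f \<circ> fst) ` features X"
    then obtain f where f: "f \<in> features X" "u = f \<circ> fst" by auto
    obtain g where g: "g \<in> features Y" "\<forall>w\<in>T. \<bar>f (p w) - g (q w)\<bar> \<le> e / 2" using fg f by blast
    show "(INF b\<in>(\<lambda>g. g \<circ> snd) ` features Y. sup_dist S u b) \<le> ennreal (e / 2)"
      using sd[OF f(1) g] f g by (intro INF_lower2[of "g \<circ> snd"]) auto
  next
    fix v :: "'a \<times> 'b \<Rightarrow> real" assume "v \<in> (\<lambda>g. g \<circ> snd) ` features Y"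
    then obtain g where g: "g \<in> features Y" "v = g \<circ> snd" by auto
    obtain f where f: "f \<in> features X" "\<forall>w\<in>T. \<bar>f (p w) - g (q w)\<bar> \<le> e / 2" using gf g by blast
    show "(INF a\<in>(\<lambda>f. f \<circ> fst) ` features X. sup_dist S a v) \<le> ennreal (e / 2)"
      using sd[OF f(1) g(1) f(2)] f g by (intro INF_lower2[of "f \<circ> fst"]) auto
  qed
  then have "2 * hausdorff_dist (sup_dist S) ((\<lambda>f. f \<circ> fst) ` features X) ((\<lambda>g. g \<circ> snd) ` features Y) \<le> 2 * ennreal (e/2)"
    by (rule mult_left_mono) simp
  also have "2 * ennreal (e/2) = ennreal e"
    using e ennreal_mult''[of "e/2" 2] by simp
  finally have m2: "2 * hausdorff_dist (sup_dist S) ((\<lambda>f. f \<circ> fst) ` features X) ((\<lambda>g. g \<circ> snd) ` features Y) \<le> ennreal e" .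
  show ?thesis unfolding box_inf_def
    using S m1 m2 by (intro INF_lower2[OF \<pi>] INF_lower2[of S]) auto
qed

lemma box_dist_eq: "box_dist X Y = enn2real (box_inf X Y)"
  by (simp add: box_dist_def box_inf_def)

lemma product_marginals:
  assumes "prob_space A" "prob_space B"
  shows "distr (A \<Otimes>\<^sub>M B) A fst = A" "distr (A \<Otimes>\<^sub>M B) B snd = B" "prob_space (A \<Otimes>\<^sub>M B)"
proof -
  interpret A: prob_space A by fact
  interpret B: prob_space B by fact
  interpret AB: pair_prob_space A B ..
  show "distr (A \<Otimes>\<^sub>M B) A fst = A" by (rule B.distr_pair_fst)
  show "prob_space (A \<Otimes>\<^sub>M B)" by (rule AB.prob_space_axioms)
  show "distr (A \<Otimes>\<^sub>M B) B snd = B"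
  proof (rule measure_eqI)
    fix E assume "E \<in> sets (distr (A \<Otimes>\<^sub>M B) B snd)"
    then have E: "E \<in> sets B" by simp
    then have "snd -` E \<inter> space (A \<Otimes>\<^sub>M B) = space A \<times> E"
      using sets.sets_into_space by (fastforce simp: space_pair_measure)
    then show "emeasure (distr (A \<Otimes>\<^sub>M B) B snd) E = emeasure B E"
      using E by (simp add: emeasure_distr B.emeasure_pair_measure_Times A.emeasure_space_1)
  qed simp
qed

lemma box_inf_le_1:
  assumes "geo_data_set X" "geo_data_set Y"
  shows "box_inf X Y \<le> 1"
proof -
  interpret X: geo X by unfold_locales fact
  interpret Y: geo Y by unfold_locales fact
  have "box_inf X Y \<le> ennreal 1"
    using X.F_ne Y.F_ne product_marginals[OF X.prob_meas Y.prob_meas]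
    by (intro box_inf_leI[OF assms, of "meas X \<Otimes>\<^sub>M meas Y" fst snd "{}"]) auto
  then show ?thesis by simp
qed

text \<open>Approximation at one sample point per cell becomes uniform on finitely many cells:
  \<open>f\<close> and \<open>g\<close> each vary by less than \<open>r\<close> on a cell, and the
  error at the sample point is the third \<open>r\<close>.\<close>

lemma (in geo) closure_approx_on_cells:
  fixes c :: "'a \<Rightarrow> nat"
  assumes c: "\<And>x y. x \<in> points X \<Longrightarrow> y \<in> points X \<Longrightarrow> c x = c y \<Longrightarrow> feat_dist X x y < r" and r: "r > 0"
    and g: "g \<in> feat_closure X"
  shows "\<exists>f\<in>features X. \<forall>x\<in>points X. c x \<le> N \<longrightarrow> \<bar>f x - g x\<bar> \<le> 3 * r"
proof -
  define y where "y j = (SOME x. x \<in> points X \<and> c x = j)" for j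
  define J where "J = {j. j \<le> N \<and> (\<exists>x\<in>points X. c x = j)}"
  have y: "y j \<in> points X \<and> c (y j) = j" if "j \<in> J" for j
    unfolding y_def by (rule someI_ex) (use that in \<open>auto simp: J_def\<close>)
  have "finite (y ` J) \<and> y ` J \<subseteq> points X \<and> r > 0" using y r by (auto simp: J_def)
  then obtain f where f: "f \<in> features X" "\<forall>a\<in>y ` J. \<bar>f a - g a\<bar> < r"
    using g[unfolded feat_closure_iff[OF F_ext]] by meson
  have "\<bar>f x - g x\<bar> \<le> 3 * r" if x: "x \<in> points X" "c x \<le> N" for x
  proof -
    have j: "c x \<in> J" using x by (auto simp: J_def)
    have d: "feat_dist X x (y (c x)) < r" using c x y[OF j] by simp
    have "\<bar>f x - f (y (c x))\<bar> \<le> feat_dist X x (y (c x))" "\<bar>g x - g (y (c x))\<bar> \<le> feat_dist X x (y (c x))"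
      using feature_lipschitz closure_lipschitz f(1) g x y[OF j] by blast+
    moreover have "\<bar>f (y (c x)) - g (y (c x))\<bar> < r" using f(2) j by blast
    ultimately show ?thesis using d by linarith
  qed
  then show ?thesis using f(1) by blast
qed

lemma prob_Int_ge:
  assumes "prob_space P" "A \<in> sets P" "B \<in> sets P" "measure P A \<ge> 1 - a" "measure P B \<ge> 1 - b"
  shows "measure P (A \<inter> B) \<ge> 1 - (a + b)"
proof -
  interpret prob_space P by fact
  have "prob (space P - A \<inter> B) \<le> prob ((space P - A) \<union> (space P - B))"
    using assms by (intro finite_measure_mono) auto
  also have "\<dots> \<le> prob (space P - A) + prob (space P - B)"
    using assms by (intro measure_Un_le) auto
  finally show ?thesis using assms by (simp add: prob_compl)
qed

lemma measure_preserving_vimage: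
  assumes "p \<in> measurable P M" "distr P M p = M" "A \<in> sets M"
  shows "measure P (p -` A \<inter> space P) = measure M A"
  using measure_distr[OF assms(1,3)] assms(2) by simp

lemma abs_chain:
  fixes a :: real
  assumes "\<bar>a - b\<bar> \<le> x" "\<bar>b - c\<bar> \<le> y" "x + y \<le> z"
  shows "\<bar>a - c\<bar> \<le> z"
  using assms by (auto simp: abs_le_iff)

text \<open>Partners may be taken in the closures, which is what limits of features provide. Off an
  event of arbitrarily small mass only finitely many cells are met, and there a closure element can
  be traded for a genuine feature at small uniform cost.\<close>

lemma box_distI:
  assumes gX: "geo_data_set X" and gY: "geo_data_set Y" and P: "prob_space P"
    and p: "p \<in> measurable P (meas X)" "distr P (meas X) p = meas X"
    and q: "q \<in> measurable P (meas Y)" "distr P (meas Y) q = meas Y"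
    and T: "T \<in> sets P" "measure P T \<ge> 1 - e" and e: "e \<ge> 0"
    and fg: "\<And>f. f \<in> features X \<Longrightarrow> \<exists>g\<in>feat_closure Y. \<forall>w\<in>T. \<bar>f (p w) - g (q w)\<bar> \<le> e / 2"
    and gf: "\<And>g. g \<in> features Y \<Longrightarrow> \<exists>f\<in>feat_closure X. \<forall>w\<in>T. \<bar>f (p w) - g (q w)\<bar> \<le> e / 2"
  shows "box_dist X Y \<le> e"
proof -
  interpret X: geo X by unfold_locales fact
  interpret Y: geo Y by unfold_locales fact
  interpret P: prob_space P by fact
  have "box_inf X Y \<le> ennreal e + ennreal \<eta>" if \<eta>: "\<eta> > 0" for \<eta>
  proof -
    \<comment> \<open>With \<open>r < \<eta> / 6\<close> the trade costs
      \<open>3 * r < \<eta> / 2\<close>, and the two discarded events have mass at most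
      \<open>\<eta>/3\<close> together; both fit into \<open>e + \<eta>\<close>.\<close>
    obtain k where k: "inverse (real (Suc k)) < \<eta> / 6" using reals_Archimedean[of "\<eta>/6"] \<eta> by auto
    define r where "r = inverse (real (Suc k))"
    have r: "r > 0" "r < \<eta> / 6" using k by (simp_all add: r_def)
    obtain c :: "'a \<Rightarrow> nat" where c: "c \<in> measurable (meas X) (count_space UNIV)"
      "\<And>x y. x \<in> points X \<Longrightarrow> y \<in> points X \<Longrightarrow> c x = c y \<Longrightarrow> feat_dist X x y < r"
      using X.cells unfolding r_def by metis
    obtain d :: "'b \<Rightarrow> nat" where d: "d \<in> measurable (meas Y) (count_space UNIV)"
      "\<And>x y. x \<in> points Y \<Longrightarrow> y \<in> points Y \<Longrightarrow> d x = d y \<Longrightarrow> feat_dist Y x y < r"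
      using Y.cells unfolding r_def by metis
    obtain N where N: "X.prob {x\<in>points X. c x > N} < \<eta>/6" using X.cells_tight[OF c(1), of "\<eta>/6"] \<eta> by auto
    obtain L where L: "Y.prob {x\<in>points Y. d x > L} < \<eta>/6" using Y.cells_tight[OF d(1), of "\<eta>/6"] \<eta> by auto
    define A where "A = c -` {..N} \<inter> space (meas X)"
    define B where "B = d -` {..L} \<inter> space (meas Y)"
    have As: "A \<in> sets (meas X)" "B \<in> sets (meas Y)"
      using measurable_sets[OF c(1)] measurable_sets[OF d(1)] unfolding A_def B_def by auto
    have "{x\<in>points X. c x > N} = space (meas X) - A" "{x\<in>points Y. d x > L} = space (meas Y) - B"
      by (auto simp: A_def B_def)
    then have AB: "X.prob A \<ge> 1 - \<eta>/6" "Y.prob B \<ge> 1 - \<eta>/6"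
      using N L X.prob_compl[OF As(1)] Y.prob_compl[OF As(2)] by auto
    define A' where "A' = p -` A \<inter> space P"
    define B' where "B' = q -` B \<inter> space P"
    have A's: "A' \<in> sets P" "B' \<in> sets P"
      using measurable_sets[OF p(1) As(1)] measurable_sets[OF q(1) As(2)] by (auto simp: A'_def B'_def)
    have "P.prob A' \<ge> 1 - \<eta>/6" "P.prob B' \<ge> 1 - \<eta>/6"
      using AB measure_preserving_vimage[OF p As(1)] measure_preserving_vimage[OF q As(2)] by (simp_all add: A'_def B'_def)
    then have "P.prob (A' \<inter> B') \<ge> 1 - (\<eta>/6 + \<eta>/6)" by (intro prob_Int_ge[OF P A's])
    then have "P.prob (T \<inter> (A' \<inter> B')) \<ge> 1 - (e + (\<eta>/6 + \<eta>/6))"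
      using A's by (intro prob_Int_ge[OF P T(1) _ T(2)]) auto
    then have PT: "P.prob (T \<inter> (A' \<inter> B')) \<ge> 1 - (e + \<eta>)" using \<eta> by simp
    have "box_inf X Y \<le> ennreal (e + \<eta>)"
    proof (rule box_inf_leI[OF gX gY P p q _ PT])
      show "T \<inter> (A' \<inter> B') \<in> sets P" using A's T by blast
      show "0 \<le> e + \<eta>" using e \<eta> by simp
    next
      fix f assume "f \<in> features X"
      then obtain g where g: "g \<in> feat_closure Y" "\<forall>w\<in>T. \<bar>f (p w) - g (q w)\<bar> \<le> e / 2" using fg by blast
      obtain g' where g': "g' \<in> features Y" "\<forall>y\<in>points Y. d y \<le> L \<longrightarrow> \<bar>g' y - g y\<bar> \<le> 3 * r"
        using Y.closure_approx_on_cells[OF d(2) r(1) g(1)] by blast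
      have "\<bar>f (p w) - g' (q w)\<bar> \<le> (e + \<eta>) / 2" if w: "w \<in> T \<inter> (A' \<inter> B')" for w
      proof -
        have "\<bar>f (p w) - g (q w)\<bar> \<le> e / 2" using g(2) w by blast
        moreover have "\<bar>g (q w) - g' (q w)\<bar> \<le> 3 * r"
          using g'(2) w abs_minus_commute[of "g (q w)" "g' (q w)"] by (auto simp: B'_def B_def)
        ultimately show ?thesis by (rule abs_chain) (use r in argo)
      qed
      then show "\<exists>g\<in>features Y. \<forall>w\<in>T \<inter> (A' \<inter> B'). \<bar>f (p w) - g (q w)\<bar> \<le> (e + \<eta>) / 2" using g'(1) by blast
    next
      fix g assume "g \<in> features Y"
      then obtain f where f: "f \<in> feat_closure X" "\<forall>w\<in>T. \<bar>f (p w) - g (q w)\<bar> \<le> e / 2" using gf by blast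
      obtain f' where f': "f' \<in> features X" "\<forall>y\<in>points X. c y \<le> N \<longrightarrow> \<bar>f' y - f y\<bar> \<le> 3 * r"
        using X.closure_approx_on_cells[OF c(2) r(1) f(1)] by blast
      have "\<bar>f' (p w) - g (q w)\<bar> \<le> (e + \<eta>) / 2" if w: "w \<in> T \<inter> (A' \<inter> B')" for w
      proof -
        have "\<bar>f' (p w) - f (p w)\<bar> \<le> 3 * r"
          using f'(2) w by (auto simp: A'_def A_def)
        moreover have "\<bar>f (p w) - g (q w)\<bar> \<le> e / 2" using f(2) w by blast
        ultimately show ?thesis by (rule abs_chain) (use r in argo)
      qed
      then show "\<exists>f\<in>features X. \<forall>w\<in>T \<inter> (A' \<inter> B'). \<bar>f (p w) - g (q w)\<bar> \<le> (e + \<eta>) / 2" using f'(1) by blast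
    qed
    then show ?thesis using e \<eta> by (simp add: ennreal_plus)
  qed
  then have "box_inf X Y \<le> ennreal e" by (rule ennreal_le_epsilon)
  then show ?thesis using e by (simp add: box_dist_eq enn2real_leI)
qed

text \<open>A certificate in purely measure-theoretic terms that the distance is at most
  \<open>e\<close>: the set is merely measurable and the sigma-algebra is the product one.\<close>

definition near_coupling :: "'a geo_data \<Rightarrow> 'b geo_data \<Rightarrow> real \<Rightarrow> ('a \<times> 'b) measure \<Rightarrow> ('a \<times> 'b) set \<Rightarrow> bool" where
  "near_coupling X Y e \<pi> S \<longleftrightarrow> prob_space \<pi> \<and> sets \<pi> = sets (meas X \<Otimes>\<^sub>M meas Y) \<and>
     distr \<pi> (meas X) fst = meas X \<and> distr \<pi> (meas Y) snd = meas Y \<and>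
     S \<in> sets \<pi> \<and> measure \<pi> S \<ge> 1 - e \<and>
     (\<forall>f\<in>features X. \<exists>g\<in>features Y. \<forall>z\<in>S. \<bar>f (fst z) - g (snd z)\<bar> \<le> e / 2) \<and>
     (\<forall>g\<in>features Y. \<exists>f\<in>features X. \<forall>z\<in>S. \<bar>f (fst z) - g (snd z)\<bar> \<le> e / 2)"

lemma sup_dist_lessD:
  assumes "sup_dist S u v < ennreal r" "z \<in> S" shows "\<bar>u z - v z\<bar> \<le> r"
proof -
  have "ennreal \<bar>u z - v z\<bar> \<le> sup_dist S u v" unfolding sup_dist_def using assms(2) by (rule SUP_upper)
  then have "ennreal \<bar>u z - v z\<bar> < ennreal r" using assms(1) by (rule le_less_trans)
  then show ?thesis by (simp add: ennreal_less_iff)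
qed

text \<open>Strictness turns the infima, including those inside the Hausdorff distance, into actual
  witnesses.\<close>

lemma box_dist_lessD:
  assumes gX: "geo_data_set X" and gY: "geo_data_set Y" and e: "box_dist X Y < e"
  shows "\<exists>\<pi> S. near_coupling X Y e \<pi> S"
proof -
  interpret X: geo X by unfold_locales fact
  interpret Y: geo Y by unfold_locales fact
  let ?T = "prod_topology (feat_topology X) (feat_topology Y)"
  have e0: "e > 0" using e enn2real_nonneg[of "box_inf X Y"] unfolding box_dist_eq by linarith
  \<comment> \<open>\<open>enn2real\<close> sends infinity to 0, so finiteness has to be known
    before the hypothesis on \<open>box_dist\<close> says anything about
    \<open>box_inf\<close>.\<close>
  have "box_inf X Y < \<top>" using box_inf_le_1[OF gX gY] by (rule le_less_trans) simp
  then have "box_inf X Y < ennreal e" using e unfolding box_dist_eq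
    by (metis ennreal_enn2real ennreal_lessI e0)
  then obtain \<pi> S where \<pi>: "\<pi> \<in> couplings X Y" and S: "closedin ?T S"
    and m: "max (1 - emeasure \<pi> S) (2 * hausdorff_dist (sup_dist S)
                   ((\<lambda>f. f \<circ> fst) ` features X) ((\<lambda>g. g \<circ> snd) ` features Y)) < ennreal e"
    unfolding box_inf_def INF_less_iff by blast
  interpret \<pi>: prob_space \<pi> using \<pi> by (simp add: couplings_def)
  have bs: "sets \<pi> = sets (meas X \<Otimes>\<^sub>M meas Y)" "sets \<pi> = sets (borel_space ?T)"
    using \<pi> borel_space_prod[OF gX gY] by (auto simp: couplings_def)
  have "topspace ?T - S \<in> sets \<pi>"
    using S unfolding bs(2) by (auto simp: borel_space_simps closedin_def intro!: sigma_sets.Basic)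
  moreover have "space \<pi> = topspace ?T" using sets_eq_imp_space_eq[OF bs(2)] by (simp add: borel_space_simps)
  ultimately have "topspace ?T - (topspace ?T - S) \<in> sets \<pi>"
    using sets.compl_sets[of "topspace ?T - S" \<pi>] by simp
  then have Ss: "S \<in> sets \<pi>" using closedin_subset[OF S] by (simp add: double_diff)
  have "ennreal (1 - \<pi>.prob S) < ennreal e"
    using m by (simp add: \<pi>.emeasure_eq_measure ennreal_minus flip: ennreal_1)
  then have pS: "\<pi>.prob S \<ge> 1 - e" by (simp add: ennreal_less_iff)
  let ?h = "hausdorff_dist (sup_dist S) ((\<lambda>f. f \<circ> fst) ` features X) ((\<lambda>g. g \<circ> snd) ` features Y)"
  have h2: "2 * ?h < ennreal e" using m by simp
  have h: "?h < ennreal (e/2)"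
  proof (rule ccontr)
    assume "\<not> ?h < ennreal (e/2)"
    then have "2 * ennreal (e/2) \<le> 2 * ?h" by (intro mult_left_mono) auto
    moreover have "2 * ennreal (e/2) = ennreal e" using e0 ennreal_mult''[of "e/2" 2] by simp
    ultimately show False using h2 by simp
  qed
  have "\<exists>g\<in>features Y. \<forall>z\<in>S. \<bar>f (fst z) - g (snd z)\<bar> \<le> e / 2" if "f \<in> features X" for f
  proof -
    have "(INF b\<in>(\<lambda>g. g \<circ> snd) ` features Y. sup_dist S (f \<circ> fst) b) \<le> ?h"
      unfolding hausdorff_dist_def using that by (intro max.coboundedI1 SUP_upper2[of "f \<circ> fst"]) auto
    then have "(INF b\<in>(\<lambda>g. g \<circ> snd) ` features Y. sup_dist S (f \<circ> fst) b) < ennreal (e/2)"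
      using h by (rule le_less_trans)
    then obtain g where g: "g \<in> features Y" "sup_dist S (f \<circ> fst) (g \<circ> snd) < ennreal (e/2)"
      unfolding INF_less_iff by blast
    then show ?thesis using sup_dist_lessD[OF g(2)] unfolding comp_def by blast
  qed
  moreover have "\<exists>f\<in>features X. \<forall>z\<in>S. \<bar>f (fst z) - g (snd z)\<bar> \<le> e / 2" if "g \<in> features Y" for g
  proof -
    have "(INF b\<in>(\<lambda>f. f \<circ> fst) ` features X. sup_dist S b (g \<circ> snd)) \<le> ?h"
      unfolding hausdorff_dist_def using that by (intro max.coboundedI2 SUP_upper2[of "g \<circ> snd"]) auto
    then have "(INF b\<in>(\<lambda>f. f \<circ> fst) ` features X. sup_dist S b (g \<circ> snd)) < ennreal (e/2)"
      using h by (rule le_less_trans)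
    then obtain f where f: "f \<in> features X" "sup_dist S (f \<circ> fst) (g \<circ> snd) < ennreal (e/2)"
      unfolding INF_less_iff by blast
    then show ?thesis using sup_dist_lessD[OF f(2)] unfolding comp_def by blast
  qed
  ultimately show ?thesis
    using \<pi> bs(1) Ss pS \<pi>.prob_space_axioms unfolding near_coupling_def couplings_def by blast
qed

lemma box_dist_nonneg: "box_dist X Y \<ge> 0"
  by (simp add: box_dist_eq)

lemma box_dist_le_1:
  assumes "geo_data_set X" "geo_data_set Y"
  shows "box_dist X Y \<le> 1"
  using box_inf_le_1[OF assms] unfolding box_dist_eq
  by (metis enn2real_1 enn2real_mono ennreal_one_less_top)

section \<open>The triangle inequality\<close>

lemma near_couplingD:
  assumes "near_coupling X Y e \<pi> S"
  shows "prob_space \<pi>" "sets \<pi> = sets (meas X \<Otimes>\<^sub>M meas Y)"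
    "fst \<in> measurable \<pi> (meas X)" "snd \<in> measurable \<pi> (meas Y)"
    "distr \<pi> (meas X) fst = meas X" "distr \<pi> (meas Y) snd = meas Y"
    "S \<in> sets \<pi>" "measure \<pi> S \<ge> 1 - e"
    "\<And>f. f \<in> features X \<Longrightarrow> \<exists>g\<in>features Y. \<forall>z\<in>S. \<bar>f (fst z) - g (snd z)\<bar> \<le> e / 2"
    "\<And>g. g \<in> features Y \<Longrightarrow> \<exists>f\<in>features X. \<forall>z\<in>S. \<bar>f (fst z) - g (snd z)\<bar> \<le> e / 2"
proof -
  show s: "sets \<pi> = sets (meas X \<Otimes>\<^sub>M meas Y)" using assms by (simp add: near_coupling_def)
  show "fst \<in> measurable \<pi> (meas X)" "snd \<in> measurable \<pi> (meas Y)"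
    using measurable_cong_sets[OF s refl] by auto
qed (use assms in \<open>auto simp: near_coupling_def\<close>)

text \<open>A coupling read with \<open>fst\<close> and \<open>snd\<close> exchanged is a coupling
  of the swapped pair; the slack \<open>\<eta>\<close> is there because the infimum is only
  approached.\<close>

lemma box_dist_commute:
  assumes gX: "geo_data_set X" and gY: "geo_data_set Y"
  shows "box_dist X Y = box_dist Y X"
proof -
  \<comment> \<open>Stated for arbitrary types, so that it can be used in both directions.\<close>
  have *: "box_dist A B \<le> box_dist B A" if gA: "geo_data_set A" and gB: "geo_data_set B"
    for A :: "'c geo_data" and B :: "'d geo_data"
  proof (rule field_le_epsilon)
    fix \<eta> :: real assume "\<eta> > 0"
    then obtain \<pi> S where c: "near_coupling B A (box_dist B A + \<eta>) \<pi> S"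
      using box_dist_lessD[OF gB gA, of "box_dist B A + \<eta>"] by auto
    note n = near_couplingD[OF c]
    interpret A: geo A by unfold_locales fact
    interpret B: geo B by unfold_locales fact
    show "box_dist A B \<le> box_dist B A + \<eta>"
    proof (rule box_distI[OF gA gB n(1) n(4,6,3,5,7,8)])
      show "box_dist B A + \<eta> \<ge> 0" using \<open>\<eta> > 0\<close> box_dist_nonneg[of B A] by simp
    next
      fix f assume "f \<in> features A"
      from n(10)[OF this] show "\<exists>g\<in>feat_closure B. \<forall>w\<in>S. \<bar>f (snd w) - g (fst w)\<bar> \<le> (box_dist B A + \<eta>) / 2"
        using B.F_closure by (metis abs_minus_commute subsetD)
    next
      fix g assume "g \<in> features B"
      from n(9)[OF this] show "\<exists>f\<in>feat_closure A. \<forall>w\<in>S. \<bar>f (snd w) - g (fst w)\<bar> \<le> (box_dist B A + \<eta>) / 2"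
        using A.F_closure by (metis abs_minus_commute subsetD)
    qed
  qed
  show ?thesis using *[OF gX gY] *[OF gY gX] by linarith
qed

text \<open>
  Gluing along a countable partition needs no disintegration: conditionally on the cell, the two
  measures are taken independent.
\<close>

lemma glue_along_partition:
  fixes a :: "'a \<Rightarrow> nat" and b :: "'b \<Rightarrow> nat"
  assumes "prob_space \<sigma>" "prob_space \<tau>"
    and a[measurable]: "a \<in> measurable \<sigma> (count_space UNIV)" and b[measurable]: "b \<in> measurable \<tau> (count_space UNIV)"
    and eq: "\<And>i. measure \<sigma> (a -` {i} \<inter> space \<sigma>) = measure \<tau> (b -` {i} \<inter> space \<tau>)"
  shows "\<exists>P. prob_space P \<and> sets P = sets (\<sigma> \<Otimes>\<^sub>M \<tau>) \<and> distr P \<sigma> fst = \<sigma> \<and> distr P \<tau> snd = \<tau> \<and>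
    measure P {w \<in> space (\<sigma> \<Otimes>\<^sub>M \<tau>). a (fst w) = b (snd w)} = 1"
proof -
  interpret s: prob_space \<sigma> by fact
  interpret t: prob_space \<tau> by fact
  interpret st: pair_prob_space \<sigma> \<tau> ..
  define m where "m i = emeasure \<sigma> (a -` {i} \<inter> space \<sigma>)" for i
  have m': "m i = emeasure \<tau> (b -` {i} \<inter> space \<tau>)" for i
    by (simp add: m_def s.emeasure_eq_measure t.emeasure_eq_measure eq)
  have mt: "m i \<noteq> \<top>" for i by (simp add: m_def s.emeasure_eq_measure)
  have inv: "inverse (m i) * m i = 1" if "m i \<noteq> 0" for i
    using ennreal_divide_self[of "m i"] that mt[of i] by (simp add: divide_ennreal_def mult.commute less_top)
  \<comment> \<open>The density that makes the coordinates independent given the common label: on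
    label \<open>i\<close> the product measure is divided by the mass \<open>m i\<close> of the
    cell.\<close>
  define k where "k w = (if a (fst w) = b (snd w) then inverse (m (a (fst w))) else 0)" for w
  have "(\<lambda>w. a (fst w)) \<in> measurable (\<sigma> \<Otimes>\<^sub>M \<tau>) (count_space UNIV)" by measurable
  then have [measurable]: "(\<lambda>w. inverse (m (a (fst w)))) \<in> borel_measurable (\<sigma> \<Otimes>\<^sub>M \<tau>)"
    by (rule measurable_compose) simp
  \<comment> \<open>Equality of the labels is written as a countable union over their common value,
    which makes it visibly measurable.\<close>
  have "Measurable.pred (\<sigma> \<Otimes>\<^sub>M \<tau>) (\<lambda>w. \<exists>i. a (fst w) = i \<and> b (snd w) = i)" by measurable
  then have [measurable]: "Measurable.pred (\<sigma> \<Otimes>\<^sub>M \<tau>) (\<lambda>w. a (fst w) = b (snd w))" by (simp add: eq_commute)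
  have k[measurable]: "k \<in> borel_measurable (\<sigma> \<Otimes>\<^sub>M \<tau>)" unfolding k_def by measurable
  define P where "P = density (\<sigma> \<Otimes>\<^sub>M \<tau>) k"
  have sP: "sets P = sets (\<sigma> \<Otimes>\<^sub>M \<tau>)" "space P = space (\<sigma> \<Otimes>\<^sub>M \<tau>)" by (simp_all add: P_def)
  have fs: "fst \<in> measurable P \<sigma>" "snd \<in> measurable P \<tau>"
    using measurable_cong_sets[OF sP(1) refl] by auto
  have ka: "(\<integral>\<^sup>+v. k (u, v) \<partial>\<tau>) = inverse (m (a u)) * m (a u)" for u
  proof -
    have "(\<integral>\<^sup>+v. k (u, v) \<partial>\<tau>) = (\<integral>\<^sup>+v. inverse (m (a u)) * indicator (b -` {a u} \<inter> space \<tau>) v \<partial>\<tau>)"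
      by (rule nn_integral_cong) (auto simp: k_def indicator_def)
    also have "\<dots> = inverse (m (a u)) * m (a u)"
      unfolding m'[of "a u"] by (rule nn_integral_cmult_indicator) measurable
    finally show ?thesis .
  qed
  have kb: "(\<integral>\<^sup>+u. k (u, v) \<partial>\<sigma>) = inverse (m (b v)) * m (b v)" for v
  proof -
    have "(\<integral>\<^sup>+u. k (u, v) \<partial>\<sigma>) = (\<integral>\<^sup>+u. inverse (m (b v)) * indicator (a -` {b v} \<inter> space \<sigma>) u \<partial>\<sigma>)"
      by (rule nn_integral_cong) (auto simp: k_def indicator_def)
    also have "\<dots> = inverse (m (b v)) * m (b v)"
      unfolding m_def[of "b v"] by (rule nn_integral_cmult_indicator) measurable
    finally show ?thesis .
  qed
  \<comment> \<open>For a cell of mass 0 the product \<open>inverse (m i) * m i\<close> is 0 in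
    \<open>ennreal\<close>, not 1; such cells are null, so the marginals still come out
    right.\<close>
  have "AE u in \<sigma>. \<forall>i. m i = 0 \<longrightarrow> a u \<noteq> i"
    unfolding AE_all_countable
  proof
    fix i show "AE u in \<sigma>. m i = 0 \<longrightarrow> a u \<noteq> i"
    proof (cases "m i = 0")
      case True
      then have "a -` {i} \<inter> space \<sigma> \<in> null_sets \<sigma>" by (auto simp: m_def)
      from AE_not_in[OF this] show ?thesis using AE_space by eventually_elim auto
    qed simp
  qed
  then have ra: "AE u in \<sigma>. inverse (m (a u)) * m (a u) = 1"
    by eventually_elim (auto intro: inv)
  have "AE v in \<tau>. \<forall>i. m i = 0 \<longrightarrow> b v \<noteq> i"
    unfolding AE_all_countable
  proof
    fix i show "AE v in \<tau>. m i = 0 \<longrightarrow> b v \<noteq> i"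
    proof (cases "m i = 0")
      case True
      then have "b -` {i} \<inter> space \<tau> \<in> null_sets \<tau>" by (auto simp: m')
      from AE_not_in[OF this] show ?thesis using AE_space by eventually_elim auto
    qed simp
  qed
  then have rb: "AE v in \<tau>. inverse (m (b v)) * m (b v) = 1"
    by eventually_elim (auto intro: inv)
  have d1: "distr P \<sigma> fst = \<sigma>"
  proof (rule measure_eqI)
    fix E assume "E \<in> sets (distr P \<sigma> fst)"
    then have E[measurable]: "E \<in> sets \<sigma>" by simp
    have "emeasure (distr P \<sigma> fst) E = emeasure P (fst -` E \<inter> space P)"
      using fs E by (simp add: emeasure_distr)
    also have "\<dots> = (\<integral>\<^sup>+w. k w * indicator (fst -` E \<inter> space P) w \<partial>(\<sigma> \<Otimes>\<^sub>M \<tau>))"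
      unfolding P_def by (subst emeasure_density) (simp_all add: measurable_sets[OF fs(1) E, unfolded sP])
    also have "\<dots> = (\<integral>\<^sup>+w. indicator E (fst w) * k w \<partial>(\<sigma> \<Otimes>\<^sub>M \<tau>))"
      by (rule nn_integral_cong) (auto simp: indicator_def sP)
    also have "\<dots> = (\<integral>\<^sup>+u. \<integral>\<^sup>+v. indicator E (fst (u,v)) * k (u,v) \<partial>\<tau> \<partial>\<sigma>)"
      by (rule t.nn_integral_fst[symmetric]) measurable
    also have "\<dots> = (\<integral>\<^sup>+u. indicator E u * (inverse (m (a u)) * m (a u)) \<partial>\<sigma>)"
      by (rule nn_integral_cong) (simp add: ka[symmetric] nn_integral_cmult)
    also have "\<dots> = (\<integral>\<^sup>+u. indicator E u \<partial>\<sigma>)"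
      by (rule nn_integral_cong_AE) (use ra in \<open>eventually_elim, simp\<close>)
    finally show "emeasure (distr P \<sigma> fst) E = emeasure \<sigma> E" by simp
  qed simp
  have d2: "distr P \<tau> snd = \<tau>"
  proof (rule measure_eqI)
    fix E assume "E \<in> sets (distr P \<tau> snd)"
    then have E[measurable]: "E \<in> sets \<tau>" by simp
    have "emeasure (distr P \<tau> snd) E = emeasure P (snd -` E \<inter> space P)"
      using fs E by (simp add: emeasure_distr)
    also have "\<dots> = (\<integral>\<^sup>+w. k w * indicator (snd -` E \<inter> space P) w \<partial>(\<sigma> \<Otimes>\<^sub>M \<tau>))"
      unfolding P_def by (subst emeasure_density) (simp_all add: measurable_sets[OF fs(2) E, unfolded sP])
    also have "\<dots> = (\<integral>\<^sup>+w. indicator E (snd w) * k w \<partial>(\<sigma> \<Otimes>\<^sub>M \<tau>))"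
      by (rule nn_integral_cong) (auto simp: indicator_def sP)
    also have "\<dots> = (\<integral>\<^sup>+v. \<integral>\<^sup>+u. indicator E (snd (u,v)) * k (u,v) \<partial>\<sigma> \<partial>\<tau>)"
      by (rule st.nn_integral_snd[symmetric]) measurable
    also have "\<dots> = (\<integral>\<^sup>+v. indicator E v * (inverse (m (b v)) * m (b v)) \<partial>\<tau>)"
      by (rule nn_integral_cong) (simp add: kb[symmetric] nn_integral_cmult)
    also have "\<dots> = (\<integral>\<^sup>+v. indicator E v \<partial>\<tau>)"
      by (rule nn_integral_cong_AE) (use rb in \<open>eventually_elim, simp\<close>)
    finally show "emeasure (distr P \<tau> snd) E = emeasure \<tau> E" by simp
  qed simp
  have PP: "prob_space P"
  proof
    have "emeasure P (fst -` space \<sigma> \<inter> space P) = emeasure (distr P \<sigma> fst) (space \<sigma>)"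
      using fs by (simp add: emeasure_distr)
    moreover have "fst -` space \<sigma> \<inter> space P = space P" by (auto simp: sP space_pair_measure)
    ultimately show "emeasure P (space P) = 1" using d1 s.emeasure_space_1 by simp
  qed
  interpret P: prob_space P by fact
  have "AE w in P. a (fst w) = b (snd w)"
    unfolding P_def by (subst AE_density) (auto simp: k_def)
  then have "P.prob {w \<in> space P. a (fst w) = b (snd w)} = 1"
    by (intro P.prob_Collect_eq_1[THEN iffD2]) (auto simp: P_def)
  then show ?thesis using PP d1 d2 sP by auto
qed

text \<open>It suffices that the two copies of the middle point fall into one small cell: features
  of \<open>Y\<close> are 1-Lipschitz, so passing from one copy to the other costs at most the cell
  size.\<close>

lemma box_dist_triangle:
  assumes gX: "geo_data_set X" and gY: "geo_data_set Y" and gZ: "geo_data_set Z"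
  shows "box_dist X Z \<le> box_dist X Y + box_dist Y Z"
proof (rule field_le_epsilon)
  fix e :: real assume e: "e > 0"
  interpret X: geo X by unfold_locales fact
  interpret Y: geo Y by unfold_locales fact
  interpret Z: geo Z by unfold_locales fact
  \<comment> \<open>Two of the four quarters pay for the near-optimal couplings, two for the middle
    cell, whose error \<open>\<eta>\<close> in the features counts twice in the box
    distance.\<close>
  define \<eta> where "\<eta> = e / 4"
  have \<eta>: "\<eta> > 0" using e by (simp add: \<eta>_def)
  define u v where "u = box_dist X Y + \<eta>" and "v = box_dist Y Z + \<eta>"
  obtain \<sigma> S where c1: "near_coupling X Y u \<sigma> S"
    using box_dist_lessD[OF gX gY, of u] \<eta> by (auto simp: u_def)
  obtain \<tau> T where c2: "near_coupling Y Z v \<tau> T"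
    using box_dist_lessD[OF gY gZ, of v] \<eta> by (auto simp: v_def)
  note n1 = near_couplingD[OF c1] and n2 = near_couplingD[OF c2]
  obtain k where k: "inverse (real (Suc k)) < \<eta>" using reals_Archimedean[OF \<eta>] by auto
  obtain c :: "'b \<Rightarrow> nat" where c: "c \<in> measurable (meas Y) (count_space UNIV)"
    "\<And>x y. x \<in> points Y \<Longrightarrow> y \<in> points Y \<Longrightarrow> c x = c y \<Longrightarrow> feat_dist Y x y < inverse (real (Suc k))"
    using Y.cells by metis
  have sp1: "space \<sigma> = points X \<times> points Y" and sp2: "space \<tau> = points Y \<times> points Z"
    using sets_eq_imp_space_eq[OF n1(2)] sets_eq_imp_space_eq[OF n2(2)] by (auto simp: space_pair_measure)
  have "measure \<sigma> ((\<lambda>z. c (snd z)) -` {i} \<inter> space \<sigma>) = measure \<tau> ((\<lambda>z. c (fst z)) -` {i} \<inter> space \<tau>)" for i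
  proof -
    have C: "c -` {i} \<inter> space (meas Y) \<in> sets (meas Y)" using measurable_sets[OF c(1)] by auto
    have "(\<lambda>z. c (snd z)) -` {i} \<inter> space \<sigma> = snd -` (c -` {i} \<inter> space (meas Y)) \<inter> space \<sigma>"
      "(\<lambda>z. c (fst z)) -` {i} \<inter> space \<tau> = fst -` (c -` {i} \<inter> space (meas Y)) \<inter> space \<tau>"
      by (auto simp: sp1 sp2)
    then show ?thesis
      using measure_preserving_vimage[OF n1(4,6) C] measure_preserving_vimage[OF n2(3,5) C] by simp
  qed
  then obtain P where P: "prob_space P" "sets P = sets (\<sigma> \<Otimes>\<^sub>M \<tau>)" "distr P \<sigma> fst = \<sigma>" "distr P \<tau> snd = \<tau>"
    "measure P {w \<in> space (\<sigma> \<Otimes>\<^sub>M \<tau>). c (snd (fst w)) = c (fst (snd w))} = 1"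
    using glue_along_partition[OF n1(1) n2(1) measurable_compose[OF n1(4) c(1)] measurable_compose[OF n2(3) c(1)]]
    by blast
  interpret P: prob_space P by fact
  have fs: "fst \<in> measurable P \<sigma>" "snd \<in> measurable P \<tau>"
    using measurable_cong_sets[OF P(2) refl] by auto
  define D where "D = {w \<in> space (\<sigma> \<Otimes>\<^sub>M \<tau>). c (snd (fst w)) = c (fst (snd w))}"
  \<comment> \<open>A set outside the sigma-algebra has measure 0 by convention, so measure 1
    already shows that \<open>D\<close> is an event.\<close>
  have Ds: "D \<in> sets P"
  proof (rule ccontr)
    assume "D \<notin> sets P"
    then show False using P(5) measure_notin_sets[of D P] by (simp add: D_def)
  qed
  define A B where "A = fst -` S \<inter> space P" and "B = snd -` T \<inter> space P"
  have AB: "A \<in> sets P" "B \<in> sets P" "P.prob A \<ge> 1 - u" "P.prob B \<ge> 1 - v"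
    unfolding A_def B_def
    using measurable_sets[OF fs(1) n1(7)] measurable_sets[OF fs(2) n2(7)] n1(8) n2(8)
      measure_preserving_vimage[OF fs(1) P(3) n1(7)] measure_preserving_vimage[OF fs(2) P(4) n2(7)]
    by simp_all
  have "P.prob (A \<inter> B) \<ge> 1 - (u + v)" by (rule prob_Int_ge[OF P(1) AB])
  then have "P.prob ((A \<inter> B) \<inter> D) \<ge> 1 - ((u + v) + 0)"
    using AB Ds P(5) by (intro prob_Int_ge[OF P(1)]) (auto simp: D_def)
  then have W: "P.prob ((A \<inter> B) \<inter> D) \<ge> 1 - (u + v + 2 * \<eta>)" using \<eta> by linarith
  have WD: "snd (fst w) \<in> points Y \<and> fst (snd w) \<in> points Y \<and> feat_dist Y (snd (fst w)) (fst (snd w)) < \<eta>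
      \<and> fst w \<in> S \<and> snd w \<in> T"
    if "w \<in> (A \<inter> B) \<inter> D" for w
  proof -
    have "snd (fst w) \<in> points Y" "fst (snd w) \<in> points Y" "c (snd (fst w)) = c (fst (snd w))" "fst w \<in> S" "snd w \<in> T"
      using that by (auto simp: D_def A_def B_def space_pair_measure sp1 sp2)
    then show ?thesis using c(2)[of "snd (fst w)" "fst (snd w)"] k by auto
  qed
  have pm: "(fst \<circ> fst) \<in> measurable P (meas X)" "(snd \<circ> snd) \<in> measurable P (meas Z)"
    using measurable_comp[OF fs(1) n1(3)] measurable_comp[OF fs(2) n2(4)] .
  have pd: "distr P (meas X) (fst \<circ> fst) = meas X" "distr P (meas Z) (snd \<circ> snd) = meas Z"
    using distr_distr[OF n1(3) fs(1)] distr_distr[OF n2(4) fs(2)] P(3,4) n1(5) n2(6) by simp_all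
  have "box_dist X Z \<le> u + v + 2 * \<eta>"
  proof (rule box_distI[OF gX gZ P(1) pm(1) pd(1) pm(2) pd(2) _ W])
    show "A \<inter> B \<inter> D \<in> P.events" using AB Ds by blast
    show "0 \<le> u + v + 2 * \<eta>" using \<eta> box_dist_nonneg[of X Y] box_dist_nonneg[of Y Z] by (simp add: u_def v_def)
  next
    fix f assume f: "f \<in> features X"
    obtain g where g: "g \<in> features Y" "\<forall>z\<in>S. \<bar>f (fst z) - g (snd z)\<bar> \<le> u / 2" using n1(9)[OF f] by blast
    obtain h where h: "h \<in> features Z" "\<forall>z\<in>T. \<bar>g (fst z) - h (snd z)\<bar> \<le> v / 2" using n2(9)[OF g(1)] by blast
    have "\<bar>f ((fst \<circ> fst) w) - h ((snd \<circ> snd) w)\<bar> \<le> (u + v + 2 * \<eta>) / 2" if w: "w \<in> A \<inter> B \<inter> D" for w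
    proof -
      have "\<bar>f (fst (fst w)) - g (snd (fst w))\<bar> \<le> u / 2" and gh: "\<bar>g (fst (snd w)) - h (snd (snd w))\<bar> \<le> v / 2"
        using g(2) h(2) WD[OF w] by blast+
      moreover have "\<bar>g (snd (fst w)) - g (fst (snd w))\<bar> \<le> \<eta>"
        using Y.feature_lipschitz[OF g(1)] WD[OF w] by (meson less_imp_le order_trans)
      ultimately have "\<bar>f (fst (fst w)) - g (fst (snd w))\<bar> \<le> u / 2 + \<eta>" using abs_chain by blast
      then show ?thesis unfolding comp_def using gh by (rule abs_chain) argo
    qed
    then show "\<exists>g\<in>feat_closure Z. \<forall>w\<in>A \<inter> B \<inter> D. \<bar>f ((fst \<circ> fst) w) - g ((snd \<circ> snd) w)\<bar> \<le> (u + v + 2 * \<eta>) / 2"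
      using h(1) Z.F_closure by blast
  next
    fix h assume h: "h \<in> features Z"
    obtain g where g: "g \<in> features Y" "\<forall>z\<in>T. \<bar>g (fst z) - h (snd z)\<bar> \<le> v / 2" using n2(10)[OF h] by blast
    obtain f where f: "f \<in> features X" "\<forall>z\<in>S. \<bar>f (fst z) - g (snd z)\<bar> \<le> u / 2" using n1(10)[OF g(1)] by blast
    have "\<bar>f ((fst \<circ> fst) w) - h ((snd \<circ> snd) w)\<bar> \<le> (u + v + 2 * \<eta>) / 2" if w: "w \<in> A \<inter> B \<inter> D" for w
    proof -
      have "\<bar>f (fst (fst w)) - g (snd (fst w))\<bar> \<le> u / 2" and gh: "\<bar>g (fst (snd w)) - h (snd (snd w))\<bar> \<le> v / 2"
        using g(2) f(2) WD[OF w] by blast+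
      moreover have "\<bar>g (snd (fst w)) - g (fst (snd w))\<bar> \<le> \<eta>"
        using Y.feature_lipschitz[OF g(1)] WD[OF w] by (meson less_imp_le order_trans)
      ultimately have "\<bar>f (fst (fst w)) - g (fst (snd w))\<bar> \<le> u / 2 + \<eta>" using abs_chain by blast
      then show ?thesis unfolding comp_def using gh by (rule abs_chain) argo
    qed
    then show "\<exists>f\<in>feat_closure X. \<forall>w\<in>A \<inter> B \<inter> D. \<bar>f ((fst \<circ> fst) w) - h ((snd \<circ> snd) w)\<bar> \<le> (u + v + 2 * \<eta>) / 2"
      using f(1) X.F_closure by blast
  qed
  then show "box_dist X Z \<le> box_dist X Y + box_dist Y Z + e" by (simp add: u_def v_def \<eta>_def)
qed

text \<open>The graph of the isomorphism carries a coupling along which the closures match exactly,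
  and \<open>box_distI\<close> accepts closures, hence error 0. This makes the choice of
  representatives harmless.\<close>

lemma isomorphic_imp_box_dist_0:
  assumes gX: "geo_data_set X" and gY: "geo_data_set Y" and iso: "isomorphic X Y"
  shows "box_dist X Y = 0"
proof -
  interpret X: geo X by unfold_locales fact
  interpret Y: geo Y by unfold_locales fact
  obtain \<phi> where \<phi>: "\<phi> \<in> measurable (meas X) (meas Y)" "distr (meas X) (meas Y) \<phi> = meas Y"
    "(\<lambda>f. compose (points X) f \<phi>) ` feat_closure Y = feat_closure X"
    using iso unfolding isomorphic_def by (elim bexE conjE)
  have "box_dist X Y \<le> 0"
  proof (rule box_distI[OF gX gY X.prob_meas measurable_ident_sets[OF refl] _ \<phi>(1,2), of "points X"])
    show "distr (meas X) (meas X) (\<lambda>x. x) = meas X" by (rule distr_id2) simp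
    show "points X \<in> X.events" using sets.top[of "meas X"] by simp
    show "1 - 0 \<le> X.prob (points X)" using X.prob_space by simp
  next
    fix f assume "f \<in> features X"
    then have "f \<in> (\<lambda>f. compose (points X) f \<phi>) ` feat_closure Y" using X.F_closure \<phi>(3) by blast
    then show "\<exists>g\<in>feat_closure Y. \<forall>w\<in>points X. \<bar>f w - g (\<phi> w)\<bar> \<le> 0 / 2" by (auto simp: compose_def)
  next
    fix g assume "g \<in> features Y"
    then have "compose (points X) g \<phi> \<in> feat_closure X" using Y.F_closure \<phi>(3) by blast
    then show "\<exists>f\<in>feat_closure X. \<forall>w\<in>points X. \<bar>f w - g (\<phi> w)\<bar> \<le> 0 / 2"
      by (intro bexI[of _ "compose (points X) g \<phi>"]) (auto simp: compose_def)
  qed simp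
  then show ?thesis using box_dist_nonneg[of X Y] by linarith
qed

section \<open>Ultralimits of couplings\<close>

definition ultra :: "'a filter \<Rightarrow> bool" where
  "ultra G \<longleftrightarrow> G \<noteq> bot \<and> (\<forall>P. eventually P G \<or> eventually (\<lambda>n. \<not> P n) G)"

text \<open>Identify \<open>n\<close> with the 0-1 family \<open>\<phi> n\<close> recording which
  sets contain it. These families lie in a compact product, so they have a cluster point
  \<open>x\<close>; the refinement of \<open>sequentially\<close> along which \<open>\<phi>\<close>
  tends to \<open>x\<close> decides every set, since the coordinates of \<open>x\<close> are 0 or
  1.\<close>

lemma ex_ultra_sequentially: "\<exists>G. ultra G \<and> G \<le> sequentially"
proof -
  define \<phi> where "\<phi> n = (\<lambda>A. if n \<in> A then 1 else (0::real))" for n :: nat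
  define K where "K = (PiE UNIV (\<lambda>_. {0,1}) :: (nat set \<Rightarrow> real) set)"
  have "compactin (product_topology (\<lambda>_::nat set. euclideanreal) UNIV) K"
    unfolding K_def by (subst compactin_PiE) (auto intro: finite_imp_compact)
  then have "compact K" by (simp add: euclidean_product_topology)
  moreover have "eventually (\<lambda>x. x \<in> K) (filtermap \<phi> sequentially)"
    by (simp add: eventually_filtermap \<phi>_def K_def PiE_iff)
  moreover have "filtermap \<phi> sequentially \<noteq> bot" by (simp add: filtermap_bot_iff)
  ultimately obtain x where x: "x \<in> K" "inf (nhds x) (filtermap \<phi> sequentially) \<noteq> bot"
    unfolding compact_filter by blast
  define G where "G = inf sequentially (filtercomap \<phi> (nhds x))"
  have ne: "G \<noteq> bot"
  proof
    assume "G = bot"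
    then have "eventually (\<lambda>_. False) G" by simp
    then obtain P Q where PQ: "eventually P sequentially" "eventually Q (filtercomap \<phi> (nhds x))" "\<And>n. \<not> (P n \<and> Q n)"
      unfolding G_def eventually_inf by blast
    then obtain R where R: "eventually R (nhds x)" "\<And>n. R (\<phi> n) \<Longrightarrow> Q n"
      unfolding eventually_filtercomap by blast
    have "eventually (\<lambda>y. \<not> R y) (filtermap \<phi> sequentially)"
      unfolding eventually_filtermap using PQ(1) by eventually_elim (use PQ(3) R(2) in blast)
    then have "eventually (\<lambda>_. False) (inf (nhds x) (filtermap \<phi> sequentially))"
      unfolding eventually_inf using R(1) by blast
    then show False using x(2) by (simp add: eventually_False)
  qed
  have lim: "(\<phi> \<longlongrightarrow> x) G" by (simp add: filterlim_iff_le_filtercomap G_def)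
  have "eventually P G \<or> eventually (\<lambda>n. \<not> P n) G" for P
  proof -
    have co: "((\<lambda>n. \<phi> n (Collect P)) \<longlongrightarrow> x (Collect P)) G"
      using continuous_on_tendsto_compose[OF continuous_on_product_coordinates lim] by simp
    have "x (Collect P) = 0 \<or> x (Collect P) = 1" using x(1) by (auto simp: K_def PiE_iff)
    then show ?thesis
    proof
      assume "x (Collect P) = 0"
      then have "eventually (\<lambda>n. \<phi> n (Collect P) < 1/2) G" using co by (intro order_tendstoD(2)[OF co]) simp
      then have "eventually (\<lambda>n. \<not> P n) G" by eventually_elim (auto simp: \<phi>_def)
      then show ?thesis ..
    next
      assume "x (Collect P) = 1"
      then have "eventually (\<lambda>n. \<phi> n (Collect P) > 1/2) G" using co by (intro order_tendstoD(1)[OF co]) simp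
      then have "eventually P G" by eventually_elim (auto simp: \<phi>_def split: if_splits)
      then show ?thesis ..
    qed
  qed
  moreover have "G \<le> sequentially" by (simp add: G_def)
  ultimately show ?thesis using ne by (auto simp: ultra_def)
qed

text \<open>Compactness gives a cluster point, and along an ultrafilter a cluster point is a limit
  because every neighbourhood is decided.\<close>

lemma ultra_bounded_convergent:
  fixes u :: "'a \<Rightarrow> real"
  assumes G: "ultra G" and b: "eventually (\<lambda>n. \<bar>u n\<bar> \<le> B) G"
  shows "\<exists>l. (u \<longlongrightarrow> l) G"
proof -
  have "compact {-B..B}" by simp
  moreover have "eventually (\<lambda>x. x \<in> {-B..B}) (filtermap u G)"
    unfolding eventually_filtermap using b by eventually_elim auto
  moreover have "filtermap u G \<noteq> bot" using G by (simp add: filtermap_bot_iff ultra_def)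
  ultimately obtain l where l: "inf (nhds l) (filtermap u G) \<noteq> bot"
    unfolding compact_filter by blast
  have "(u \<longlongrightarrow> l) G"
  proof (rule topological_tendstoI)
    fix S assume S: "open S" "l \<in> S"
    show "eventually (\<lambda>n. u n \<in> S) G"
    proof (rule ccontr)
      assume "\<not> ?thesis"
      then have "eventually (\<lambda>n. u n \<notin> S) G" using G by (auto simp: ultra_def)
      then have "eventually (\<lambda>x. x \<notin> S) (filtermap u G)" by (simp add: eventually_filtermap)
      moreover have "eventually (\<lambda>x. x \<in> S) (nhds l)" using S by (rule eventually_nhds_in_open)
      ultimately have "eventually (\<lambda>_. False) (inf (nhds l) (filtermap u G))"
        unfolding eventually_inf by blast
      then show False using l by (simp add: eventually_False)
    qed
  qed
  then show ?thesis by blast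
qed

text \<open>Supplies the domain on which Caratheodory's extension of the limit starts.\<close>

lemma semiring_of_rectangles:
  "semiring_of_sets (space A \<times> space B) {a \<times> b |a b. a \<in> sets A \<and> b \<in> sets B}"
proof (unfold_locales)
  show "{a \<times> b |a b. a \<in> sets A \<and> b \<in> sets B} \<subseteq> Pow (space A \<times> space B)"
    by (auto dest: sets.sets_into_space)
  show "{} \<in> {a \<times> b |a b. a \<in> sets A \<and> b \<in> sets B}" by auto
  fix u v assume "u \<in> {a \<times> b |a b. a \<in> sets A \<and> b \<in> sets B}" "v \<in> {a \<times> b |a b. a \<in> sets A \<and> b \<in> sets B}"
  then obtain a b c d where uv: "u = a \<times> b" "v = c \<times> d" "a \<in> sets A" "b \<in> sets B" "c \<in> sets A" "d \<in> sets B" by auto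
  show "u \<inter> v \<in> {a \<times> b |a b. a \<in> sets A \<and> b \<in> sets B}"
    using uv by (auto simp: Times_Int_Times intro!: exI[of _ "a \<inter> c"] exI[of _ "b \<inter> d"])
  show "\<exists>C\<subseteq>{a \<times> b |a b. a \<in> sets A \<and> b \<in> sets B}. finite C \<and> disjoint C \<and> u - v = \<Union> C"
  proof (intro exI[of _ "{(a - c) \<times> b, (a \<inter> c) \<times> (b - d)}"] conjI)
    show "{(a - c) \<times> b, (a \<inter> c) \<times> (b - d)} \<subseteq> {a \<times> b |a b. a \<in> sets A \<and> b \<in> sets B}"
      using uv by auto
    show "disjoint {(a - c) \<times> b, (a \<inter> c) \<times> (b - d)}" by (auto simp: disjoint_def)
  qed (auto simp: uv)
qed

text \<open>
  The limit along the ultrafilter exists on all measurable sets but is only finitely additive;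
  restricted to rectangles it is countably additive because its marginals are Radon.
\<close>

lemma ultralimit_coupling:
  fixes X :: "'a geo_data" and Y :: "'b geo_data" and \<pi> :: "nat \<Rightarrow> ('a \<times> 'b) measure"
  assumes gX: "geo_data_set X" and gY: "geo_data_set Y" and G: "ultra G"
    and \<pi>: "\<And>n. prob_space (\<pi> n)" and s\<pi>: "\<And>n. sets (\<pi> n) = sets (meas X \<Otimes>\<^sub>M meas Y)"
    and mX: "\<And>n. distr (\<pi> n) (meas X) fst = meas X" and mY: "\<And>n. distr (\<pi> n) (meas Y) snd = meas Y"
  shows "\<exists>\<rho>. prob_space \<rho> \<and> sets \<rho> = sets (meas X \<Otimes>\<^sub>M meas Y) \<and> distr \<rho> (meas X) fst = meas X \<and>
    distr \<rho> (meas Y) snd = meas Y \<and>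
    (\<forall>A\<in>sets (meas X). \<forall>B\<in>sets (meas Y). ((\<lambda>n. measure (\<pi> n) (A \<times> B)) \<longlongrightarrow> measure \<rho> (A \<times> B)) G)"
proof -
  interpret X: geo X by unfold_locales fact
  interpret Y: geo Y by unfold_locales fact
  have Gne: "G \<noteq> bot" using G by (simp add: ultra_def)
  let ?M = "sets (meas X \<Otimes>\<^sub>M meas Y)"
  have sp: "space (\<pi> n) = points X \<times> points Y" for n
    using sets_eq_imp_space_eq[OF s\<pi>] by (simp add: space_pair_measure)
  have fst: "fst \<in> measurable (\<pi> n) (meas X)" and snd: "snd \<in> measurable (\<pi> n) (meas Y)" for n
    using measurable_cong_sets[OF s\<pi> refl] by auto
  have "\<exists>l. ((\<lambda>n. measure (\<pi> n) E) \<longlongrightarrow> l) G" for E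
    using prob_space.prob_le_1[OF \<pi>] by (intro ultra_bounded_convergent[OF G, of _ 1]) auto
  then obtain p where p: "\<And>E. ((\<lambda>n. measure (\<pi> n) E) \<longlongrightarrow> p E) G" by metis
  have p0: "p E \<ge> 0" for E
    by (rule tendsto_lowerbound[OF p _ Gne]) simp
  have pmono: "p E \<le> p F" if "E \<subseteq> F" "F \<in> ?M" for E F
  proof (rule tendsto_le[OF Gne p p], rule always_eventually, rule allI)
    fix n interpret P: prob_space "\<pi> n" by (rule \<pi>)
    show "P.prob E \<le> P.prob F" using that s\<pi> by (intro P.finite_measure_mono) auto
  qed
  have psub: "p (E \<union> F) \<le> p E + p F" if "E \<in> ?M" "F \<in> ?M" for E F
    by (rule tendsto_le[OF Gne tendsto_add[OF p p] p], rule always_eventually)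
      (use that s\<pi> in \<open>auto intro!: measure_Un_le\<close>)
  have pUN: "p (\<Union>i\<in>I. E i) \<le> (\<Sum>i\<in>I. p (E i))" if "finite I" "\<And>i. i \<in> I \<Longrightarrow> E i \<in> ?M" for I :: "nat set" and E
    by (rule tendsto_le[OF Gne tendsto_sum[OF p] p], rule always_eventually)
      (use that s\<pi> in \<open>auto intro!: measure_UNION_le\<close>)
  have padd: "p (\<Union>i\<in>I. E i) = (\<Sum>i\<in>I. p (E i))"
    if "finite I" "\<And>i. i \<in> I \<Longrightarrow> E i \<in> ?M" "disjoint_family_on E I" for I :: "nat set" and E
  proof (rule tendsto_unique[OF Gne p])
    have "measure (\<pi> n) (\<Union>i\<in>I. E i) = (\<Sum>i\<in>I. measure (\<pi> n) (E i))" for n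
    proof -
      interpret P: prob_space "\<pi> n" by (rule \<pi>)
      show ?thesis using that s\<pi> by (intro P.finite_measure_finite_Union) auto
    qed
    then show "((\<lambda>n. measure (\<pi> n) (\<Union>i\<in>I. E i)) \<longlongrightarrow> (\<Sum>i\<in>I. p (E i))) G"
      using tendsto_sum[OF p] by simp
  qed
  have pX: "p (A \<times> points Y) = X.prob A" if A: "A \<in> sets (meas X)" for A
  proof (rule tendsto_unique[OF Gne p])
    have "fst -` A \<inter> space (\<pi> n) = A \<times> points Y" for n
      using sets.sets_into_space[OF A] by (auto simp: sp)
    then have "measure (\<pi> n) (A \<times> points Y) = X.prob A" for n
      using measure_preserving_vimage[OF fst mX A] by metis
    then show "((\<lambda>n. measure (\<pi> n) (A \<times> points Y)) \<longlongrightarrow> X.prob A) G" by simp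
  qed
  have pY: "p (points X \<times> B) = Y.prob B" if B: "B \<in> sets (meas Y)" for B
  proof (rule tendsto_unique[OF Gne p])
    have "snd -` B \<inter> space (\<pi> n) = points X \<times> B" for n
      using sets.sets_into_space[OF B] by (auto simp: sp)
    then have "measure (\<pi> n) (points X \<times> B) = Y.prob B" for n
      using measure_preserving_vimage[OF snd mY B] by metis
    then show "((\<lambda>n. measure (\<pi> n) (points X \<times> B)) \<longlongrightarrow> Y.prob B) G" by simp
  qed
  have tX: "points X \<in> sets (meas X)" and tY: "points Y \<in> sets (meas Y)"
    using sets.top[of "meas X"] sets.top[of "meas Y"] by auto
  \<comment> \<open>A rectangle leaves another only through two strips, whose limit masses are given
    by the marginals; approximation in each factor therefore controls \<open>p\<close>.\<close>
  have rect_diff: "p (a \<times> b) \<le> p (a' \<times> b') + X.prob (a - a') + Y.prob (b - b')"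
    if s: "a \<in> sets (meas X)" "b \<in> sets (meas Y)" "a' \<in> sets (meas X)" "b' \<in> sets (meas Y)" for a b a' b'
  proof -
    have sub: "a \<subseteq> points X" "b \<subseteq> points Y" using sets.sets_into_space s by fastforce+
    have "p (a \<times> b) \<le> p ((a' \<times> b' \<union> (a - a') \<times> points Y) \<union> points X \<times> (b - b'))"
      using s sub tX tY by (intro pmono) auto
    also have "\<dots> \<le> p (a' \<times> b' \<union> (a - a') \<times> points Y) + p (points X \<times> (b - b'))"
      using s tX tY by (intro psub) auto
    also have "p (a' \<times> b' \<union> (a - a') \<times> points Y) \<le> p (a' \<times> b') + p ((a - a') \<times> points Y)"
      using s tX tY by (intro psub) auto
    finally show ?thesis using pX[of "a - a'"] pY[of "b - b'"] s by auto
  qed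
  define R where "R = {a \<times> b |a b. a \<in> sets (meas X) \<and> b \<in> sets (meas Y)}"
  have RM: "R \<subseteq> ?M" by (auto simp: R_def)
  interpret R: semiring_of_sets "points X \<times> points Y" R
    using semiring_of_rectangles[of "meas X" "meas Y"] by (simp add: R_def)
  have ca: "countably_additive R (\<lambda>E. ennreal (p E))"
    unfolding countably_additive_def
  proof (intro allI impI)
    fix A :: "nat \<Rightarrow> ('a \<times> 'b) set"
    assume A: "range A \<subseteq> R" and dj: "disjoint_family A" and U: "(\<Union>i. A i) \<in> R"
    have AM: "A i \<in> ?M" for i using A RM by auto
    show "(\<Sum>i. ennreal (p (A i))) = ennreal (p (\<Union>i. A i))"
    proof (rule antisym)
      have "(\<Sum>i<n. ennreal (p (A i))) \<le> ennreal (p (\<Union>i. A i))" for n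
      proof -
        have "(\<Sum>i<n. ennreal (p (A i))) = ennreal (\<Sum>i<n. p (A i))" using p0 by (simp add: sum_ennreal)
        also have "(\<Sum>i<n. p (A i)) = p (\<Union>i<n. A i)"
          using dj AM by (intro padd[symmetric]) (auto simp: disjoint_family_on_def)
        also have "p (\<Union>i<n. A i) \<le> p (\<Union>i. A i)" using U RM by (intro pmono) auto
        finally show ?thesis using p0 by (simp add: ennreal_leI)
      qed
      then show "(\<Sum>i. ennreal (p (A i))) \<le> ennreal (p (\<Union>i. A i))"
        by (intro suminf_le_const[OF summableI]) auto
    next
      \<comment> \<open>Only this inequality needs regularity: shrink the union to a compact
        rectangle, enlarge each piece to an open one, pass to a finite subcover and use finite
        subadditivity.\<close>
      show "ennreal (p (\<Union>i. A i)) \<le> (\<Sum>i. ennreal (p (A i)))"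
      proof (rule ennreal_le_epsilon)
        fix e :: real assume e: "e > 0"
        obtain a b where ab: "(\<Union>i. A i) = a \<times> b" "a \<in> sets (meas X)" "b \<in> sets (meas Y)"
          using U by (auto simp: R_def)
        have "\<forall>i. \<exists>c d. A i = c \<times> d \<and> c \<in> sets (meas X) \<and> d \<in> sets (meas Y)"
        proof
          fix i
          have "A i \<in> R" using A by blast
          then show "\<exists>c d. A i = c \<times> d \<and> c \<in> sets (meas X) \<and> d \<in> sets (meas Y)" by (simp add: R_def)
        qed
        then obtain c d where cd: "\<And>i. A i = c i \<times> d i" "\<And>i. c i \<in> sets (meas X)" "\<And>i. d i \<in> sets (meas Y)"
          by metis
        obtain K where K: "compactin X.mtopology K" "K \<in> sets (meas X)" "K \<subseteq> a" "X.prob (a - K) < e/4"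
          using X.compact_approx[OF ab(2), of "e/4"] e by auto
        obtain L where L: "compactin Y.mtopology L" "L \<in> sets (meas Y)" "L \<subseteq> b" "Y.prob (b - L) < e/4"
          using Y.compact_approx[OF ab(3), of "e/4"] e by auto
        \<comment> \<open>The compact factors lose \<open>e/4\<close> each, and enlarging both
          factors of every piece adds \<open>2 * \<delta> i\<close>, at most \<open>e/2\<close> in
          total.\<close>
        define \<delta> where "\<delta> i = e/4 * (1/2)^Suc i" for i
        have \<delta>: "\<delta> i > 0" for i using e by (simp add: \<delta>_def)
        have "\<forall>i. \<exists>U. openin X.mtopology U \<and> U \<in> sets (meas X) \<and> c i \<subseteq> U \<and> X.prob (U - c i) < \<delta> i"
          using X.open_approx[OF cd(2) \<delta>] by blast
        then obtain U where U: "\<And>i. openin X.mtopology (U i)" "\<And>i. U i \<in> sets (meas X)" "\<And>i. c i \<subseteq> U i"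
            "\<And>i. X.prob (U i - c i) < \<delta> i" by metis
        have "\<forall>i. \<exists>V. openin Y.mtopology V \<and> V \<in> sets (meas Y) \<and> d i \<subseteq> V \<and> Y.prob (V - d i) < \<delta> i"
          using Y.open_approx[OF cd(3) \<delta>] by blast
        then obtain V where V: "\<And>i. openin Y.mtopology (V i)" "\<And>i. V i \<in> sets (meas Y)" "\<And>i. d i \<subseteq> V i"
            "\<And>i. Y.prob (V i - d i) < \<delta> i" by metis
        have cKL: "compactin (prod_topology X.mtopology Y.mtopology) (K \<times> L)"
          using K(1) L(1) by (simp add: compactin_Times)
        have cov: "K \<times> L \<subseteq> \<Union>(range (\<lambda>i. U i \<times> V i))"
        proof
          fix z assume "z \<in> K \<times> L"
          then have "z \<in> (\<Union>i. A i)" using ab(1) K(3) L(3) by auto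
          then obtain i where "z \<in> c i \<times> d i" using cd(1) by auto
          then show "z \<in> \<Union>(range (\<lambda>i. U i \<times> V i))" using U(3) V(3) by blast
        qed
        have "\<exists>\<F>. finite \<F> \<and> \<F> \<subseteq> range (\<lambda>i. U i \<times> V i) \<and> K \<times> L \<subseteq> \<Union>\<F>"
          by (rule compactinD[OF cKL _ cov]) (use U(1) V(1) in \<open>auto simp: openin_prod_Times_iff\<close>)
        then obtain \<F> where F: "finite \<F>" "\<F> \<subseteq> range (\<lambda>i. U i \<times> V i)" "K \<times> L \<subseteq> \<Union>\<F>" by blast
        obtain I where I: "finite I" "\<F> = (\<lambda>i. U i \<times> V i) ` I"
          using finite_subset_image[OF F(1,2)] by blast
        have "p (a \<times> b) \<le> p (K \<times> L) + X.prob (a - K) + Y.prob (b - L)"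
          by (rule rect_diff[OF ab(2,3) K(2) L(2)])
        moreover have "p (K \<times> L) \<le> p (\<Union>i\<in>I. U i \<times> V i)"
          using F(3) I U(2) V(2) by (intro pmono) auto
        moreover have "p (\<Union>i\<in>I. U i \<times> V i) \<le> (\<Sum>i\<in>I. p (U i \<times> V i))"
          using U(2) V(2) by (intro pUN I(1)) auto
        moreover have "(\<Sum>i\<in>I. p (U i \<times> V i)) \<le> (\<Sum>i\<in>I. p (A i) + 2 * \<delta> i)"
        proof (rule sum_mono)
          fix i
          have "p (U i \<times> V i) \<le> p (c i \<times> d i) + X.prob (U i - c i) + Y.prob (V i - d i)"
            by (rule rect_diff[OF U(2) V(2) cd(2,3)])
          then show "p (U i \<times> V i) \<le> p (A i) + 2 * \<delta> i" using U(4)[of i] V(4)[of i] cd(1)[of i] by simp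
        qed
        moreover have "(\<Sum>i\<in>I. p (A i) + 2 * \<delta> i) = (\<Sum>i\<in>I. p (A i)) + 2 * (\<Sum>i\<in>I. \<delta> i)"
          by (simp add: sum.distrib sum_distrib_left)
        moreover have "(\<Sum>i\<in>I. \<delta> i) \<le> e/4"
        proof -
          have sm: "\<delta> sums (e/4)"
            using sums_mult[OF power_half_series, of "e/4"] by (simp add: \<delta>_def[abs_def])
          have "(\<Sum>i\<in>I. \<delta> i) \<le> suminf \<delta>"
            using sums_summable[OF sm] I(1) \<delta> by (intro sum_le_suminf) (auto intro: less_imp_le)
          then show ?thesis using sums_unique[OF sm] by simp
        qed
        ultimately have "p (a \<times> b) \<le> (\<Sum>i\<in>I. p (A i)) + e" using K(4) L(4) by linarith
        then have "ennreal (p (\<Union>i. A i)) \<le> ennreal ((\<Sum>i\<in>I. p (A i)) + e)" unfolding ab(1) by (rule ennreal_leI)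
        also have "\<dots> = (\<Sum>i\<in>I. ennreal (p (A i))) + ennreal e"
          using p0 e by (simp add: ennreal_plus sum_nonneg sum_ennreal)
        also have "\<dots> \<le> (\<Sum>i. ennreal (p (A i))) + ennreal e"
          using I(1) by (intro add_mono sum_le_suminf summableI) auto
        finally show "ennreal (p (\<Union>i. A i)) \<le> (\<Sum>i. ennreal (p (A i))) + ennreal e" .
      qed
    qed
  qed
  have "p {} = 0" using padd[of "{}" "\<lambda>_. {}"] by (simp add: disjoint_family_on_def)
  then have pos: "positive R (\<lambda>E. ennreal (p E))" by (simp add: positive_def)
  obtain \<mu> where \<mu>: "\<And>E. E \<in> R \<Longrightarrow> \<mu> E = ennreal (p E)" "measure_space (points X \<times> points Y) (sigma_sets (points X \<times> points Y) R) \<mu>"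
    using R.caratheodory[OF pos ca] by metis
  define \<rho> where "\<rho> = measure_of (points X \<times> points Y) R \<mu>"
  have Rp: "R \<subseteq> Pow (points X \<times> points Y)" by (rule R.space_closed)
  have s\<rho>: "sets \<rho> = ?M" unfolding \<rho>_def using Rp by (simp add: sets_pair_measure R_def)
  have sp\<rho>: "space \<rho> = points X \<times> points Y" using sets_eq_imp_space_eq[OF s\<rho>] by (simp add: space_pair_measure)
  have em: "emeasure \<rho> (A \<times> B) = ennreal (p (A \<times> B))" if AB: "A \<in> sets (meas X)" "B \<in> sets (meas Y)" for A B
  proof -
    have "A \<times> B \<in> R" using AB by (auto simp: R_def)
    then have "emeasure \<rho> (A \<times> B) = \<mu> (A \<times> B)"
      unfolding \<rho>_def emeasure_measure_of_conv using \<mu>(2) by (simp add: sigma_sets.Basic)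
    then show ?thesis using \<mu>(1) \<open>A \<times> B \<in> R\<close> by simp
  qed
  have f: "fst \<in> measurable \<rho> (meas X)" and s: "snd \<in> measurable \<rho> (meas Y)"
    using measurable_cong_sets[OF s\<rho> refl] by auto
  have dX: "distr \<rho> (meas X) fst = meas X"
  proof (rule measure_eqI)
    fix A assume "A \<in> sets (distr \<rho> (meas X) fst)"
    then have A: "A \<in> sets (meas X)" by simp
    have "fst -` A \<inter> space \<rho> = A \<times> points Y" using sets.sets_into_space[OF A] by (auto simp: sp\<rho>)
    then show "emeasure (distr \<rho> (meas X) fst) A = emeasure (meas X) A"
      using em[OF A tY] pX[OF A] by (simp add: emeasure_distr[OF f A] X.emeasure_eq_measure)
  qed simp
  have dY: "distr \<rho> (meas Y) snd = meas Y"
  proof (rule measure_eqI)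
    fix A assume "A \<in> sets (distr \<rho> (meas Y) snd)"
    then have A: "A \<in> sets (meas Y)" by simp
    have "snd -` A \<inter> space \<rho> = points X \<times> A" using sets.sets_into_space[OF A] by (auto simp: sp\<rho>)
    then show "emeasure (distr \<rho> (meas Y) snd) A = emeasure (meas Y) A"
      using em[OF tX A] pY[OF A] by (simp add: emeasure_distr[OF s A] Y.emeasure_eq_measure)
  qed simp
  have pr: "prob_space \<rho>"
  proof
    show "emeasure \<rho> (space \<rho>) = 1" using em[OF tX tY] pX[OF tX] X.prob_space by (simp add: sp\<rho>)
  qed
  have "measure \<rho> (A \<times> B) = p (A \<times> B)" if AB: "A \<in> sets (meas X)" "B \<in> sets (meas Y)" for A B
    using em[OF AB] p0 by (simp add: measure_def)
  then show ?thesis using pr s\<rho> dX dY p by metis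
qed

section \<open>The infimum is attained\<close>

text \<open>By \<open>near\<close>, every point of \<open>S\<close> is a limit of points of the
  \<open>T n\<close>. Hence the partners \<open>g n\<close> are eventually bounded at one point of
  \<open>S\<close>, then at every point by the Lipschitz bound, and converge pointwise along
  \<open>G\<close>; a pointwise limit of features lies in the closure.\<close>

lemma ultralimit_feature:
  fixes X :: "'a geo_data" and Y :: "'b geo_data"
  assumes gX: "geo_data_set X" and gY: "geo_data_set Y" and G: "ultra G"
    and near: "\<And>z r. z \<in> S \<Longrightarrow> r > 0 \<Longrightarrow> eventually (\<lambda>n. \<exists>w\<in>T n. fst w \<in> points X \<and> snd w \<in> points Y \<and>
        feat_dist X (fst w) (fst z) < r \<and> feat_dist Y (snd w) (snd z) < r) G"
    and S: "S \<noteq> {}" "S \<subseteq> points X \<times> points Y"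
    and f: "f \<in> features X" and g: "\<And>n. g n \<in> features Y"
    and fg: "\<And>n w. w \<in> T n \<Longrightarrow> \<bar>f (fst w) - g n (snd w)\<bar> \<le> b n" and b: "(b \<longlongrightarrow> \<beta>) G"
  shows "\<exists>h\<in>feat_closure Y. \<forall>z\<in>S. \<bar>f (fst z) - h (snd z)\<bar> \<le> \<beta>"
proof -
  interpret X: geo X by unfold_locales fact
  interpret Y: geo Y by unfold_locales fact
  have Gne: "G \<noteq> bot" using G by (simp add: ultra_def)
  have close: "eventually (\<lambda>n. \<bar>f (fst z) - g n (snd z)\<bar> \<le> b n + 2 * r) G" if z: "z \<in> S" and r: "r > 0" for z r
    using near[OF z r]
  proof eventually_elim
    case (elim n)
    then obtain w where w: "w \<in> T n" "fst w \<in> points X" "snd w \<in> points Y"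
      "feat_dist X (fst w) (fst z) < r" "feat_dist Y (snd w) (snd z) < r" by blast
    have zp: "fst z \<in> points X" "snd z \<in> points Y" using z S by auto
    have "\<bar>f (fst w) - f (fst z)\<bar> \<le> r" "\<bar>g n (snd w) - g n (snd z)\<bar> \<le> r"
      using X.feature_lipschitz[OF f w(2) zp(1)] Y.feature_lipschitz[OF g w(3) zp(2), of n] w(4,5) by linarith+
    with fg[OF w(1)] show ?case by (auto simp: abs_le_iff)
  qed
  obtain z0 where z0: "z0 \<in> S" using S by blast
  have y0: "snd z0 \<in> points Y" using z0 S by auto
  have lim: "\<exists>l. ((\<lambda>n. g n y) \<longlongrightarrow> l) G" if y: "y \<in> points Y" for y
  proof (rule ultra_bounded_convergent[OF G])
    \<comment> \<open>At \<open>z0\<close> the error is at most \<open>b n + 2\<close>, and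
      eventually \<open>b n < \<beta> + 1\<close>; together they make the 3 in the bound.\<close>
    have "eventually (\<lambda>n. b n < \<beta> + 1) G" using b by (intro order_tendstoD(2)[OF b]) simp
    with close[OF z0, of 1, OF zero_less_one]
    show "eventually (\<lambda>n. \<bar>g n y\<bar> \<le> \<bar>f (fst z0)\<bar> + \<beta> + 3 + feat_dist Y y (snd z0)) G"
    proof eventually_elim
      case (elim n)
      have "\<bar>g n y - g n (snd z0)\<bar> \<le> feat_dist Y y (snd z0)" by (rule Y.feature_lipschitz[OF g y y0])
      with elim show ?case by linarith
    qed
  qed
  then obtain l where l: "\<And>y. y \<in> points Y \<Longrightarrow> ((\<lambda>n. g n y) \<longlongrightarrow> l y) G" by metis
  define h where "h = restrict l (points Y)"
  have hl: "((\<lambda>n. g n y) \<longlongrightarrow> h y) G" if "y \<in> points Y" for y using l that by (simp add: h_def)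
  have "h \<in> feat_closure Y"
    unfolding feat_closure_iff[OF Y.F_ext]
  proof (intro conjI allI impI)
    show "h \<in> points Y \<rightarrow>\<^sub>E UNIV" by (simp add: h_def)
    fix A and e :: real assume A: "finite A \<and> A \<subseteq> points Y \<and> 0 < e"
    have "eventually (\<lambda>n. \<forall>a\<in>A. \<bar>g n a - h a\<bar> < e) G"
    proof (rule eventually_ball_finite)
      show "\<forall>a\<in>A. \<forall>\<^sub>F n in G. \<bar>g n a - h a\<bar> < e"
      proof
        fix a assume "a \<in> A"
        then have "((\<lambda>n. g n a) \<longlongrightarrow> h a) G" using hl A by blast
        from tendstoD[OF this, of e] A show "\<forall>\<^sub>F n in G. \<bar>g n a - h a\<bar> < e" by (simp add: dist_real_def)
      qed
    qed (use A in simp)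
    then obtain n where "\<forall>a\<in>A. \<bar>g n a - h a\<bar> < e" using eventually_happens'[OF Gne] by blast
    then show "\<exists>f\<in>features Y. \<forall>a\<in>A. \<bar>f a - h a\<bar> < e" using g by blast
  qed
  moreover have "\<bar>f (fst z) - h (snd z)\<bar> \<le> \<beta>" if z: "z \<in> S" for z
  proof (rule field_le_epsilon)
    fix e :: real assume e: "e > 0"
    have y: "snd z \<in> points Y" using z S by auto
    show "\<bar>f (fst z) - h (snd z)\<bar> \<le> \<beta> + e"
    proof (rule tendsto_le[OF Gne])
      show "((\<lambda>n. b n + 2 * (e/2)) \<longlongrightarrow> \<beta> + e) G" using tendsto_add[OF b tendsto_const, of e] by simp
      show "((\<lambda>n. \<bar>f (fst z) - g n (snd z)\<bar>) \<longlongrightarrow> \<bar>f (fst z) - h (snd z)\<bar>) G"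
        by (intro tendsto_rabs tendsto_diff tendsto_const hl y)
      show "eventually (\<lambda>n. \<bar>f (fst z) - g n (snd z)\<bar> \<le> b n + 2 * (e/2)) G"
        using close[OF z, of "e/2"] e by simp
    qed
  qed
  ultimately show ?thesis by blast
qed

text \<open>Convergence of the couplings says nothing about the sets, so a limit of the
  \<open>T n\<close> is built from cells: at each scale a product cell is kept unless
  \<open>T n\<close> misses it for \<open>G\<close>-almost all \<open>n\<close>.\<close>

lemma box_dist_attained:
  fixes X :: "'a geo_data" and Y :: "'b geo_data"
  assumes gX: "geo_data_set X" and gY: "geo_data_set Y" and D1: "box_dist X Y < 1"
  shows "\<exists>\<rho> S. prob_space \<rho> \<and> sets \<rho> = sets (meas X \<Otimes>\<^sub>M meas Y) \<and> distr \<rho> (meas X) fst = meas X \<and>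
    distr \<rho> (meas Y) snd = meas Y \<and> S \<in> sets \<rho> \<and> S \<noteq> {} \<and> measure \<rho> S \<ge> 1 - box_dist X Y \<and>
    (\<forall>f\<in>features X. \<exists>g\<in>feat_closure Y. \<forall>z\<in>S. \<bar>f (fst z) - g (snd z)\<bar> \<le> box_dist X Y / 2) \<and>
    (\<forall>g\<in>features Y. \<exists>f\<in>feat_closure X. \<forall>z\<in>S. \<bar>f (fst z) - g (snd z)\<bar> \<le> box_dist X Y / 2)"
proof -
  interpret X: geo X by unfold_locales fact
  interpret Y: geo Y by unfold_locales fact
  define D where "D = box_dist X Y"
  define b where "b n = D + inverse (real (Suc n))" for n
  have "\<forall>n. \<exists>\<pi> S. near_coupling X Y (b n) \<pi> S"
    using box_dist_lessD[OF gX gY] by (simp add: b_def D_def)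
  then obtain \<pi> T where nc: "\<And>n. near_coupling X Y (b n) (\<pi> n) (T n)" by metis
  note n = near_couplingD[OF nc]
  obtain G where G: "ultra G" "G \<le> sequentially" using ex_ultra_sequentially by blast
  have Gne: "G \<noteq> bot" using G by (simp add: ultra_def)
  have "b \<longlonglongrightarrow> D + 0" unfolding b_def by (intro tendsto_add tendsto_const LIMSEQ_inverse_real_of_nat)
  then have b: "(b \<longlongrightarrow> D) G" using tendsto_mono[OF G(2)] by simp
  obtain \<rho> where r: "prob_space \<rho>" "sets \<rho> = sets (meas X \<Otimes>\<^sub>M meas Y)" "distr \<rho> (meas X) fst = meas X"
    "distr \<rho> (meas Y) snd = meas Y"
    and r5: "\<forall>A\<in>sets (meas X). \<forall>B\<in>sets (meas Y). ((\<lambda>n. measure (\<pi> n) (A \<times> B)) \<longlongrightarrow> measure \<rho> (A \<times> B)) G"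
    using ultralimit_coupling[where \<pi> = \<pi>, OF gX gY G(1) n(1,2,5,6)] by (elim exE conjE)
  interpret r: prob_space \<rho> by fact
  have spr: "space \<rho> = points X \<times> points Y" using sets_eq_imp_space_eq[OF r(2)] by (simp add: space_pair_measure)
  have spn: "space (\<pi> n) = points X \<times> points Y" for n
    using sets_eq_imp_space_eq[OF n(2)] by (simp add: space_pair_measure)
  obtain c :: "nat \<Rightarrow> 'a \<Rightarrow> nat" where c: "\<And>k. c k \<in> measurable (meas X) (count_space UNIV)"
    "\<And>k x y. x \<in> points X \<Longrightarrow> y \<in> points X \<Longrightarrow> c k x = c k y \<Longrightarrow> feat_dist X x y < inverse (real (Suc k))"
    using X.cells by metis
  obtain d :: "nat \<Rightarrow> 'b \<Rightarrow> nat" where d: "\<And>k. d k \<in> measurable (meas Y) (count_space UNIV)"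
    "\<And>k x y. x \<in> points Y \<Longrightarrow> y \<in> points Y \<Longrightarrow> d k x = d k y \<Longrightarrow> feat_dist Y x y < inverse (real (Suc k))"
    using Y.cells by metis
  define A where "A k m = c k -` {fst (prod_decode m)} \<inter> space (meas X)" for k m
  define B where "B k m = d k -` {snd (prod_decode m)} \<inter> space (meas Y)" for k m
  define R where "R k m = A k m \<times> B k m" for k m
  have As: "A k m \<in> sets (meas X)" and Bs: "B k m \<in> sets (meas Y)" for k m
    using measurable_sets[OF c(1)] measurable_sets[OF d(1)] unfolding A_def B_def by auto
  have Rs: "R k m \<in> sets \<rho>" "R k m \<in> sets (\<pi> n)" for k m n using As Bs r(2) n(2) by (auto simp: R_def)
  have Rd: "m = m'" if "z \<in> R k m" "z \<in> R k m'" for z k m m'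
  proof -
    have "prod_decode m = prod_decode m'" using that by (auto simp: R_def A_def B_def prod_eq_iff)
    then show ?thesis by (metis prod_decode_inverse)
  qed
  have Rc: "z \<in> R k (prod_encode (c k (fst z), d k (snd z)))" if "z \<in> space \<rho>" for z k
    using that by (auto simp: R_def A_def B_def spr)
  define E where "E k = {m. eventually (\<lambda>n. R k m \<inter> T n = {}) G}" for k
  define V where "V k = (\<Union>m\<in>E k. R k m)" for k
  have Vs: "V k \<in> sets \<rho>" for k unfolding V_def using Rs by (intro sets.countable_UN'') auto
  \<comment> \<open>The ultralimit commutes with finite sums only. The bound is therefore proved for
    finitely many discarded cells, whose union misses \<open>T n\<close> for \<open>G\<close>-almost
    all \<open>n\<close>, and then passed to the countable union.\<close>
  have VD: "measure \<rho> (V k) \<le> D" for k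
  proof -
    define J where "J N = E k \<inter> {..<N}" for N
    have "measure \<rho> (\<Union>m\<in>J N. R k m) \<le> D" for N
    proof -
      have fJ: "finite (J N)" by (simp add: J_def)
      have dj: "disjoint_family_on (R k) (J N)" using Rd by (auto simp: disjoint_family_on_def)
      have "measure \<rho> (\<Union>m\<in>J N. R k m) = (\<Sum>m\<in>J N. measure \<rho> (R k m))"
        using fJ dj Rs by (intro r.finite_measure_finite_Union) auto
      also have "\<dots> \<le> D"
      proof (rule tendsto_le[OF Gne b])
        show "((\<lambda>n. \<Sum>m\<in>J N. measure (\<pi> n) (R k m)) \<longlongrightarrow> (\<Sum>m\<in>J N. measure \<rho> (R k m))) G"
          unfolding R_def by (intro tendsto_sum r5[rule_format] As Bs)
        have "eventually (\<lambda>n. \<forall>m\<in>J N. R k m \<inter> T n = {}) G"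
          by (rule eventually_ball_finite[OF fJ]) (simp add: J_def E_def)
        then show "eventually (\<lambda>n. (\<Sum>m\<in>J N. measure (\<pi> n) (R k m)) \<le> b n) G"
        proof eventually_elim
          case (elim n)
          interpret P: prob_space "\<pi> n" by (rule n(1))
          have "(\<Sum>m\<in>J N. P.prob (R k m)) = P.prob (\<Union>m\<in>J N. R k m)"
            using fJ dj Rs by (intro P.finite_measure_finite_Union[symmetric]) auto
          also have "\<dots> \<le> P.prob (space (\<pi> n) - T n)"
          proof (rule P.finite_measure_mono)
            have "R k m \<subseteq> space (\<pi> n)" for m using sets.sets_into_space[OF Rs(2)] .
            then show "(\<Union>m\<in>J N. R k m) \<subseteq> space (\<pi> n) - T n" using elim by blast
          qed (use n(7)[of n] in auto)
          also have "\<dots> \<le> b n" using P.prob_compl[OF n(7)] n(8)[of n] by simp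
          finally show ?case .
        qed
      qed
      finally show ?thesis .
    qed
    moreover have "(\<lambda>N. measure \<rho> (\<Union>m\<in>J N. R k m)) \<longlonglongrightarrow> measure \<rho> (\<Union>N. \<Union>m\<in>J N. R k m)"
      using Rs by (intro r.finite_Lim_measure_incseq) (auto simp: incseq_def J_def)
    ultimately have "measure \<rho> (\<Union>N. \<Union>m\<in>J N. R k m) \<le> D" by (intro LIMSEQ_le_const2) auto
    moreover have "(\<Union>N. \<Union>m\<in>J N. R k m) = V k" by (auto simp: J_def V_def)
    ultimately show ?thesis by simp
  qed
  \<comment> \<open>Nothing nests the partitions, so intersecting all kept sets could add up the
    losses. The limit superior loses at most \<open>D\<close>, and a point kept at arbitrarily fine
    scales is already a limit of points of the \<open>T n\<close>.\<close>
  define S where "S = (\<Inter>i. \<Union>k\<in>{i..}. space \<rho> - V k)"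
  have Ws: "(\<Union>k\<in>{i..}. space \<rho> - V k) \<in> sets \<rho>" for i using Vs by (intro sets.countable_UN'') auto
  have Ss: "S \<in> sets \<rho>" unfolding S_def using Ws by (intro sets.countable_INT) auto
  have "1 - D \<le> measure \<rho> (\<Union>k\<in>{i..}. space \<rho> - V k)" for i
  proof -
    have "1 - D \<le> measure \<rho> (space \<rho> - V i)" using VD[of i] r.prob_compl[OF Vs] by simp
    also have "\<dots> \<le> measure \<rho> (\<Union>k\<in>{i..}. space \<rho> - V k)"
      using Ws by (intro r.finite_measure_mono) auto
    finally show ?thesis .
  qed
  moreover have "(\<lambda>i. measure \<rho> (\<Union>k\<in>{i..}. space \<rho> - V k)) \<longlonglongrightarrow> measure \<rho> S"
    unfolding S_def using Ws by (intro r.finite_Lim_measure_decseq) (auto simp: decseq_def)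
  ultimately have SD: "measure \<rho> S \<ge> 1 - D" by (intro LIMSEQ_le_const) auto
  then have Sne: "S \<noteq> {}" using D1 by (auto simp: D_def)
  have Ssub: "S \<subseteq> points X \<times> points Y" using sets.sets_into_space[OF Ss] by (simp add: spr)
  have near: "eventually (\<lambda>n. \<exists>w\<in>T n. fst w \<in> points X \<and> snd w \<in> points Y \<and>
        feat_dist X (fst w) (fst z) < e \<and> feat_dist Y (snd w) (snd z) < e) G" if z: "z \<in> S" and e: "e > 0" for z e
  proof -
    obtain i where i: "inverse (real (Suc i)) < e" using reals_Archimedean[OF e] by blast
    obtain k where k: "k \<ge> i" "z \<in> space \<rho>" "z \<notin> V k" using z by (auto simp: S_def)
    define m where "m = prod_encode (c k (fst z), d k (snd z))"
    have zR: "z \<in> R k m" using Rc[OF k(2)] by (simp add: m_def)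
    then have "m \<notin> E k" using k(3) by (auto simp: V_def)
    then have "eventually (\<lambda>n. \<not> R k m \<inter> T n = {}) G" using G(1) unfolding ultra_def E_def by blast
    then show ?thesis
    proof eventually_elim
      case (elim n)
      then obtain w where w: "w \<in> R k m" "w \<in> T n" by blast
      have "inverse (real (Suc k)) \<le> inverse (real (Suc i))" using k(1) by (intro le_imp_inverse_le) auto
      then have ik: "inverse (real (Suc k)) < e" using i by (rule le_less_trans)
      have p: "fst w \<in> points X" "snd w \<in> points Y" "c k (fst w) = c k (fst z)" "d k (snd w) = d k (snd z)"
        "fst z \<in> points X" "snd z \<in> points Y"
        using w(1) k(2) by (auto simp: R_def A_def B_def m_def spr)
      have "feat_dist X (fst w) (fst z) < inverse (real (Suc k))" "feat_dist Y (snd w) (snd z) < inverse (real (Suc k))"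
        by (rule c(2) d(2); fact p)+
      then have "feat_dist X (fst w) (fst z) < e" "feat_dist Y (snd w) (snd z) < e" using ik by linarith+
      then show ?case using w(2) p by blast
    qed
  qed
  have b2: "((\<lambda>n. b n / 2) \<longlongrightarrow> D / 2) G" using tendsto_divide[OF b tendsto_const[of 2]] by simp
  have fw: "\<exists>g\<in>feat_closure Y. \<forall>z\<in>S. \<bar>f (fst z) - g (snd z)\<bar> \<le> D / 2" if f: "f \<in> features X" for f
  proof -
    have "\<forall>n. \<exists>g\<in>features Y. \<forall>z\<in>T n. \<bar>f (fst z) - g (snd z)\<bar> \<le> b n / 2" using n(9)[OF f] by blast
    then obtain g where g: "\<And>n. g n \<in> features Y" "\<And>n z. z \<in> T n \<Longrightarrow> \<bar>f (fst z) - g n (snd z)\<bar> \<le> b n / 2" by metis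
    show ?thesis by (rule ultralimit_feature[OF gX gY G(1) near Sne Ssub f g b2])
  qed
  have bw: "\<exists>f\<in>feat_closure X. \<forall>z\<in>S. \<bar>f (fst z) - g (snd z)\<bar> \<le> D / 2" if g: "g \<in> features Y" for g
  proof -
    have "\<forall>n. \<exists>f\<in>features X. \<forall>z\<in>T n. \<bar>f (fst z) - g (snd z)\<bar> \<le> b n / 2" using n(10)[OF g] by blast
    then obtain f where f: "\<And>n. f n \<in> features X" "\<And>n z. z \<in> T n \<Longrightarrow> \<bar>f n (fst z) - g (snd z)\<bar> \<le> b n / 2" by metis
    \<comment> \<open>The backward direction is the forward lemma for the swapped sets.\<close>
    have "\<exists>h\<in>feat_closure X. \<forall>z\<in>prod.swap ` S. \<bar>g (fst z) - h (snd z)\<bar> \<le> D / 2"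
    proof (rule ultralimit_feature[OF gY gX G(1) _ _ _ g f(1) _ b2, where T = "\<lambda>n. prod.swap ` T n"])
      fix z :: "'b \<times> 'a" and e :: real assume z: "z \<in> prod.swap ` S" and e: "e > 0"
      then have "prod.swap z \<in> S" by auto
      from near[OF this e]
      show "eventually (\<lambda>n. \<exists>w\<in>prod.swap ` T n. fst w \<in> points Y \<and> snd w \<in> points X \<and>
        feat_dist Y (fst w) (fst z) < e \<and> feat_dist X (snd w) (snd z) < e) G"
        by eventually_elim force
    next
      fix n w assume "w \<in> prod.swap ` T n"
      then show "\<bar>g (fst w) - f n (snd w)\<bar> \<le> b n / 2" using f(2)[of "prod.swap w" n] by (auto simp: abs_minus_commute)
    qed (use Sne Ssub in auto)
    then obtain h where h: "h \<in> feat_closure X" "\<forall>z\<in>prod.swap ` S. \<bar>g (fst z) - h (snd z)\<bar> \<le> D / 2" by blast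
    have "\<bar>h (fst z) - g (snd z)\<bar> \<le> D / 2" if "z \<in> S" for z
      using h(2) that by (auto simp: abs_minus_commute)
    then show ?thesis using h(1) by blast
  qed
  show ?thesis using r(1-4) Ss Sne SD fw bw unfolding D_def by blast
qed

section \<open>The data set generated by a family of functions\<close>

text \<open>\<open>H_cells\<close> does threefold duty: it makes the evaluation map measurable, the
  quotient separable, and almost every point land in the support. \<open>H_bdd\<close> makes the
  distance finite.\<close>

locale feature_family = prob_space P for P :: "'w measure" +
  fixes H :: "('w \<Rightarrow> real) set"
  assumes H_ne: "H \<noteq> {}"
    and H_cells: "\<And>k::nat. \<exists>c\<in>measurable P (count_space (UNIV::nat set)). \<forall>w\<in>space P. \<forall>w'\<in>space P.
      c w = c w' \<longrightarrow> (\<forall>h\<in>H. \<bar>h w - h w'\<bar> \<le> inverse (real (Suc k)))"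
    and H_bdd: "\<And>w w'. w \<in> space P \<Longrightarrow> w' \<in> space P \<Longrightarrow> bdd_above ((\<lambda>h. \<bar>h w - h w'\<bar>) ` H)"
begin

text \<open>
  Sending \<open>w\<close> to its evaluation \<open>h \<mapsto> h w\<close> identifies the points that \<open>H\<close> does not
  separate.  The carrier below is the support of the image of \<open>P\<close> for the uniform distance on
  functions on \<open>H\<close>; being closed there, it is complete.
\<close>

definition pts :: "(('w \<Rightarrow> real) \<Rightarrow> real) set" where
  "pts = {z \<in> extensional H. \<forall>e>0. \<exists>A\<in>events. emeasure P A > 0 \<and> (\<forall>w\<in>A. \<forall>h\<in>H. \<bar>h w - z h\<bar> \<le> e)}"

definition feats :: "((('w \<Rightarrow> real) \<Rightarrow> real) \<Rightarrow> real) set" where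
  "feats = (\<lambda>h. \<lambda>z\<in>pts. z h) ` H"

text \<open>Distance and topology depend only on points and features, and the Borel measure can be
  formed only once the topology is known; hence the placeholder.\<close>

definition pre :: "(('w \<Rightarrow> real) \<Rightarrow> real) geo_data" where
  "pre = \<lparr>points = pts, features = feats, meas = undefined\<rparr>"

abbreviation dst where "dst \<equiv> feat_dist pre"

lemma pre_sel [simp]: "points pre = pts" "features pre = feats" by (simp_all add: pre_def)

lemma pts_near:
  assumes "z \<in> pts" "e > 0"
  shows "\<exists>A\<in>events. emeasure P A > 0 \<and> (\<forall>w\<in>A. \<forall>h\<in>H. \<bar>h w - z h\<bar> \<le> e)"
  using assms unfolding pts_def by blast

lemma pts_near_point:
  assumes "z \<in> pts" "e > 0"
  shows "\<exists>w\<in>space P. \<forall>h\<in>H. \<bar>h w - z h\<bar> \<le> e"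
proof -
  obtain A where A: "A \<in> events" "emeasure P A > 0" "\<forall>w\<in>A. \<forall>h\<in>H. \<bar>h w - z h\<bar> \<le> e" using pts_near[OF assms] by blast
  then have "A \<noteq> {}" by auto
  then show ?thesis using A sets.sets_into_space[OF A(1)] by blast
qed

lemma pts_bdd:
  assumes "z \<in> pts" "y \<in> pts" shows "bdd_above ((\<lambda>h. \<bar>z h - y h\<bar>) ` H)"
proof -
  obtain u where u: "u \<in> space P" "\<forall>h\<in>H. \<bar>h u - z h\<bar> \<le> 1" using pts_near_point[OF assms(1), of 1] by auto
  obtain v where v: "v \<in> space P" "\<forall>h\<in>H. \<bar>h v - y h\<bar> \<le> 1" using pts_near_point[OF assms(2), of 1] by auto
  obtain b where b: "\<And>h. h \<in> H \<Longrightarrow> \<bar>h u - h v\<bar> \<le> b" using H_bdd[OF u(1) v(1)] by (auto simp: bdd_above_def)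
  have "\<bar>z h - y h\<bar> \<le> b + 2" if "h \<in> H" for h
    using b[OF that] bspec[OF u(2) that] bspec[OF v(2) that] by (auto simp: abs_le_iff)
  then show ?thesis by (auto simp: bdd_above_def)
qed

lemma dst_eq: "z \<in> pts \<Longrightarrow> y \<in> pts \<Longrightarrow> dst z y = (SUP h\<in>H. \<bar>z h - y h\<bar>)"
  by (simp add: feat_dist_def feats_def image_image)

lemma dst_ge: "z \<in> pts \<Longrightarrow> y \<in> pts \<Longrightarrow> h \<in> H \<Longrightarrow> \<bar>z h - y h\<bar> \<le> dst z y"
  unfolding dst_eq by (intro cSUP_upper pts_bdd)

lemma dst_le: "z \<in> pts \<Longrightarrow> y \<in> pts \<Longrightarrow> (\<And>h. h \<in> H \<Longrightarrow> \<bar>z h - y h\<bar> \<le> r) \<Longrightarrow> dst z y \<le> r"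
  unfolding dst_eq by (intro cSUP_least H_ne)

sublocale Z: Metric_space pts dst
proof
  fix x y
  show "0 \<le> dst x y"
  proof (cases "x \<in> pts \<and> y \<in> pts")
    case True
    obtain h where "h \<in> H" using H_ne by blast
    then show ?thesis using dst_ge[of x y h] True by linarith
  qed (auto simp: feat_dist_def)
  show "dst x y = dst y x" by (simp add: feat_dist_def abs_minus_commute)
next
  fix x y assume xy: "x \<in> pts" "y \<in> pts"
  show "(dst x y = 0) = (x = y)"
  proof
    assume "dst x y = 0"
    then have "x h = y h" if "h \<in> H" for h using dst_ge[OF xy that] by simp
    then show "x = y" using xy by (auto simp: pts_def intro: extensionalityI)
  next
    assume "x = y"
    obtain h where "h \<in> H" using H_ne by blast
    then show "dst x y = 0" using dst_le[OF xy, of 0] dst_ge[OF xy, of h] \<open>x = y\<close> by simp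
  qed
next
  fix x y z assume xyz: "x \<in> pts" "y \<in> pts" "z \<in> pts"
  show "dst x z \<le> dst x y + dst y z"
  proof (rule dst_le[OF xyz(1,3)])
    fix h assume h: "h \<in> H"
    show "\<bar>x h - z h\<bar> \<le> dst x y + dst y z"
      using dst_ge[OF xyz(1,2) h] dst_ge[OF xyz(2,3) h] by (rule abs_chain) simp
  qed
qed

text \<open>A Cauchy sequence converges uniformly on \<open>H\<close>. The limit stays in the
  support, since an event close to a late term is still close to the limit.\<close>

lemma dst_complete: "Z.mcomplete"
  unfolding Z.mcomplete_def
proof (intro allI impI)
  fix s assume s: "Z.MCauchy s"
  then have sP: "s n \<in> pts" for n by (auto simp: Z.MCauchy_def)
  have C: "\<exists>N. \<forall>m n. N \<le> m \<longrightarrow> N \<le> n \<longrightarrow> dst (s m) (s n) < e" if "e > 0" for e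
    using s that by (auto simp: Z.MCauchy_def)
  have "\<exists>l. (\<lambda>n. s n h) \<longlonglongrightarrow> l" if h: "h \<in> H" for h
  proof -
    have "Cauchy (\<lambda>n. s n h)"
    proof (rule metric_CauchyI)
      fix e :: real assume "e > 0"
      from C[OF this] show "\<exists>M. \<forall>m\<ge>M. \<forall>n\<ge>M. dist (s m h) (s n h) < e"
        using dst_ge[OF sP sP h] unfolding dist_real_def by (meson le_less_trans)
    qed
    then show ?thesis using Cauchy_convergent_iff convergent_def by blast
  qed
  then obtain l where l: "\<And>h. h \<in> H \<Longrightarrow> (\<lambda>n. s n h) \<longlonglongrightarrow> l h" by metis
  define z where "z = restrict l H"
  have unif: "\<exists>N. \<forall>n\<ge>N. \<forall>h\<in>H. \<bar>s n h - z h\<bar> \<le> e" if e: "e > 0" for e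
  proof -
    obtain N where N: "\<And>m n. N \<le> m \<Longrightarrow> N \<le> n \<Longrightarrow> dst (s m) (s n) < e" using C[OF e] by blast
    have "\<bar>s n h - z h\<bar> \<le> e" if n: "n \<ge> N" and h: "h \<in> H" for n h
    proof (rule LIMSEQ_le_const2)
      show "(\<lambda>m. \<bar>s n h - s m h\<bar>) \<longlonglongrightarrow> \<bar>s n h - z h\<bar>"
        using l[OF h] h by (intro tendsto_rabs tendsto_diff tendsto_const) (simp add: z_def)
      show "\<exists>M. \<forall>m\<ge>M. \<bar>s n h - s m h\<bar> \<le> e"
        using dst_ge[OF sP sP h, of n] N[OF n] by (meson less_imp_le order_trans)
    qed
    then show ?thesis by blast
  qed
  have zP: "z \<in> pts"
    unfolding pts_def
  proof (intro CollectI conjI allI impI)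
    show "z \<in> extensional H" by (simp add: z_def)
    fix e :: real assume e: "e > 0"
    obtain N where N: "\<And>n h. n \<ge> N \<Longrightarrow> h \<in> H \<Longrightarrow> \<bar>s n h - z h\<bar> \<le> e/2" using unif[of "e/2"] e by auto
    obtain A where A: "A \<in> events" "emeasure P A > 0" "\<forall>w\<in>A. \<forall>h\<in>H. \<bar>h w - s N h\<bar> \<le> e/2"
      using pts_near[OF sP[of N], of "e/2"] e by auto
    have "\<bar>h w - z h\<bar> \<le> e" if "w \<in> A" "h \<in> H" for w h
    proof -
      have "\<bar>h w - s N h\<bar> \<le> e/2" using A(3) that by blast
      then show ?thesis using N[OF order_refl that(2)] by (rule abs_chain) simp
    qed
    then show "\<exists>A\<in>events. 0 < emeasure P A \<and> (\<forall>w\<in>A. \<forall>h\<in>H. \<bar>h w - z h\<bar> \<le> e)" using A by blast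
  qed
  have "limitin Z.mtopology s z sequentially"
    unfolding Z.limit_metric_sequentially
  proof (intro conjI zP allI impI)
    fix e :: real assume e: "e > 0"
    obtain N where N: "\<And>n h. n \<ge> N \<Longrightarrow> h \<in> H \<Longrightarrow> \<bar>s n h - z h\<bar> \<le> e/2" using unif[of "e/2"] e by auto
    have "dst (s n) z < e" if "n \<ge> N" for n
      using dst_le[OF sP zP N[OF that]] e by simp
    then show "\<exists>N. \<forall>n\<ge>N. s n \<in> pts \<and> dst (s n) z < e" using sP by blast
  qed
  then show "\<exists>x. limitin Z.mtopology s x sequentially" by blast
qed

text \<open>Choose one support point for each scale and each cell that comes near the support. A
  further support point near the same cell lies within three times the scale of the chosen
  one.\<close>

lemma dst_separable: "separable_space Z.mtopology"
proof -
  obtain c :: "nat \<Rightarrow> 'w \<Rightarrow> nat" where c: "\<And>k. \<forall>w\<in>space P. \<forall>w'\<in>space P.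
      c k w = c k w' \<longrightarrow> (\<forall>h\<in>H. \<bar>h w - h w'\<bar> \<le> inverse (real (Suc k)))" using H_cells by metis
  define Q where "Q k j = {z\<in>pts. \<exists>w\<in>space P. c k w = j \<and> (\<forall>h\<in>H. \<bar>h w - z h\<bar> \<le> inverse (real (Suc k)))}" for k j
  define g where "g k j = (SOME z. z \<in> Q k j)" for k j
  define C where "C = {g k j |k j. Q k j \<noteq> {}}"
  have gQ: "g k j \<in> Q k j" if "Q k j \<noteq> {}" for k j using that unfolding g_def by (rule some_in_eq[THEN iffD2])
  have "C \<subseteq> range (\<lambda>(k,j). g k j)" by (auto simp: C_def)
  then have "countable C" by (rule countable_subset) auto
  moreover have Cp: "C \<subseteq> pts" using gQ by (auto simp: C_def Q_def)
  moreover have "Z.mtopology closure_of C = pts"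
  proof
    show "Z.mtopology closure_of C \<subseteq> pts" using closure_of_subset_topspace[of Z.mtopology C] by simp
    show "pts \<subseteq> Z.mtopology closure_of C"
    proof
      fix z assume z: "z \<in> pts"
      have "\<exists>y\<in>C. y \<in> Z.mball z r" if r: "r > 0" for r
      proof -
        obtain k where k: "inverse (real (Suc k)) < r / 3" using reals_Archimedean[of "r/3"] r by auto
        define \<epsilon> where "\<epsilon> = inverse (real (Suc k))"
        have e: "\<epsilon> > 0" "\<epsilon> < r/3" using k by (auto simp: \<epsilon>_def)
        obtain w where w: "w \<in> space P" "\<forall>h\<in>H. \<bar>h w - z h\<bar> \<le> \<epsilon>"
          using pts_near_point[OF z e(1)] by blast
        have "z \<in> Q k (c k w)" using z w by (auto simp: Q_def \<epsilon>_def)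
        then have ne: "Q k (c k w) \<noteq> {}" by blast
        define y where "y = g k (c k w)"
        have y: "y \<in> Q k (c k w)" using gQ[OF ne] by (simp add: y_def)
        then obtain v where v: "v \<in> space P" "c k v = c k w" "\<forall>h\<in>H. \<bar>h v - y h\<bar> \<le> \<epsilon>" by (auto simp: Q_def \<epsilon>_def)
        have yp: "y \<in> pts" using y by (simp add: Q_def)
        have "\<bar>z h - y h\<bar> \<le> 3 * \<epsilon>" if h: "h \<in> H" for h
        proof -
          have "\<bar>h w - h v\<bar> \<le> \<epsilon>" using c[of k] w(1) v(1,2) h unfolding \<epsilon>_def by metis
          moreover have "\<bar>h w - z h\<bar> \<le> \<epsilon>" "\<bar>h v - y h\<bar> \<le> \<epsilon>" using w(2) v(3) h by auto
          ultimately show ?thesis by (auto simp: abs_le_iff)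
        qed
        then have "dst z y \<le> 3 * \<epsilon>" by (rule dst_le[OF z yp])
        then have "y \<in> Z.mball z r" using z yp e by simp
        moreover have "y \<in> C" using ne by (auto simp: C_def y_def)
        ultimately show ?thesis by blast
      qed
      then show "z \<in> Z.mtopology closure_of C" using z unfolding Z.metric_closure_of by blast
    qed
  qed
  ultimately show ?thesis unfolding separable_space_def by auto
qed

text \<open>A set that is open for the uniform pseudo-distance of \<open>H\<close> is the union of
  the cells contained in it, hence a countable union of events.\<close>

lemma family_open_measurable:
  assumes "U \<subseteq> space P"
    and "\<And>w. w \<in> U \<Longrightarrow> \<exists>k. \<forall>w'\<in>space P. (\<forall>h\<in>H. \<bar>h w - h w'\<bar> \<le> inverse (real (Suc k))) \<longrightarrow> w' \<in> U"
  shows "U \<in> events"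
proof -
  obtain c :: "nat \<Rightarrow> 'w \<Rightarrow> nat" where c: "\<And>k. c k \<in> measurable P (count_space UNIV)"
    "\<And>k. \<forall>w\<in>space P. \<forall>w'\<in>space P.
      c k w = c k w' \<longrightarrow> (\<forall>h\<in>H. \<bar>h w - h w'\<bar> \<le> inverse (real (Suc k)))" using H_cells by metis
  define J where "J k = {j. c k -` {j} \<inter> space P \<subseteq> U}" for k
  have "U = (\<Union>k. c k -` J k \<inter> space P)"
  proof
    show "U \<subseteq> (\<Union>k. c k -` J k \<inter> space P)"
    proof
      fix w assume w: "w \<in> U"
      then obtain k where k: "\<And>w'. w'\<in>space P \<Longrightarrow> (\<forall>h\<in>H. \<bar>h w - h w'\<bar> \<le> inverse (real (Suc k))) \<Longrightarrow> w' \<in> U"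
        using assms(2) by blast
      have wP: "w \<in> space P" using w assms(1) by blast
      have "c k w \<in> J k" unfolding J_def
      proof (intro CollectI subsetI)
        fix v assume "v \<in> c k -` {c k w} \<inter> space P"
        then have "v \<in> space P" "c k w = c k v" by auto
        then show "v \<in> U" using k c(2)[of k] wP by blast
      qed
      then show "w \<in> (\<Union>k. c k -` J k \<inter> space P)" using wP by blast
    qed
    show "(\<Union>k. c k -` J k \<inter> space P) \<subseteq> U" by (auto simp: J_def)
  qed
  also have "\<dots> \<in> events" using measurable_sets[OF c(1)] by (intro sets.countable_UN) auto
  finally show ?thesis .
qed

section \<open>The evaluation map and its exceptional null set\<close>

definition ev :: "'w \<Rightarrow> ('w \<Rightarrow> real) \<Rightarrow> real" where "ev w = (\<lambda>h\<in>H. h w)"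

definition bad :: "'w set" where "bad = {w \<in> space P. ev w \<notin> pts}"

lemma ev_in_pts:
  assumes "\<And>k. \<exists>A\<in>events. emeasure P A > 0 \<and> (\<forall>v\<in>A. \<forall>h\<in>H. \<bar>h v - h w\<bar> \<le> inverse (real (Suc k)))"
  shows "ev w \<in> pts"
  unfolding pts_def
proof (intro CollectI conjI allI impI)
  show "ev w \<in> extensional H" by (simp add: ev_def)
  fix e :: real assume "e > 0"
  then obtain k where k: "inverse (real (Suc k)) < e" using reals_Archimedean by blast
  obtain A where A: "A \<in> events" "emeasure P A > 0" "\<forall>v\<in>A. \<forall>h\<in>H. \<bar>h v - h w\<bar> \<le> inverse (real (Suc k))"
    using assms by blast
  have "\<forall>v\<in>A. \<forall>h\<in>H. \<bar>h v - ev w h\<bar> \<le> e"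
  proof (intro ballI)
    fix v h assume "v \<in> A" "h \<in> H"
    then have "\<bar>h v - h w\<bar> \<le> inverse (real (Suc k))" "ev w h = h w" using A(3) by (auto simp: ev_def)
    then show "\<bar>h v - ev w h\<bar> \<le> e" using k by linarith
  qed
  then show "\<exists>A\<in>events. 0 < emeasure P A \<and> (\<forall>v\<in>A. \<forall>h\<in>H. \<bar>h v - ev w h\<bar> \<le> e)" using A by blast
qed

lemma ev_near:
  assumes "ev w \<in> pts" "e > 0"
  shows "\<exists>A\<in>events. emeasure P A > 0 \<and> (\<forall>v\<in>A. \<forall>h\<in>H. \<bar>h v - h w\<bar> \<le> e)"
  using pts_near[OF assms] by (simp add: ev_def cong: ball_cong)

lemma half_scale: "\<exists>m. 2 * inverse (real (Suc m)) \<le> inverse (real (Suc k))"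
  by (intro exI[of _ "2 * k + 1"]) (simp add: field_simps)

text \<open>The support is closed, so lying outside it is an open condition; this makes
  \<open>bad\<close> an event.\<close>

lemma bad_open:
  assumes w: "w \<in> bad"
  shows "\<exists>m. \<forall>v\<in>space P. (\<forall>h\<in>H. \<bar>h w - h v\<bar> \<le> inverse (real (Suc m))) \<longrightarrow> v \<in> bad"
proof -
  obtain k where k: "\<And>A. A \<in> events \<Longrightarrow> emeasure P A > 0 \<Longrightarrow> \<not> (\<forall>v\<in>A. \<forall>h\<in>H. \<bar>h v - h w\<bar> \<le> inverse (real (Suc k)))"
    using ev_in_pts[of w] w unfolding bad_def by blast
  obtain m where m: "2 * inverse (real (Suc m)) \<le> inverse (real (Suc k))" using half_scale by blast
  have "v \<in> bad" if v: "v \<in> space P" "\<forall>h\<in>H. \<bar>h w - h v\<bar> \<le> inverse (real (Suc m))" for v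
  proof (rule ccontr)
    assume "v \<notin> bad"
    then have "ev v \<in> pts" using v(1) by (simp add: bad_def)
    then obtain A where A: "A \<in> events" "emeasure P A > 0" "\<forall>u\<in>A. \<forall>h\<in>H. \<bar>h u - h v\<bar> \<le> inverse (real (Suc m))"
      using ev_near[of v "inverse (real (Suc m))"] by auto
    have "\<bar>h u - h w\<bar> \<le> inverse (real (Suc k))" if "u \<in> A" "h \<in> H" for u h
    proof -
      have "\<bar>h u - h v\<bar> \<le> inverse (real (Suc m))" "\<bar>h v - h w\<bar> \<le> inverse (real (Suc m))"
        using A(3) v(2) that by (auto simp: abs_minus_commute)
      then show ?thesis by (rule abs_chain) (use m in linarith)
    qed
    then show False using k[OF A(1,2)] by blast
  qed
  then show "\<exists>m. \<forall>v\<in>space P. (\<forall>h\<in>H. \<bar>h w - h v\<bar> \<le> inverse (real (Suc m))) \<longrightarrow> v \<in> bad" by blast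
qed

lemma bad_events: "bad \<in> events"
  using bad_open by (intro family_open_measurable) (auto simp: bad_def)

text \<open>A point whose cells all have positive mass evaluates into the support, with those cells
  as witnesses. A bad point therefore lies in one of the countably many null cells.\<close>

lemma bad_null: "emeasure P bad = 0"
proof -
  obtain c :: "nat \<Rightarrow> 'w \<Rightarrow> nat" where c: "\<And>k. c k \<in> measurable P (count_space UNIV)"
    "\<And>k. \<forall>w\<in>space P. \<forall>w'\<in>space P.
      c k w = c k w' \<longrightarrow> (\<forall>h\<in>H. \<bar>h w - h w'\<bar> \<le> inverse (real (Suc k)))" using H_cells by metis
  define J where "J k = {j. emeasure P (c k -` {j} \<inter> space P) = 0}" for k
  have cs: "c k -` {j} \<inter> space P \<in> events" for k j using measurable_sets[OF c(1)] by auto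
  have "(\<Union>k. \<Union>j\<in>J k. c k -` {j} \<inter> space P) \<in> null_sets P"
    using cs by (intro null_sets_UN null_sets_UN' null_setsI) (auto simp: J_def)
  moreover have "bad \<subseteq> (\<Union>k. \<Union>j\<in>J k. c k -` {j} \<inter> space P)"
  proof (rule ccontr)
    assume "\<not> ?thesis"
    then obtain w where w: "w \<in> bad" "w \<notin> (\<Union>k. \<Union>j\<in>J k. c k -` {j} \<inter> space P)" by blast
    have wP: "w \<in> space P" using w(1) by (simp add: bad_def)
    have wJ: "c k w \<notin> J k" for k using w(2) wP by blast
    have "ev w \<in> pts"
    proof (rule ev_in_pts)
      fix k
      show "\<exists>A\<in>events. emeasure P A > 0 \<and> (\<forall>v\<in>A. \<forall>h\<in>H. \<bar>h v - h w\<bar> \<le> inverse (real (Suc k)))"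
      proof (intro bexI[of _ "c k -` {c k w} \<inter> space P"] conjI)
        show "0 < emeasure P (c k -` {c k w} \<inter> space P)" using wJ[of k] by (simp add: J_def zero_less_iff_neq_zero)
        show "\<forall>v\<in>c k -` {c k w} \<inter> space P. \<forall>h\<in>H. \<bar>h v - h w\<bar> \<le> inverse (real (Suc k))"
          using c(2)[of k] wP by blast
      qed (rule cs)
    qed
    then show False using w(1) by (simp add: bad_def)
  qed
  ultimately have "bad \<in> null_sets P" using bad_events null_sets_subset by blast
  then show ?thesis by (rule null_setsD1)
qed

text \<open>The data set is the image of \<open>P\<close> under evaluation, on its support. Off a
  null set each of its features pulls back to the member of \<open>H\<close> it came from.\<close>

lemma quotient_geo_data:
  "\<exists>(Z :: (('w \<Rightarrow> real) \<Rightarrow> real) geo_data) q W. geo_data_set Z \<and> q \<in> measurable P (meas Z) \<and> distr P (meas Z) q = meas Z \<and>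
     W \<in> events \<and> prob W = 1 \<and> (\<forall>f\<in>features Z. \<exists>h\<in>H. \<forall>w\<in>W. f (q w) = h w) \<and>
     (\<forall>h\<in>H. \<exists>f\<in>features Z. \<forall>w\<in>W. f (q w) = h w)"
proof -
  define W where "W = space P - bad"
  have Ws: "W \<in> events" using bad_events by (simp add: W_def)
  have "prob bad = 0" using bad_null by (simp add: measure_def)
  then have W1: "prob W = 1" unfolding W_def using prob_compl[OF bad_events] by simp
  have evW: "ev w \<in> pts" if "w \<in> W" for w using that by (simp add: W_def bad_def)
  have "W \<noteq> {}" using W1 by auto
  then obtain w0 where w0: "w0 \<in> W" by blast
  \<comment> \<open>Evaluation is redirected on the null set \<open>bad\<close> so that
    \<open>q\<close> maps everywhere into the support.\<close>
  define q where "q w = (if w \<in> W then ev w else ev w0)" for w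
  have qp: "q w \<in> pts" for w using evW w0 by (simp add: q_def)
  define T where "T = feat_topology pre"
  have TM: "T = Z.mtopology" by (simp add: T_def feat_topology_def)
  have qm: "q \<in> measurable P (borel_space T)"
    unfolding borel_space_def
  proof (rule measurable_measure_of)
    show "{U. openin T U} \<subseteq> Pow (topspace T)" using openin_subset by blast
    show "q \<in> space P \<rightarrow> topspace T" using qp by (simp add: TM)
    fix U assume "U \<in> {U. openin T U}"
    then have U: "openin Z.mtopology U" by (simp add: TM)
    \<comment> \<open>Bad points may lie close to a good one, so it is the union with
      \<open>bad\<close> that is open for \<open>H\<close>; the event \<open>bad\<close> is removed
      afterwards.\<close>
    have "{w\<in>W. ev w \<in> U} \<union> bad \<in> events"
    proof (rule family_open_measurable)
      show "{w\<in>W. ev w \<in> U} \<union> bad \<subseteq> space P" by (auto simp: W_def bad_def)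
      fix w assume w: "w \<in> {w\<in>W. ev w \<in> U} \<union> bad"
      show "\<exists>k. \<forall>v\<in>space P. (\<forall>h\<in>H. \<bar>h w - h v\<bar> \<le> inverse (real (Suc k))) \<longrightarrow> v \<in> {w\<in>W. ev w \<in> U} \<union> bad"
      proof (cases "w \<in> bad")
        case False
        then have w': "w \<in> W" "ev w \<in> U" using w by auto
        obtain r where r: "r > 0" "Z.mball (ev w) r \<subseteq> U" using U w'(2) unfolding Z.openin_mtopology by blast
        obtain k where k: "inverse (real (Suc k)) < r" using reals_Archimedean[OF r(1)] by blast
        have "ev v \<in> U" if v: "v \<in> W" "\<forall>h\<in>H. \<bar>h w - h v\<bar> \<le> inverse (real (Suc k))" for v
        proof -
          have "dst (ev w) (ev v) \<le> inverse (real (Suc k))"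
            using v(2) by (intro dst_le evW w' v) (simp add: ev_def)
          then have "ev v \<in> Z.mball (ev w) r" using k evW w'(1) v(1) by simp
          then show ?thesis using r by blast
        qed
        then show ?thesis unfolding W_def by blast
      next
        case True
        then show ?thesis using bad_open by blast
      qed
    qed
    then have "({w\<in>W. ev w \<in> U} \<union> bad) - bad \<in> events" using bad_events by blast
    moreover have "({w\<in>W. ev w \<in> U} \<union> bad) - bad = {w\<in>W. ev w \<in> U}" by (auto simp: W_def)
    ultimately have e: "{w\<in>W. ev w \<in> U} \<in> events" by simp
    have "q -` U \<inter> space P = {w\<in>W. ev w \<in> U} \<union> (if ev w0 \<in> U then bad else {})"
      by (auto simp: q_def W_def bad_def split: if_splits)
    then show "q -` U \<inter> space P \<in> events" using e bad_events by simp
  qed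
  define Z where "Z = \<lparr>points = pts, features = feats, meas = distr P (borel_space T) q\<rparr>"
  have sel: "points Z = pts" "features Z = feats" "meas Z = distr P (borel_space T) q" by (simp_all add: Z_def)
  have dZ: "feat_dist Z = dst" by (simp add: fun_eq_iff feat_dist_def sel)
  have TZ: "feat_topology Z = T" by (simp add: T_def feat_topology_def dZ sel)
  have bs: "space (borel_space T) = pts" by (simp add: borel_space_simps TM)
  have supp: "emeasure (meas Z) U > 0" if U: "openin T U" "U \<noteq> {}" for U
  proof -
    have Us: "U \<in> sets (borel_space T)" using U by (auto simp: borel_space_simps intro: sigma_sets.Basic)
    obtain z where z: "z \<in> U" using U by blast
    then obtain r where r: "r > 0" "Z.mball z r \<subseteq> U" using U unfolding TM Z.openin_mtopology by blast
    have zp: "z \<in> pts" using z U openin_subset[of T U] by (auto simp: TM)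
    obtain A where A: "A \<in> events" "emeasure P A > 0" "\<forall>w\<in>A. \<forall>h\<in>H. \<bar>h w - z h\<bar> \<le> r/2"
      using pts_near[OF zp, of "r/2"] r by auto
    have "A - bad \<subseteq> q -` U \<inter> space P"
    proof
      fix w assume w: "w \<in> A - bad"
      then have wW: "w \<in> W" using sets.sets_into_space[OF A(1)] by (auto simp: W_def)
      have "dst z (ev w) \<le> r/2"
        using A(3) w by (intro dst_le zp evW wW) (auto simp: ev_def abs_minus_commute)
      then have "ev w \<in> Z.mball z r" using r zp evW[OF wW] by simp
      then show "w \<in> q -` U \<inter> space P" using r wW by (auto simp: q_def W_def)
    qed
    then have "emeasure P (A - bad) \<le> emeasure P (q -` U \<inter> space P)"
      using measurable_sets[OF qm Us] by (rule emeasure_mono)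
    moreover have "emeasure P (A - bad) = emeasure P A"
      using bad_null bad_events A(1) by (intro emeasure_Diff_null_set) auto
    ultimately show ?thesis using A(2) unfolding sel by (simp add: emeasure_distr[OF qm Us])
  qed
  have bdd: "bdd_above ((\<lambda>f. \<bar>f x - f y\<bar>) ` features Z)" if "x \<in> pts" "y \<in> pts" for x y
    using pts_bdd[OF that] that by (simp add: sel feats_def image_image)
  have gZ: "geo_data_set Z"
    unfolding geo_data_set_def TZ sel(1) dZ
  proof (intro conjI)
    show "features Z \<noteq> {}" using H_ne by (simp add: sel feats_def)
    show "features Z \<subseteq> pts \<rightarrow>\<^sub>E UNIV" by (auto simp: sel feats_def)
    show "space (meas Z) = pts" "sets (meas Z) = sets (borel_space T)" by (simp_all add: sel bs)
    show "prob_space (meas Z)" unfolding sel by (rule prob_space_distr[OF qm])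
  qed (use bdd supp Z.Metric_space_axioms dst_complete dst_separable in \<open>auto simp: TM\<close>)
  have "\<forall>f\<in>features Z. \<exists>h\<in>H. \<forall>w\<in>W. f (q w) = h w" "\<forall>h\<in>H. \<exists>f\<in>features Z. \<forall>w\<in>W. f (q w) = h w"
    using evW by (auto simp: sel feats_def q_def ev_def)
  moreover have "q \<in> measurable P (meas Z)" using qm by (simp add: sel)
  moreover have "distr P (meas Z) q = meas Z" unfolding sel by (intro distr_cong) auto
  ultimately show ?thesis using gZ Ws W1 by blast
qed

end

section \<open>Interpolation\<close>

text \<open>The index set is shared by all families on \<open>P\<close>, so that functions belonging
  to different times can be compared index by index. The last clause asks only for closure elements
  because the matched pairs consist of such elements, also at the two end points.\<close>

definition represents :: "'w measure \<Rightarrow> 'i set \<Rightarrow> ('i \<Rightarrow> 'w \<Rightarrow> real) \<Rightarrow> 'a geo_data \<Rightarrow> bool" where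
  "represents P I h Z \<longleftrightarrow> geo_data_set Z \<and> (\<exists>q W. q \<in> measurable P (meas Z) \<and> distr P (meas Z) q = meas Z \<and>
     W \<in> sets P \<and> measure P W = 1 \<and> (\<forall>f\<in>features Z. \<exists>i\<in>I. \<forall>w\<in>W. f (q w) = h i w) \<and>
     (\<forall>i\<in>I. \<exists>f\<in>feat_closure Z. \<forall>w\<in>W. f (q w) = h i w))"

text \<open>Both data sets are images of the same \<open>P\<close>, so their maps form a coupling
  and equal indices supply the matching.\<close>

lemma represents_box_dist_le:
  assumes P: "prob_space P" and Z: "represents P I h Z" and Z': "represents P I h' Z'"
    and T: "T \<in> sets P" "measure P T \<ge> 1 - e" and e: "e \<ge> 0"
    and hh: "\<And>i w. i \<in> I \<Longrightarrow> w \<in> T \<Longrightarrow> \<bar>h i w - h' i w\<bar> \<le> e / 2"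
  shows "box_dist Z Z' \<le> e"
proof -
  obtain q W where q: "geo_data_set Z" "q \<in> measurable P (meas Z)" "distr P (meas Z) q = meas Z"
     "W \<in> sets P" "measure P W = 1" "\<forall>f\<in>features Z. \<exists>i\<in>I. \<forall>w\<in>W. f (q w) = h i w"
     "\<forall>i\<in>I. \<exists>f\<in>feat_closure Z. \<forall>w\<in>W. f (q w) = h i w"
    using Z unfolding represents_def by (elim exE conjE)
  obtain q' W' where q': "geo_data_set Z'" "q' \<in> measurable P (meas Z')" "distr P (meas Z') q' = meas Z'"
     "W' \<in> sets P" "measure P W' = 1" "\<forall>f\<in>features Z'. \<exists>i\<in>I. \<forall>w\<in>W'. f (q' w) = h' i w"
     "\<forall>i\<in>I. \<exists>f\<in>feat_closure Z'. \<forall>w\<in>W'. f (q' w) = h' i w"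
    using Z' unfolding represents_def by (elim exE conjE)
  have "measure P (W \<inter> W') \<ge> 1 - (0 + 0)" using q q' by (intro prob_Int_ge[OF P]) auto
  then have "measure P (T \<inter> (W \<inter> W')) \<ge> 1 - (e + (0 + 0))"
    using q q' by (intro prob_Int_ge[OF P T(1) _ T(2)]) auto
  then have m: "measure P (T \<inter> (W \<inter> W')) \<ge> 1 - e" by simp
  show ?thesis
  proof (rule box_distI[OF q(1) q'(1) P q(2,3) q'(2,3) _ m e])
    show "T \<inter> (W \<inter> W') \<in> sets P" using T q q' by auto
  next
    fix f assume "f \<in> features Z"
    then obtain i where i: "i \<in> I" "\<forall>w\<in>W. f (q w) = h i w" using q(6) by blast
    obtain g where g: "g \<in> feat_closure Z'" "\<forall>w\<in>W'. g (q' w) = h' i w" using q'(7) i(1) by blast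
    show "\<exists>g\<in>feat_closure Z'. \<forall>w\<in>T \<inter> (W \<inter> W'). \<bar>f (q w) - g (q' w)\<bar> \<le> e / 2"
      using i g hh by (intro bexI[of _ g]) auto
  next
    fix g assume "g \<in> features Z'"
    then obtain i where i: "i \<in> I" "\<forall>w\<in>W'. g (q' w) = h' i w" using q'(6) by blast
    obtain f where f: "f \<in> feat_closure Z" "\<forall>w\<in>W. f (q w) = h i w" using q(7) i(1) by blast
    show "\<exists>f\<in>feat_closure Z. \<forall>w\<in>T \<inter> (W \<inter> W'). \<bar>f (q w) - g (q' w)\<bar> \<le> e / 2"
      using i f hh by (intro bexI[of _ f]) auto
  qed
qed

section \<open>Ranges of features\<close>

lemma closure_range:
  assumes gX: "geo_data_set X" and K: "closed K" and F: "\<forall>f\<in>features X. \<forall>x\<in>points X. f x \<in> K"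
    and f: "f \<in> feat_closure X" and x: "x \<in> points X"
  shows "f x \<in> K"
proof -
  interpret X: geo X by unfold_locales fact
  have "\<exists>y\<in>K. dist y (f x) < e" if "e > 0" for e
  proof -
    have "finite {x} \<and> {x} \<subseteq> points X \<and> e > 0" using x that by simp
    then obtain g where "g \<in> features X" "\<forall>a\<in>{x}. \<bar>g a - f a\<bar> < e"
      using f[unfolded feat_closure_iff[OF X.F_ext]] by meson
    then show ?thesis using F x by (auto simp: dist_real_def)
  qed
  then have "f x \<in> closure K" by (simp add: closure_approachable)
  then show ?thesis using K by simp
qed

text \<open>The points where \<open>f\<close> leaves \<open>K\<close> form an open null set, which
  full support forces to be empty.\<close>

lemma range_extends:
  assumes gZ: "geo_data_set Z" and P: "prob_space P" and q: "q \<in> measurable P (meas Z)" "distr P (meas Z) q = meas Z"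
    and W: "W \<in> sets P" "measure P W = 1" and K: "closed K" and f: "f \<in> feat_closure Z"
    and fW: "\<And>w. w \<in> W \<Longrightarrow> f (q w) \<in> K" and z: "z \<in> points Z"
  shows "f z \<in> K"
proof (rule ccontr)
  assume "f z \<notin> K"
  interpret Z: geo Z by unfold_locales fact
  interpret P: prob_space P by fact
  define U where "U = {z\<in>points Z. f z \<in> - K}"
  have "openin Z.mtopology {z\<in>topspace Z.mtopology. f z \<in> - K}"
    using K by (intro openin_continuous_map_preimage[OF Z.feature_continuous[OF f]]) auto
  then have U: "openin Z.mtopology U" by (simp add: U_def)
  have Us: "U \<in> sets (meas Z)" using U by (rule Z.open_sets)
  have "U \<noteq> {}" using z \<open>f z \<notin> K\<close> by (auto simp: U_def)
  then have "emeasure (meas Z) U > 0" by (rule Z.support[OF U])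
  then have "Z.prob U > 0" by (simp add: Z.emeasure_eq_measure)
  moreover have "Z.prob U = P.prob (q -` U \<inter> space P)" using measure_preserving_vimage[OF q Us] by simp
  moreover have "P.prob (q -` U \<inter> space P) \<le> P.prob (space P - W)"
    using fW W by (intro P.finite_measure_mono) (auto simp: U_def)
  ultimately show False using P.prob_compl[OF W(1)] W(2) by simp
qed

text \<open>Composition with \<open>\<phi>\<close> compares the two data sets only on the image of
  \<open>\<phi>\<close>; full support extends the bound to all points. This is needed because
  \<open>data_sets_K\<close> restricts every representative of a class.\<close>

lemma isomorphic_range:
  assumes gX: "geo_data_set X" and gZ: "geo_data_set Z" and iso: "isomorphic X Z" and K: "closed K"
    and F: "\<forall>f\<in>features X. \<forall>x\<in>points X. f x \<in> K"
  shows "\<forall>f\<in>features Z. \<forall>z\<in>points Z. f z \<in> K"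
proof (intro ballI)
  fix f z assume f: "f \<in> features Z" and z: "z \<in> points Z"
  interpret X: geo X by unfold_locales fact
  interpret Z: geo Z by unfold_locales fact
  obtain \<phi> where \<phi>: "\<phi> \<in> measurable (meas X) (meas Z)" "distr (meas X) (meas Z) \<phi> = meas Z"
    "(\<lambda>f. compose (points X) f \<phi>) ` feat_closure Z = feat_closure X"
    using iso unfolding isomorphic_def by (elim bexE conjE)
  have fZ: "f \<in> feat_closure Z" using f Z.F_closure by blast
  then have c: "compose (points X) f \<phi> \<in> feat_closure X" using \<phi>(3) by blast
  show "f z \<in> K"
  proof (rule range_extends[OF gZ X.prob_meas \<phi>(1,2) _ _ K fZ _ z])
    show "points X \<in> X.events" using sets.top[of "meas X"] by simp
    show "X.prob (points X) = 1" using X.prob_space by simp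
    fix w assume w: "w \<in> points X"
    then show "f (\<phi> w) \<in> K" using closure_range[OF gX K F c w] by (simp add: compose_def)
  qed
qed

lemma isomorphic_refl:
  assumes "geo_data_set X" shows "isomorphic X X"
proof -
  interpret X: geo X by unfold_locales fact
  have "compose (points X) f (\<lambda>x. x) = f" if "f \<in> feat_closure X" for f
    using that unfolding feat_closure_iff[OF X.F_ext] by (auto simp: compose_def fun_eq_iff PiE_iff extensional_def)
  then have "(\<lambda>f. compose (points X) f (\<lambda>x. x)) ` feat_closure X = feat_closure X" by force
  then show ?thesis unfolding isomorphic_def
    by (intro bexI[of _ "\<lambda>x. x"]) (auto simp: distr_id2)
qed

section \<open>Interpolants of matched pairs\<close>

definition interp :: "('a \<times> 'b) set \<Rightarrow> real \<Rightarrow> ('a \<Rightarrow> real) \<times> ('b \<Rightarrow> real) \<Rightarrow> ('a \<times> 'b) \<times> real \<Rightarrow> real" where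
  "interp S t p w = (if fst w \<in> S then (1 - t) * fst p (fst (fst w)) + t * snd p (snd (fst w))
     else if t \<le> snd w then fst p (fst (fst w)) else snd p (snd (fst w)))"

text \<open>\<open>fin\<close> keeps the distance generated by the interpolants finite, since off
  \<open>S\<close> nothing else compares the two functions of a pair. A point of \<open>S\<close>
  provides it, or bounded features when \<open>S\<close> is empty.\<close>

locale interpolation = X: geo X + Y: geo Y + R: prob_space R
  for X :: "'a geo_data" and Y :: "'b geo_data" and R :: "('a \<times> 'b) measure" +
  fixes S :: "('a \<times> 'b) set" and D :: real
  assumes sets_R: "sets R = sets (meas X \<Otimes>\<^sub>M meas Y)"
    and marg_X: "distr R (meas X) fst = meas X" and marg_Y: "distr R (meas Y) snd = meas Y"
    and S: "S \<in> sets R" and S_mass: "measure R S \<ge> 1 - D" and D: "D \<ge> 0"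
    and fw: "\<And>f. f \<in> features X \<Longrightarrow> \<exists>g\<in>feat_closure Y. \<forall>z\<in>S. \<bar>f (fst z) - g (snd z)\<bar> \<le> D / 2"
    and bw: "\<And>g. g \<in> features Y \<Longrightarrow> \<exists>f\<in>feat_closure X. \<forall>z\<in>S. \<bar>f (fst z) - g (snd z)\<bar> \<le> D / 2"
    and fin: "\<And>x y. x \<in> points X \<Longrightarrow> y \<in> points Y \<Longrightarrow> \<exists>B. \<forall>f\<in>feat_closure X. \<forall>g\<in>feat_closure Y.
      (\<forall>z\<in>S. \<bar>f (fst z) - g (snd z)\<bar> \<le> D / 2) \<longrightarrow> \<bar>f x - g y\<bar> \<le> B"
begin

definition pairs where
  "pairs = {(f, g). f \<in> feat_closure X \<and> g \<in> feat_closure Y \<and> (\<forall>z\<in>S. \<bar>f (fst z) - g (snd z)\<bar> \<le> D / 2)}"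

definition U :: "real measure" where "U = uniform_measure lborel {0..1}"

definition P :: "(('a \<times> 'b) \<times> real) measure" where "P = R \<Otimes>\<^sub>M U"

lemma prob_U: "prob_space U" unfolding U_def by (rule prob_space_uniform_measure) auto

lemma sets_U [measurable_cong]: "sets U = sets borel" by (simp add: U_def)

lemma space_U [simp]: "space U = UNIV" by (simp add: U_def)

lemma prob_P: "prob_space P" unfolding P_def by (rule product_marginals[OF R.prob_space_axioms prob_U])

lemma fst_P: "fst \<in> measurable P R" "distr P R fst = R" 
  unfolding P_def using product_marginals[OF R.prob_space_axioms prob_U] by auto

lemma snd_P: "snd \<in> measurable P U" "distr P U snd = U" 
  unfolding P_def using product_marginals[OF R.prob_space_axioms prob_U] by auto

lemma space_R: "space R = points X \<times> points Y"
  using sets_eq_imp_space_eq[OF sets_R] by (simp add: space_pair_measure)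

lemma space_P: "space P = (points X \<times> points Y) \<times> UNIV"
  by (simp add: P_def space_pair_measure space_R)

lemma fst_R: "fst \<in> measurable R (meas X)" and snd_R: "snd \<in> measurable R (meas Y)"
  using measurable_cong_sets[OF sets_R refl] by auto

lemma measure_U_Icc: "0 \<le> a \<Longrightarrow> a \<le> b \<Longrightarrow> b \<le> 1 \<Longrightarrow> measure U {a..<b} = b - a"
proof -
  assume ab: "0 \<le> a" "a \<le> b" "b \<le> 1"
  then have "{0..1} \<inter> {a..<b} = {a..<b}" by auto
  then have "emeasure U {a..<b} = ennreal (b - a)"
    using ab unfolding U_def by (simp add: emeasure_uniform_measure divide_ennreal_def)
  then show ?thesis using ab by (simp add: measure_def)
qed

lemma pairsD:
  assumes "p \<in> pairs"
  shows "fst p \<in> feat_closure X" "snd p \<in> feat_closure Y" "\<And>z. z \<in> S \<Longrightarrow> \<bar>fst p (fst z) - snd p (snd z)\<bar> \<le> D / 2"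
  using assms by (auto simp: pairs_def split_beta)

text \<open>An interpolant is a convex combination of the two values or one of them, so
  \<open>fin\<close> bounds its distance to the first function of the pair.\<close>

lemma interp_between:
  assumes t: "0 \<le> t" "t \<le> 1"
  shows "\<bar>interp S t p w - fst p (fst (fst w))\<bar> \<le> \<bar>fst p (fst (fst w)) - snd p (snd (fst w))\<bar>"
proof -
  let ?a = "fst p (fst (fst w))" and ?b = "snd p (snd (fst w))"
  have "\<bar>((1 - t) * ?a + t * ?b) - ?a\<bar> = t * \<bar>?a - ?b\<bar>"
  proof -
    have "((1 - t) * ?a + t * ?b) - ?a = - (t * (?a - ?b))" by (simp add: algebra_simps)
    then show ?thesis using t by (simp add: abs_mult)
  qed
  moreover have "t * \<bar>?a - ?b\<bar> \<le> \<bar>?a - ?b\<bar>" using t by (intro mult_left_le_one_le) auto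
  ultimately show ?thesis by (auto simp: interp_def)
qed

text \<open>Two points that fall into the same branch of \<open>interp\<close> see the same convex
  combination of 1-Lipschitz functions.\<close>

lemma interp_lipschitz:
  assumes t: "0 \<le> t" "t \<le> 1" and p: "p \<in> pairs" and w: "w \<in> space P" "w' \<in> space P"
    and S: "fst w \<in> S \<longleftrightarrow> fst w' \<in> S" "t \<le> snd w \<longleftrightarrow> t \<le> snd w'"
    and r: "feat_dist X (fst (fst w)) (fst (fst w')) \<le> r" "feat_dist Y (snd (fst w)) (snd (fst w')) \<le> r"
  shows "\<bar>interp S t p w - interp S t p w'\<bar> \<le> r"
proof -
  let ?a = "fst p (fst (fst w)) - fst p (fst (fst w'))" and ?b = "snd p (snd (fst w)) - snd p (snd (fst w'))"
  have "\<bar>?a\<bar> \<le> feat_dist X (fst (fst w)) (fst (fst w'))" "\<bar>?b\<bar> \<le> feat_dist Y (snd (fst w)) (snd (fst w'))"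
    using w by (auto intro!: X.closure_lipschitz Y.closure_lipschitz pairsD[OF p] simp: space_P)
  then have ab: "\<bar>?a\<bar> \<le> r" "\<bar>?b\<bar> \<le> r" using r by linarith+
  have "\<bar>(1 - t) * ?a + t * ?b\<bar> \<le> (1 - t) * r + t * r"
  proof -
    have "\<bar>(1 - t) * ?a + t * ?b\<bar> \<le> \<bar>(1 - t) * ?a\<bar> + \<bar>t * ?b\<bar>" by (rule abs_triangle_ineq)
    also have "\<dots> = (1 - t) * \<bar>?a\<bar> + t * \<bar>?b\<bar>" using t by (simp add: abs_mult)
    also have "\<dots> \<le> (1 - t) * r + t * r" using ab t by (intro add_mono mult_left_mono) auto
    finally show ?thesis .
  qed
  then have "\<bar>(1 - t) * ?a + t * ?b\<bar> \<le> r" by (simp add: algebra_simps)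
  moreover have "((1 - t) * fst p (fst (fst w)) + t * snd p (snd (fst w))) -
      ((1 - t) * fst p (fst (fst w')) + t * snd p (snd (fst w'))) = (1 - t) * ?a + t * ?b"
    by (simp add: algebra_simps)
  ultimately show ?thesis using ab S by (auto simp: interp_def)
qed

lemma interp_feature_family:
  assumes t: "0 \<le> t" "t \<le> 1"
  shows "feature_family P (interp S t ` pairs)"
proof -
  interpret P: prob_space P by (rule prob_P)
  show ?thesis
  proof
    obtain f where f: "f \<in> features X" using X.F_ne by blast
    obtain g where "g \<in> feat_closure Y" "\<forall>z\<in>S. \<bar>f (fst z) - g (snd z)\<bar> \<le> D / 2" using fw[OF f] by blast
    then have "(f, g) \<in> pairs" using f X.F_closure by (auto simp: pairs_def)
    then show "interp S t ` pairs \<noteq> {}" by blast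
  next
    fix k :: nat
    obtain c :: "'a \<Rightarrow> nat" where c: "c \<in> measurable (meas X) (count_space UNIV)"
      "\<And>x y. x \<in> points X \<Longrightarrow> y \<in> points X \<Longrightarrow> c x = c y \<Longrightarrow> feat_dist X x y < inverse (real (Suc k))"
      using X.cells by metis
    obtain d :: "'b \<Rightarrow> nat" where d: "d \<in> measurable (meas Y) (count_space UNIV)"
      "\<And>x y. x \<in> points Y \<Longrightarrow> y \<in> points Y \<Longrightarrow> d x = d y \<Longrightarrow> feat_dist Y x y < inverse (real (Suc k))"
      using Y.cells by metis
    \<comment> \<open>The label joins the cells of both coordinates with the two bits that select
      the branch of \<open>interp\<close>; the height matters only through one of these
      bits.\<close>
    define m where "m w = prod_encode (prod_encode (c (fst (fst w)), d (snd (fst w))),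
      prod_encode (of_bool (fst w \<in> S), of_bool (t \<le> snd w)))" for w :: "('a \<times> 'b) \<times> real"
    have [measurable]: "fst \<in> measurable P R" "snd \<in> measurable P U" "fst \<in> measurable R (meas X)" "snd \<in> measurable R (meas Y)"
      "c \<in> measurable (meas X) (count_space UNIV)" "d \<in> measurable (meas Y) (count_space UNIV)" "S \<in> sets R"
      using fst_P snd_P fst_R snd_R c(1) d(1) S by auto
    have 1: "(\<lambda>w. c (fst (fst w))) \<in> measurable P (count_space UNIV)" by measurable
    have 2: "(\<lambda>w. d (snd (fst w))) \<in> measurable P (count_space UNIV)" by measurable
    have 3: "(\<lambda>w. of_bool (fst w \<in> S) :: nat) \<in> measurable P (count_space UNIV)" by measurable
    have 4: "(\<lambda>w. of_bool (t \<le> snd w) :: nat) \<in> measurable P (count_space UNIV)" by measurable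
    have enc: "(\<lambda>w. prod_encode (a w, b w)) \<in> measurable P (count_space UNIV)"
      if "a \<in> measurable P (count_space UNIV)" "b \<in> measurable P (count_space UNIV)" for a b
    proof -
      have "(\<lambda>w. (a w, b w)) \<in> measurable P (count_space UNIV \<Otimes>\<^sub>M count_space UNIV)"
        using that by (rule measurable_Pair)
      then have "(\<lambda>w. (a w, b w)) \<in> measurable P (count_space UNIV)" by (simp add: pair_measure_countable)
      then show ?thesis by (rule measurable_compose) simp
    qed
    have m: "m \<in> measurable P (count_space UNIV)" unfolding m_def[abs_def] by (intro enc 1 2 3 4)
    show "\<exists>c\<in>measurable P (count_space (UNIV::nat set)). \<forall>w\<in>space P. \<forall>w'\<in>space P.
      c w = c w' \<longrightarrow> (\<forall>h\<in>interp S t ` pairs. \<bar>h w - h w'\<bar> \<le> inverse (real (Suc k)))"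
    proof (intro bexI[OF _ m] ballI impI)
      fix w w' h assume w: "w \<in> space P" "w' \<in> space P" "m w = m w'" "h \<in> interp S t ` pairs"
      then obtain p where p: "p \<in> pairs" "h = interp S t p" by blast
      have e: "c (fst (fst w)) = c (fst (fst w'))" "d (snd (fst w)) = d (snd (fst w'))"
        "fst w \<in> S \<longleftrightarrow> fst w' \<in> S" "t \<le> snd w \<longleftrightarrow> t \<le> snd w'"
        using w(3) by (simp_all add: m_def of_bool_eq_iff)
      show "\<bar>h w - h w'\<bar> \<le> inverse (real (Suc k))"
        unfolding p(2)
        by (rule interp_lipschitz[OF t p(1) w(1,2) e(3,4)])
          (use w(1,2) e(1,2) c(2) d(2) in \<open>auto intro!: less_imp_le simp: space_P\<close>)
    qed
  next
    fix w w' assume w: "w \<in> space P" "w' \<in> space P"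
    have wp: "fst (fst w) \<in> points X" "snd (fst w) \<in> points Y" "fst (fst w') \<in> points X" "snd (fst w') \<in> points Y"
      using w by (auto simp: space_P)
    obtain B where B: "\<And>p. p \<in> pairs \<Longrightarrow> \<bar>fst p (fst (fst w)) - snd p (snd (fst w))\<bar> \<le> B"
      using fin[OF wp(1,2)] pairsD by metis
    obtain B' where B': "\<And>p. p \<in> pairs \<Longrightarrow> \<bar>fst p (fst (fst w')) - snd p (snd (fst w'))\<bar> \<le> B'"
      using fin[OF wp(3,4)] pairsD by metis
    \<comment> \<open>The comparison goes through the first function of the pair, with
      \<open>fin\<close> used at both ends.\<close>
    have "\<bar>interp S t p w - interp S t p w'\<bar> \<le> B + feat_dist X (fst (fst w)) (fst (fst w')) + B'" if p: "p \<in> pairs" for p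
    proof -
      have "\<bar>interp S t p w - fst p (fst (fst w))\<bar> \<le> B" "\<bar>interp S t p w' - fst p (fst (fst w'))\<bar> \<le> B'"
        using interp_between[OF t] B[OF p] B'[OF p] by (meson order_trans)+
      moreover have "\<bar>fst p (fst (fst w)) - fst p (fst (fst w'))\<bar> \<le> feat_dist X (fst (fst w)) (fst (fst w'))"
        by (rule X.closure_lipschitz[OF pairsD(1)[OF p] wp(1,3)])
      ultimately show ?thesis by (auto simp: abs_le_iff)
    qed
    then show "bdd_above ((\<lambda>h. \<bar>h w - h w'\<bar>) ` interp S t ` pairs)" unfolding bdd_above_def by blast
  qed
qed

lemma ex_interpolant:
  assumes t: "0 \<le> t" "t \<le> 1"
  shows "\<exists>Z :: (((('a \<times> 'b) \<times> real \<Rightarrow> real) \<Rightarrow> real) geo_data). represents P pairs (interp S t) Z"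
proof -
  interpret F: feature_family P "interp S t ` pairs" by (rule interp_feature_family[OF t])
  obtain Z :: "((('a \<times> 'b) \<times> real \<Rightarrow> real) \<Rightarrow> real) geo_data" and q W where Z: "geo_data_set Z"
     "q \<in> measurable P (meas Z)" "distr P (meas Z) q = meas Z"
     "W \<in> F.events" "F.prob W = 1" "\<forall>f\<in>features Z. \<exists>h\<in>interp S t ` pairs. \<forall>w\<in>W. f (q w) = h w"
     "\<forall>h\<in>interp S t ` pairs. \<exists>f\<in>features Z. \<forall>w\<in>W. f (q w) = h w"
    using F.quotient_geo_data by (elim exE conjE)
  interpret Z: geo Z by unfold_locales fact
  have "\<forall>f\<in>features Z. \<exists>p\<in>pairs. \<forall>w\<in>W. f (q w) = interp S t p w"
    "\<forall>p\<in>pairs. \<exists>f\<in>feat_closure Z. \<forall>w\<in>W. f (q w) = interp S t p w"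
    using Z(6,7) Z.F_closure by blast+
  then show ?thesis unfolding represents_def using Z by blast
qed

lemma interpolants_box_dist:
  assumes "0 \<le> s" "s \<le> t" "t \<le> 1" "represents P pairs (interp S s) Z" "represents P pairs (interp S t) Z'"
  shows "box_dist Z Z' \<le> (t - s) * D"
proof (rule represents_box_dist_le[OF prob_P assms(4,5)])
  interpret P: prob_space P by (rule prob_P)
  interpret U: prob_space U by (rule prob_U)
  \<comment> \<open>With the threshold \<open>t \<le> u\<close>, the times \<open>s\<close> and
    \<open>t\<close> select different functions exactly for heights \<open>s \<le> u < t\<close>,
    hence the half-open interval; off \<open>S\<close> this is the only place where the interpolants
    can differ.\<close>
  define C where "C = (space R - S) \<times> {s..<t}"
  have Cs: "C \<in> sets P" unfolding C_def P_def using S sets_U by auto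
  show "space P - C \<in> P.events" using Cs by blast
  have "emeasure P C = emeasure R (space R - S) * emeasure U {s..<t}"
    unfolding C_def P_def using S sets_U by (intro U.emeasure_pair_measure_Times) auto
  then have "P.prob C = R.prob (space R - S) * U.prob {s..<t}"
    by (simp add: measure_def enn2real_mult)
  also have "\<dots> = (1 - R.prob S) * (t - s)"
    using R.prob_compl[OF S] measure_U_Icc assms(1-3) by simp
  also have "\<dots> \<le> D * (t - s)" using S_mass assms(2) by (intro mult_right_mono) auto
  finally show "1 - (t - s) * D \<le> P.prob (space P - C)" using P.prob_compl[OF Cs] by (simp add: mult.commute)
  show "0 \<le> (t - s) * D" using D assms(2) by simp
  fix p w assume p: "p \<in> pairs" and w: "w \<in> space P - C"
  let ?a = "fst p (fst (fst w))" and ?b = "snd p (snd (fst w))"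
  have nn: "0 \<le> (t - s) * D / 2" using D assms(2) by simp
  show "\<bar>interp S s p w - interp S t p w\<bar> \<le> (t - s) * D / 2"
  proof (cases "fst w \<in> S")
    case True
    have "interp S s p w - interp S t p w = (t - s) * (?a - ?b)"
      using True by (simp add: interp_def algebra_simps)
    then have "\<bar>interp S s p w - interp S t p w\<bar> = (t - s) * \<bar>?a - ?b\<bar>" using assms(2) by (simp add: abs_mult)
    also have "\<dots> \<le> (t - s) * (D / 2)" using pairsD(3)[OF p True] assms(2) by (intro mult_left_mono) auto
    finally show ?thesis by simp
  next
    case False
    then have "snd w \<notin> {s..<t}" using w by (cases w) (auto simp: C_def space_P space_R)
    then have "interp S s p w = interp S t p w" using False assms(2) by (auto simp: interp_def)
    then show ?thesis using nn by simp
  qed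
qed

lemma represents_X: "represents P pairs (interp S 0) X"
  unfolding represents_def
proof (intro conjI X.geo exI)
  interpret P: prob_space P by (rule prob_P)
  interpret U: prob_space U by (rule prob_U)
  \<comment> \<open>Heights range over all reals and lie in the unit interval only almost surely;
    off \<open>S\<close>, time 0 selects the first function exactly for heights at least 0.\<close>
  define W where "W = snd -` {0..} \<inter> space P"
  show q: "fst \<circ> fst \<in> measurable P (meas X)" by (rule measurable_comp[OF fst_P(1) fst_R])
  show "distr P (meas X) (fst \<circ> fst) = meas X"
    using distr_distr[OF fst_R fst_P(1)] fst_P(2) marg_X by simp
  show "W \<in> P.events" unfolding W_def using measurable_sets[OF snd_P(1)] sets_U by auto
  have "U.prob {0..<1} \<le> U.prob {0..}" using sets_U by (intro U.finite_measure_mono) auto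
  then have "U.prob {0..} = 1" using measure_U_Icc[of 0 1] U.prob_le_1[of "{0..}"] by simp
  then show "P.prob W = 1" unfolding W_def using measure_preserving_vimage[OF snd_P, of "{0..}"] sets_U by simp
  have i: "interp S 0 p w = fst p ((fst \<circ> fst) w)" if "w \<in> W" for p w
    using that by (auto simp: interp_def W_def)
  show "\<forall>f\<in>features X. \<exists>p\<in>pairs. \<forall>w\<in>W. f ((fst \<circ> fst) w) = interp S 0 p w"
  proof
    fix f assume f: "f \<in> features X"
    obtain g where "g \<in> feat_closure Y" "\<forall>z\<in>S. \<bar>f (fst z) - g (snd z)\<bar> \<le> D / 2" using fw[OF f] by blast
    then have "(f, g) \<in> pairs" using f X.F_closure by (auto simp: pairs_def)
    then show "\<exists>p\<in>pairs. \<forall>w\<in>W. f ((fst \<circ> fst) w) = interp S 0 p w" using i by (intro bexI[of _ "(f,g)"]) auto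
  qed
  show "\<forall>p\<in>pairs. \<exists>f\<in>feat_closure X. \<forall>w\<in>W. f ((fst \<circ> fst) w) = interp S 0 p w"
    using i pairsD(1) by (metis)
qed

lemma represents_Y: "represents P pairs (interp S 1) Y"
  unfolding represents_def
proof (intro conjI Y.geo exI)
  interpret P: prob_space P by (rule prob_P)
  interpret U: prob_space U by (rule prob_U)
  \<comment> \<open>Off \<open>S\<close>, height 1 still selects the first function at time 1, so
    the interval is half-open; the end point has measure 0.\<close>
  define W where "W = snd -` {0..<1} \<inter> space P"
  show q: "snd \<circ> fst \<in> measurable P (meas Y)" by (rule measurable_comp[OF fst_P(1) snd_R])
  show "distr P (meas Y) (snd \<circ> fst) = meas Y"
    using distr_distr[OF snd_R fst_P(1)] fst_P(2) marg_Y by simp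
  show "W \<in> P.events" unfolding W_def using measurable_sets[OF snd_P(1)] sets_U by auto
  show "P.prob W = 1" unfolding W_def
    using measure_preserving_vimage[OF snd_P, of "{0..<1}"] measure_U_Icc[of 0 1] sets_U by simp
  have i: "interp S 1 p w = snd p ((snd \<circ> fst) w)" if "w \<in> W" for p w
    using that by (auto simp: interp_def W_def)
  show "\<forall>g\<in>features Y. \<exists>p\<in>pairs. \<forall>w\<in>W. g ((snd \<circ> fst) w) = interp S 1 p w"
  proof
    fix g assume g: "g \<in> features Y"
    obtain f where "f \<in> feat_closure X" "\<forall>z\<in>S. \<bar>f (fst z) - g (snd z)\<bar> \<le> D / 2" using bw[OF g] by blast
    then have "(f, g) \<in> pairs" using g Y.F_closure by (auto simp: pairs_def)
    then show "\<exists>p\<in>pairs. \<forall>w\<in>W. g ((snd \<circ> fst) w) = interp S 1 p w" using i by (intro bexI[of _ "(f,g)"]) auto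
  qed
  show "\<forall>p\<in>pairs. \<exists>g\<in>feat_closure Y. \<forall>w\<in>W. g ((snd \<circ> fst) w) = interp S 1 p w"
    using i pairsD(2) by metis
qed

text \<open>Convexity puts the interpolants into \<open>K\<close> pointwise; closedness and full
  support carry this over to all points of \<open>Z\<close>, including those outside the image of
  the quotient map.\<close>

lemma interpolant_range:
  assumes t: "0 \<le> t" "t \<le> 1" and Z: "represents P pairs (interp S t) Z"
    and K: "closed K" "convex K"
    and KX: "\<forall>f\<in>features X. \<forall>x\<in>points X. f x \<in> K"
    and KY: "\<forall>f\<in>features Y. \<forall>x\<in>points Y. f x \<in> K"
  shows "\<forall>f\<in>features Z. \<forall>z\<in>points Z. f z \<in> K"
proof (intro ballI)
  fix f z assume f: "f \<in> features Z" "z \<in> points Z"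
  obtain q W where q: "geo_data_set Z" "q \<in> measurable P (meas Z)" "distr P (meas Z) q = meas Z"
     "W \<in> sets P" "measure P W = 1" "\<forall>f\<in>features Z. \<exists>i\<in>pairs. \<forall>w\<in>W. f (q w) = interp S t i w"
     "\<forall>i\<in>pairs. \<exists>f\<in>feat_closure Z. \<forall>w\<in>W. f (q w) = interp S t i w"
    using Z unfolding represents_def by (elim exE conjE)
  interpret Z: geo Z by unfold_locales fact
  have fZ: "f \<in> feat_closure Z" using f Z.F_closure by blast
  obtain p where p: "p \<in> pairs" "\<forall>w\<in>W. f (q w) = interp S t p w" using q(6) f(1) by blast
  show "f z \<in> K"
  proof (rule range_extends[OF q(1) prob_P q(2-5) K(1) fZ _ f(2)])
    fix w assume w: "w \<in> W"
    then have "w \<in> space P" using sets.sets_into_space[OF q(4)] by blast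
    then have "fst p (fst (fst w)) \<in> K" "snd p (snd (fst w)) \<in> K"
      using closure_range[OF X.geo K(1) KX pairsD(1)[OF p(1)]] closure_range[OF Y.geo K(1) KY pairsD(2)[OF p(1)]]
      by (auto simp: space_P)
    then have "interp S t p w \<in> K"
      using convexD_alt[OF K(2), of "fst p (fst (fst w))" "snd p (snd (fst w))" t] t by (auto simp: interp_def)
    then show "f (q w) \<in> K" using p(2) w by simp
  qed
qed

end

section \<open>Geodesics\<close>

definition rep :: "real geo_data set \<Rightarrow> real geo_data" where
  "rep A = (SOME X. X \<in> A)"

lemma box_class_rep: "box_class A B = box_dist (rep A) (rep B)"
  by (simp add: box_class_def rep_def)

lemma iso_class_in_data_sets:
  assumes "geo_data_set Z" shows "iso_rel `` {Z} \<in> data_sets"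
  using assms unfolding data_sets_def by (auto intro: quotientI)

text \<open>Isomorphism is reflexive, so the class contains \<open>Z\<close> and the choice made by
  \<open>rep\<close> is a genuine member.\<close>

lemma iso_class_rep:
  assumes "geo_data_set Z"
  shows "geo_data_set (rep (iso_rel `` {Z}))" "isomorphic Z (rep (iso_rel `` {Z}))"
proof -
  have "Z \<in> iso_rel `` {Z}" using assms isomorphic_refl[OF assms] by (auto simp: iso_rel_def)
  then have "rep (iso_rel `` {Z}) \<in> iso_rel `` {Z}" unfolding rep_def by (rule someI)
  then show "geo_data_set (rep (iso_rel `` {Z}))" "isomorphic Z (rep (iso_rel `` {Z}))"
    by (auto simp: iso_rel_def)
qed

lemma rep_in:
  assumes "A \<in> data_sets"
  shows "rep A \<in> A" "geo_data_set (rep A)"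
proof -
  obtain Z where Z: "geo_data_set Z" "A = iso_rel `` {Z}" using assms by (auto simp: data_sets_def elim: quotientE)
  have "Z \<in> A" using Z isomorphic_refl[OF Z(1)] by (auto simp: iso_rel_def)
  then show "rep A \<in> A" unfolding rep_def by (rule someI)
  show "geo_data_set (rep A)" using iso_class_rep(1)[OF Z(1)] Z(2) by simp
qed

lemma interpolation_geodesic:
  assumes A: "A \<in> data_sets" and B: "B \<in> data_sets"
    and I: "interpolation (rep A) (rep B) R S (box_class A B)"
  shows "\<exists>\<gamma>\<in>{0..1} \<rightarrow> data_sets. box_geodesic \<gamma> A B \<and>
    (A \<in> data_sets_K \<longrightarrow> B \<in> data_sets_K \<longrightarrow> \<gamma> \<in> {0..1} \<rightarrow> data_sets_K)"
proof -
  define D where "D = box_class A B"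
  interpret interpolation "rep A" "rep B" R S D using I by (simp add: D_def)
  have "\<exists>Z :: ((((real \<times> real) \<times> real \<Rightarrow> real) \<Rightarrow> real) geo_data). 0 \<le> t \<longrightarrow> t \<le> 1 \<longrightarrow> represents P pairs (interp S t) Z" for t
    using ex_interpolant by blast
  then obtain Z :: "real \<Rightarrow> (((real \<times> real) \<times> real \<Rightarrow> real) \<Rightarrow> real) geo_data"
    where Z: "\<And>t. 0 \<le> t \<Longrightarrow> t \<le> 1 \<Longrightarrow> represents P pairs (interp S t) (Z t)" by metis
  have gZ: "geo_data_set (Z t)" if "0 \<le> t" "t \<le> 1" for t
    using Z[OF that] by (simp add: represents_def)
  \<comment> \<open>The interpolants live on a type of functions, while classes consist of data sets
    on the reals.\<close>
  have "\<exists>Q :: real geo_data. 0 \<le> t \<longrightarrow> t \<le> 1 \<longrightarrow> geo_data_set Q \<and> isomorphic (Z t) Q" for t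
    using geo_data_set_real_representative[OF gZ[of t]] by blast
  then obtain Q :: "real \<Rightarrow> real geo_data"
    where Q: "\<And>t. 0 \<le> t \<Longrightarrow> t \<le> 1 \<Longrightarrow> geo_data_set (Q t)" "\<And>t. 0 \<le> t \<Longrightarrow> t \<le> 1 \<Longrightarrow> isomorphic (Z t) (Q t)"
    by metis
  \<comment> \<open>The end points are set by hand: \<open>Z 0\<close> and \<open>Z 1\<close> are
    shown to have distance 0 from the representatives of \<open>A\<close> and \<open>B\<close>,
    whereas a geodesic must start and end at the classes themselves.\<close>
  define \<gamma> where "\<gamma> t = (if t = 0 then A else if t = 1 then B else iso_rel `` {Q t})" for t
  have \<gamma>D: "\<gamma> t \<in> data_sets" if "0 \<le> t" "t \<le> 1" for t
    using A B iso_class_in_data_sets[OF Q(1)[OF that]] by (simp add: \<gamma>_def)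
  have g\<gamma>: "geo_data_set (rep (\<gamma> t))" if "0 \<le> t" "t \<le> 1" for t using rep_in(2)[OF \<gamma>D[OF that]] .
  have z0: "box_dist (Z t) (rep (\<gamma> t)) = 0" if t: "0 \<le> t" "t \<le> 1" for t
  proof -
    consider "t = 0" | "t = 1" | "t \<noteq> 0" "t \<noteq> 1" by blast
    then show ?thesis
    proof cases
      case 1
      have "box_dist (rep A) (Z 0) \<le> (0 - 0) * D"
        by (rule interpolants_box_dist[OF _ _ _ represents_X Z]) auto
      then show ?thesis using 1 box_dist_nonneg[of "Z 0" "rep A"] box_dist_commute[OF gZ[OF t] g\<gamma>[OF t]] by (simp add: \<gamma>_def)
    next
      case 2
      have "box_dist (Z 1) (rep B) \<le> (1 - 1) * D"
        by (rule interpolants_box_dist[OF _ _ _ Z represents_Y]) auto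
      then show ?thesis using 2 box_dist_nonneg[of "Z 1" "rep B"] by (simp add: \<gamma>_def)
    next
      case 3
      have "box_dist (Z t) (Q t) = 0" using isomorphic_imp_box_dist_0[OF gZ[OF t] Q(1)[OF t] Q(2)[OF t]] .
      moreover have "box_dist (Q t) (rep (\<gamma> t)) = 0"
        using isomorphic_imp_box_dist_0[OF Q(1)[OF t] iso_class_rep[OF Q(1)[OF t]]] 3 by (simp add: \<gamma>_def)
      ultimately show ?thesis
        using box_dist_triangle[OF gZ[OF t] Q(1)[OF t] g\<gamma>[OF t]] box_dist_nonneg[of "Z t" "rep (\<gamma> t)"] by linarith
    qed
  qed
  have up: "box_class (\<gamma> s) (\<gamma> t) \<le> (t - s) * D" if st: "0 \<le> s" "s \<le> t" "t \<le> 1" for s t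
  proof -
    have s: "0 \<le> s" "s \<le> 1" and t: "0 \<le> t" "t \<le> 1" using st by auto
    have "box_dist (rep (\<gamma> s)) (rep (\<gamma> t)) \<le> box_dist (rep (\<gamma> s)) (Z s) + box_dist (Z s) (rep (\<gamma> t))"
      by (rule box_dist_triangle[OF g\<gamma>[OF s] gZ[OF s] g\<gamma>[OF t]])
    also have "\<dots> \<le> box_dist (rep (\<gamma> s)) (Z s) + (box_dist (Z s) (Z t) + box_dist (Z t) (rep (\<gamma> t)))"
      by (intro add_left_mono box_dist_triangle[OF gZ[OF s] gZ[OF t] g\<gamma>[OF t]])
    also have "\<dots> = box_dist (Z s) (Z t)"
      using z0[OF s] z0[OF t] box_dist_commute[OF gZ[OF s] g\<gamma>[OF s]] by simp
    also have "\<dots> \<le> (t - s) * D" by (rule interpolants_box_dist[OF st Z[OF s] Z[OF t]])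
    finally show ?thesis by (simp add: box_class_rep)
  qed
  have tri: "box_class (\<gamma> a) (\<gamma> c) \<le> box_class (\<gamma> a) (\<gamma> b) + box_class (\<gamma> b) (\<gamma> c)"
    if "0 \<le> a" "a \<le> 1" "0 \<le> b" "b \<le> 1" "0 \<le> c" "c \<le> 1" for a b c
    unfolding box_class_rep by (intro box_dist_triangle g\<gamma> that)
  have ends: "\<gamma> 0 = A" "\<gamma> 1 = B" by (simp_all add: \<gamma>_def)
  \<comment> \<open>If the piece from \<open>s\<close> to \<open>t\<close> were shorter than its
    share, the route through 0, \<open>s\<close>, \<open>t\<close>, 1 would be shorter than
    \<open>D\<close>.\<close>
  have eq: "box_class (\<gamma> s) (\<gamma> t) = (t - s) * D" if st: "0 \<le> s" "s \<le> t" "t \<le> 1" for s t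
  proof (rule antisym[OF up[OF st]])
    have "D \<le> box_class (\<gamma> 0) (\<gamma> s) + (box_class (\<gamma> s) (\<gamma> t) + box_class (\<gamma> t) (\<gamma> 1))"
      using tri[of 0 s 1] tri[of s t 1] st unfolding D_def ends by simp
    also have "\<dots> \<le> (s - 0) * D + (box_class (\<gamma> s) (\<gamma> t) + (1 - t) * D)"
      using up[of 0 s] up[of t 1] st by simp
    finally show "(t - s) * D \<le> box_class (\<gamma> s) (\<gamma> t)" by (simp add: algebra_simps)
  qed
  have "box_class (\<gamma> s) (\<gamma> t) = \<bar>s - t\<bar> * D" if "s \<in> {0..1}" "t \<in> {0..1}" for s t
  proof (cases "s \<le> t")
    case True
    then show ?thesis using eq[of s t] that by simp
  next
    case False
    have "box_class (\<gamma> s) (\<gamma> t) = box_class (\<gamma> t) (\<gamma> s)"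
      unfolding box_class_rep using that by (intro box_dist_commute g\<gamma>) auto
    then show ?thesis using eq[of t s] that False by simp
  qed
  then have geod: "box_geodesic \<gamma> A B" by (simp add: box_geodesic_def ends D_def)
  have "\<gamma> \<in> {0..1} \<rightarrow> data_sets_K" if AK: "A \<in> data_sets_K" and BK: "B \<in> data_sets_K"
  proof
    fix t :: real assume "t \<in> {0..1}"
    then have t: "0 \<le> t" "t \<le> 1" by auto
    let ?K = "{-1/2..1/2::real}"
    have K: "closed ?K" "convex ?K" by auto
    have KA: "\<forall>f\<in>features (rep A). \<forall>x\<in>points (rep A). f x \<in> ?K"
      using AK rep_in(1)[OF A] unfolding data_sets_K_def by blast
    have KB: "\<forall>f\<in>features (rep B). \<forall>x\<in>points (rep B). f x \<in> ?K"
      using BK rep_in(1)[OF B] unfolding data_sets_K_def by blast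
    have KZ: "\<forall>f\<in>features (Z t). \<forall>x\<in>points (Z t). f x \<in> ?K"
      by (rule interpolant_range[OF t Z[OF t] K KA KB])
    have KQ: "\<forall>f\<in>features (Q t). \<forall>x\<in>points (Q t). f x \<in> ?K"
      by (rule isomorphic_range[OF gZ[OF t] Q(1)[OF t] Q(2)[OF t] K(1) KZ])
    have "\<forall>f\<in>features V. \<forall>x\<in>points V. f x \<in> ?K" if "V \<in> iso_rel `` {Q t}" for V
    proof -
      have V: "geo_data_set V" "isomorphic (Q t) V" using that by (auto simp: iso_rel_def)
      show ?thesis by (rule isomorphic_range[OF Q(1)[OF t] V K(1) KQ])
    qed
    then have "iso_rel `` {Q t} \<in> data_sets_K"
      unfolding data_sets_K_def using iso_class_in_data_sets[OF Q(1)[OF t]] by blast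
    then show "\<gamma> t \<in> data_sets_K" using AK BK by (simp add: \<gamma>_def)
  qed
  moreover have "\<gamma> \<in> {0..1} \<rightarrow> data_sets" using \<gamma>D by auto
  ultimately show ?thesis using geod by blast
qed

text \<open>The attained optimum supplies everything but \<open>fin\<close>. For that, a fixed point
  of \<open>S\<close> bounds |f x - g y| by the distances to its coordinates plus half the box
  distance, uniformly over matched pairs.\<close>

lemma interpolation_of_box_lt_1:
  assumes gX: "geo_data_set X" and gY: "geo_data_set Y" and D1: "box_dist X Y < 1"
  shows "\<exists>R S. interpolation X Y R S (box_dist X Y)"
proof -
  interpret X: geo X by unfold_locales fact
  interpret Y: geo Y by unfold_locales fact
  obtain R S where R: "prob_space R" "sets R = sets (meas X \<Otimes>\<^sub>M meas Y)" "distr R (meas X) fst = meas X"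
    "distr R (meas Y) snd = meas Y" "S \<in> sets R" "S \<noteq> {}" "measure R S \<ge> 1 - box_dist X Y"
    "\<forall>f\<in>features X. \<exists>g\<in>feat_closure Y. \<forall>z\<in>S. \<bar>f (fst z) - g (snd z)\<bar> \<le> box_dist X Y / 2"
    "\<forall>g\<in>features Y. \<exists>f\<in>feat_closure X. \<forall>z\<in>S. \<bar>f (fst z) - g (snd z)\<bar> \<le> box_dist X Y / 2"
    using box_dist_attained[OF gX gY D1] by (elim exE conjE)
  obtain z where z: "z \<in> S" using R(6) by blast
  have "space R = points X \<times> points Y" using sets_eq_imp_space_eq[OF R(2)] by (simp add: space_pair_measure)
  then have zp: "fst z \<in> points X" "snd z \<in> points Y" using z sets.sets_into_space[OF R(5)] by auto
  have "\<bar>f x - g y\<bar> \<le> feat_dist X x (fst z) + box_dist X Y / 2 + feat_dist Y (snd z) y"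
    if "x \<in> points X" "y \<in> points Y" "f \<in> feat_closure X" "g \<in> feat_closure Y"
      "\<forall>z\<in>S. \<bar>f (fst z) - g (snd z)\<bar> \<le> box_dist X Y / 2" for x y f g
  proof -
    have "\<bar>f (fst z) - g (snd z)\<bar> \<le> box_dist X Y / 2" using that(5) z by blast
    with X.closure_lipschitz[OF that(3,1) zp(1)]
    have "\<bar>f x - g (snd z)\<bar> \<le> feat_dist X x (fst z) + box_dist X Y / 2" by (rule abs_chain) simp
    then show ?thesis using Y.closure_lipschitz[OF that(4) zp(2) that(2)] by (rule abs_chain) simp
  qed
  then have fin: "\<exists>b. \<forall>f\<in>feat_closure X. \<forall>g\<in>feat_closure Y.
      (\<forall>z\<in>S. \<bar>f (fst z) - g (snd z)\<bar> \<le> box_dist X Y / 2) \<longrightarrow> \<bar>f x - g y\<bar> \<le> b"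
    if "x \<in> points X" "y \<in> points Y" for x y
    using that by blast
  interpret R: prob_space R by fact
  have "interpolation X Y R S (box_dist X Y)"
  proof unfold_locales
    show "\<exists>g\<in>feat_closure Y. \<forall>z\<in>S. \<bar>f (fst z) - g (snd z)\<bar> \<le> box_dist X Y / 2" if "f \<in> features X" for f
      using R(8) that by blast
    show "\<exists>f\<in>feat_closure X. \<forall>z\<in>S. \<bar>f (fst z) - g (snd z)\<bar> \<le> box_dist X Y / 2" if "g \<in> features Y" for g
      using R(9) that by blast
  qed (fact R box_dist_nonneg fin)+
  then show ?thesis by blast
qed

text \<open>At distance \<open>1\<close> nothing needs to be matched: \<open>S = {}\<close> and the product coupling do.\<close>

lemma interpolation_of_bounded:
  assumes gX: "geo_data_set X" and gY: "geo_data_set Y" and D1: "box_dist X Y = 1"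
    and KX: "\<forall>f\<in>features X. \<forall>x\<in>points X. f x \<in> {-1/2..1/2}"
    and KY: "\<forall>f\<in>features Y. \<forall>x\<in>points Y. f x \<in> {-1/2..1/2}"
  shows "interpolation X Y (meas X \<Otimes>\<^sub>M meas Y) {} (box_dist X Y)"
proof -
  interpret X: geo X by unfold_locales fact
  interpret Y: geo Y by unfold_locales fact
  note R = product_marginals[OF X.prob_meas Y.prob_meas]
  interpret R: prob_space "meas X \<Otimes>\<^sub>M meas Y" by (rule R(3))
  \<comment> \<open>Both values lie in an interval of length 1, which gives \<open>fin\<close>
    without any point of \<open>S\<close>.\<close>
  have "\<bar>f x - g y\<bar> \<le> 1" if "x \<in> points X" "y \<in> points Y" "f \<in> feat_closure X" "g \<in> feat_closure Y" for x y f g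
    using closure_range[OF gX closed_atLeastAtMost KX that(3,1)] closure_range[OF gY closed_atLeastAtMost KY that(4,2)]
    by (auto simp: abs_le_iff)
  then have "\<exists>b. \<forall>f\<in>feat_closure X. \<forall>g\<in>feat_closure Y. \<bar>f x - g y\<bar> \<le> b"
    if "x \<in> points X" "y \<in> points Y" for x y using that by blast
  moreover have "feat_closure X \<noteq> {}" "feat_closure Y \<noteq> {}"
    using X.F_ne Y.F_ne X.F_closure Y.F_closure by blast+
  ultimately show ?thesis
    by unfold_locales (use R D1 in auto)
qed

theorem theorem4p5:
  shows "(\<forall>A\<in>data_sets_K. \<forall>B\<in>data_sets_K.
            \<exists>\<gamma> \<in> {0..1} \<rightarrow> data_sets_K. box_geodesic \<gamma> A B) \<and>
         (\<forall>A\<in>data_sets. \<forall>B\<in>data_sets. box_class A B < 1 \<longrightarrow>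
            (\<exists>\<gamma> \<in> {0..1} \<rightarrow> data_sets. box_geodesic \<gamma> A B))"
proof (intro conjI ballI impI)
  fix A B assume AB: "A \<in> data_sets_K" "B \<in> data_sets_K"
  then have A: "A \<in> data_sets" and B: "B \<in> data_sets" by (auto simp: data_sets_K_def)
  have "\<exists>R S. interpolation (rep A) (rep B) R S (box_class A B)"
  proof (cases "box_class A B < 1")
    case True
    then show ?thesis using interpolation_of_box_lt_1[OF rep_in(2)[OF A] rep_in(2)[OF B]] by (simp add: box_class_rep)
  next
    \<comment> \<open>The box distance never exceeds 1, so the remaining case is distance exactly
      1.\<close>
    case False
    then have "box_dist (rep A) (rep B) = 1"
      using box_dist_le_1[OF rep_in(2)[OF A] rep_in(2)[OF B]] by (simp add: box_class_rep)
    moreover have "\<forall>f\<in>features (rep A). \<forall>x\<in>points (rep A). f x \<in> {-1/2..1/2}"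
      "\<forall>f\<in>features (rep B). \<forall>x\<in>points (rep B). f x \<in> {-1/2..1/2}"
      using AB rep_in(1)[OF A] rep_in(1)[OF B] unfolding data_sets_K_def by blast+
    ultimately show ?thesis
      using interpolation_of_bounded[OF rep_in(2)[OF A] rep_in(2)[OF B]] unfolding box_class_rep by blast
  qed
  then show "\<exists>\<gamma> \<in> {0..1} \<rightarrow> data_sets_K. box_geodesic \<gamma> A B"
    using interpolation_geodesic[OF A B] AB by blast
next
  fix A B assume AB: "A \<in> data_sets" "B \<in> data_sets" "box_class A B < 1"
  then have "\<exists>R S. interpolation (rep A) (rep B) R S (box_class A B)"
    using interpolation_of_box_lt_1[OF rep_in(2)[OF AB(1)] rep_in(2)[OF AB(2)]] by (simp add: box_class_rep)
  then show "\<exists>\<gamma> \<in> {0..1} \<rightarrow> data_sets. box_geodesic \<gamma> A B"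
    using interpolation_geodesic[OF AB(1,2)] by blast
qed

end
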